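(* Let $B=(B_m,g_B)$ and $F=(F_k,g_F)$ be two pseudo-Riemannian manifolds of dimensions $m\ge 2$ and $k\ge 0$, respectively, with scalar curvatures $S_B$ and $S_F$. Let $\mu\in\mathbb{R}$ be a parameter and let $\psi\in C^\infty_{>0}(B)$. Then the scalar curvature $S$ of the product manifold $B\times F$ with the metric $g=\psi^{2\mu}g_B+\psi^2 g_F$ satisfies the following. (i) If $\mu\neq -\frac{k}{m-1}$, then $$-\beta\,\Delta_B u+S_B u=S\,u^{2\mu\alpha+1}-S_F\,u^{2(\mu-1)\alpha+1},$$ where $$\alpha=\frac{2[k+(m-1)\mu]}{\{[k+(m-1)\mu]+(1-\mu)\}k+(m-2)\mu[k+(m-1)\mu]},\qquad \beta=2\alpha[k+(m-1)\mu]>0,$$ and $\psi=u^\alpha>0$. (ii) If $\mu=-\frac{k}{m-1}$, then $$-\left[-k^2\frac{m-2}{m-1}+k(k+1)\right]\frac{|\nabla^B\psi|_B^2}{\psi^2}=\psi^{-2\frac{k}{m-1}}S-S_B-S_F\,\psi^{-2\left(\frac{k}{m-1}+1\right)}.$$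
   Context: Manifolds are smooth and connected. $C^\infty_{>0}(B)$ is the set of smooth positive functions on $B$. $\Delta_B=\nabla^{B\,i}\nabla^B_i$ is the Laplace–Beltrami operator of $(B,g_B)$ (trace of the Hessian), $\nabla^B$ is the gradient, and $|\nabla^B\psi|_B^2=g_B(\nabla^B\psi,\nabla^B\psi)$. Functions and metrics on $B$ and $F$ are identified with their pullbacks to $B\times F$ by the projections, so $g=(\psi\circ\pi)^{2\mu}\pi^*g_B+(\psi\circ\pi)^2\sigma^*g_F$ with projections $\pi:B\times F\to B$, $\sigma:B\times F\to F$. Curvature sign convention: $R(X,Y)Z=\nabla_X\nabla_YZ-\nabla_Y\nabla_XZ-\nabla_{[X,Y]}Z$, $\mathrm{Ric}(X,Y)=\sum_i h(E_i,E_i)h(R(E_i,Y)X,E_i)$ for an orthonormal frame, and scalar curvature is the metric trace of $\mathrm{Ric}$ (round spheres have positive scalar curvature). When $k=0$ the fiber is a point and $S_F=0$.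
   Formalization: Part (i) excludes the case m = 2, k = 0, in which the denominator of α is zero, so that α and β are undefined; part (ii) has no such exclusion. *)

theory Defs
  imports "HOL-Analysis.Analysis"
begin

text \<open>
  No manifold library is assumed.  Manifolds of arbitrary dimension \<open>n :: nat\<close> (including
  \<open>n = 0\<close>) are modelled on the library's \<^const>\<open>Euclidean_space\<close> \<open>n\<close>, whose points are the
  functions \<open>x :: nat \<Rightarrow> real\<close> with \<open>x i = 0\<close> for all \<open>i \<ge> n\<close>.  Indices run over \<open>{..<n}\<close>.
\<close>

section \<open>Smooth functions of several real variables\<close>

definition pdiff :: "nat \<Rightarrow> ((nat \<Rightarrow> real) \<Rightarrow> real) \<Rightarrow> (nat \<Rightarrow> real) \<Rightarrow> real" where
  "pdiff i f x = deriv (\<lambda>t. f (x(i := t))) (x i)"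

primrec iter_pdiff :: "nat list \<Rightarrow> ((nat \<Rightarrow> real) \<Rightarrow> real) \<Rightarrow> (nat \<Rightarrow> real) \<Rightarrow> real" where
  "iter_pdiff [] f = f"
| "iter_pdiff (i # js) f = pdiff i (iter_pdiff js f)"

text \<open>To be used for open subsets \<open>U\<close> of \<open>Euclidean_space n\<close>: all iterated partial
  derivatives exist on \<open>U\<close> and are continuous there.\<close>

definition smooth_on :: "nat \<Rightarrow> (nat \<Rightarrow> real) set \<Rightarrow> ((nat \<Rightarrow> real) \<Rightarrow> real) \<Rightarrow> bool" where
  "smooth_on n U f \<longleftrightarrow>
     (\<forall>js. set js \<subseteq> {..<n} \<longrightarrow>
        continuous_map (subtopology (Euclidean_space n) U) euclideanreal (iter_pdiff js f) \<and>
        (\<forall>x\<in>U. \<forall>i<n. (\<lambda>t. iter_pdiff js f (x(i := t))) differentiable at (x i)))"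

section \<open>Smooth manifolds\<close>

record 'a chart =
  chart_dom :: "'a set"
  chart_map :: "'a \<Rightarrow> nat \<Rightarrow> real"

abbreviation chart_inv :: "'a chart \<Rightarrow> (nat \<Rightarrow> real) \<Rightarrow> 'a" where
  "chart_inv c \<equiv> inv_into (chart_dom c) (chart_map c)"

text \<open>Besides an atlas, a manifold carries a choice of a chart around each point.  The quantities
  that are evaluated below in that chart (tensorial expressions in local coordinates) do not depend
  on the choice.\<close>

record 'a manifold =
  mtop :: "'a topology"
  mdim :: nat
  atlas :: "'a chart set"
  chart_at :: "'a \<Rightarrow> 'a chart"

abbreviation points :: "('a, 'z) manifold_scheme \<Rightarrow> 'a set" where
  "points M \<equiv> topspace (mtop M)"

definition smooth_map_on :: "('a, 'z) manifold_scheme \<Rightarrow> 'a set \<Rightarrow> ('a \<Rightarrow> real) \<Rightarrow> bool" where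
  "smooth_map_on M V f \<longleftrightarrow>
     (\<forall>c \<in> atlas M. smooth_on (mdim M) (chart_map c ` (V \<inter> chart_dom c)) (f \<circ> chart_inv c))"

definition smooth_near :: "('a, 'z) manifold_scheme \<Rightarrow> 'a \<Rightarrow> ('a \<Rightarrow> real) \<Rightarrow> bool" where
  "smooth_near M p f \<longleftrightarrow> (\<exists>V. openin (mtop M) V \<and> p \<in> V \<and> smooth_map_on M V f)"

definition smooth_manifold :: "('a, 'z) manifold_scheme \<Rightarrow> bool" where
  "smooth_manifold M \<longleftrightarrow>
     Hausdorff_space (mtop M) \<and> second_countable (mtop M) \<and>
     connected_space (mtop M) \<and> points M \<noteq> {} \<and>
     (\<forall>p \<in> points M. chart_at M p \<in> atlas M \<and> p \<in> chart_dom (chart_at M p)) \<and>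
     (\<forall>c \<in> atlas M.
        openin (mtop M) (chart_dom c) \<and>
        openin (Euclidean_space (mdim M)) (chart_map c ` chart_dom c) \<and>
        homeomorphic_map (subtopology (mtop M) (chart_dom c))
          (subtopology (Euclidean_space (mdim M)) (chart_map c ` chart_dom c)) (chart_map c)) \<and>
     (\<forall>c \<in> atlas M. \<forall>d \<in> atlas M. \<forall>i < mdim M.
        smooth_on (mdim M) (chart_map c ` (chart_dom c \<inter> chart_dom d))
          (\<lambda>x. chart_map d (chart_inv c x) i))"

section \<open>Tangent vectors\<close>

text \<open>Tangent vectors at \<open>p\<close> are directional derivatives acting on functions that are smooth near
  \<open>p\<close>.  They are totalised by the value \<open>0\<close> on all other functions, so that equality of tangent
  vectors is equality of HOL functions.\<close>

type_synonym 'a tvec = "('a \<Rightarrow> real) \<Rightarrow> real"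

definition coord_vec :: "('a, 'z) manifold_scheme \<Rightarrow> 'a chart \<Rightarrow> 'a \<Rightarrow> nat \<Rightarrow> 'a tvec" where
  "coord_vec M c p i =
     (\<lambda>f. if smooth_near M p f then pdiff i (f \<circ> chart_inv c) (chart_map c p) else 0)"

definition tangent_space :: "('a, 'z) manifold_scheme \<Rightarrow> 'a \<Rightarrow> 'a tvec set" where
  "tangent_space M p =
     {v. \<exists>c \<in> atlas M. p \<in> chart_dom c \<and>
          (\<exists>a. v = (\<lambda>f. \<Sum>i<mdim M. a i * coord_vec M c p i f))}"

definition pushforward ::
  "('b, 'z) manifold_scheme \<Rightarrow> ('a \<Rightarrow> 'b) \<Rightarrow> 'b \<Rightarrow> 'a tvec \<Rightarrow> 'b tvec" where
  "pushforward N h q v = (\<lambda>f. if smooth_near N q f then v (f \<circ> h) else 0)"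

section \<open>Pseudo-Riemannian manifolds\<close>

record 'a pr_manifold = "'a manifold" +
  metric :: "'a \<Rightarrow> 'a tvec \<Rightarrow> 'a tvec \<Rightarrow> real"

definition metric_comp ::
  "('a, 'z) pr_manifold_scheme \<Rightarrow> 'a chart \<Rightarrow> (nat \<Rightarrow> real) \<Rightarrow> nat \<Rightarrow> nat \<Rightarrow> real" where
  "metric_comp M c x i j =
     (let p = chart_inv c x in metric M p (coord_vec M c p i) (coord_vec M c p j))"

text \<open>The index of the metric need not be required to be constant: it is, by connectedness.\<close>

definition pseudo_riemannian :: "('a, 'z) pr_manifold_scheme \<Rightarrow> bool" where
  "pseudo_riemannian M \<longleftrightarrow>
     smooth_manifold M \<and>
     (\<forall>p \<in> points M.
        (\<forall>u \<in> tangent_space M p. \<forall>v \<in> tangent_space M p. metric M p u v = metric M p v u) \<and>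
        (\<forall>u \<in> tangent_space M p. \<forall>v \<in> tangent_space M p. \<forall>w \<in> tangent_space M p. \<forall>a b.
           metric M p (\<lambda>f. a * u f + b * v f) w = a * metric M p u w + b * metric M p v w) \<and>
        (\<forall>u \<in> tangent_space M p.
           (\<forall>v \<in> tangent_space M p. metric M p u v = 0) \<longrightarrow> u = (\<lambda>f. 0))) \<and>
     (\<forall>c \<in> atlas M. \<forall>i < mdim M. \<forall>j < mdim M.
        smooth_on (mdim M) (chart_map c ` chart_dom c) (\<lambda>x. metric_comp M c x i j))"

section \<open>Metric trace, Levi-Civita connection and curvature in local coordinates\<close>

text \<open>Here \<open>h\<close> is the component matrix of a scalar product on \<open>\<real>\<^sup>n\<close> and \<open>G x\<close> that of the
  metric at the point with coordinates \<open>x\<close>.\<close>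

definition inner_by :: "nat \<Rightarrow> (nat \<Rightarrow> nat \<Rightarrow> real) \<Rightarrow> (nat \<Rightarrow> real) \<Rightarrow> (nat \<Rightarrow> real) \<Rightarrow> real" where
  "inner_by n h u v = (\<Sum>i<n. \<Sum>j<n. h i j * u i * v j)"

definition orthonormal_frame ::
  "nat \<Rightarrow> (nat \<Rightarrow> nat \<Rightarrow> real) \<Rightarrow> (nat \<Rightarrow> nat \<Rightarrow> real) \<Rightarrow> bool" where
  "orthonormal_frame n h E \<longleftrightarrow>
     (\<forall>i<n. \<bar>inner_by n h (E i) (E i)\<bar> = 1) \<and>
     (\<forall>i<n. \<forall>j<n. i \<noteq> j \<longrightarrow> inner_by n h (E i) (E j) = 0)"

text \<open>For a bilinear form \<open>T\<close> the trace is the same for every orthonormal frame.\<close>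

definition metric_trace ::
  "nat \<Rightarrow> (nat \<Rightarrow> nat \<Rightarrow> real) \<Rightarrow> ((nat \<Rightarrow> real) \<Rightarrow> (nat \<Rightarrow> real) \<Rightarrow> real) \<Rightarrow> real" where
  "metric_trace n h T =
     (let E = (SOME E. orthonormal_frame n h E)
      in \<Sum>i<n. inner_by n h (E i) (E i) * T (E i) (E i))"

definition inverse_matrix :: "nat \<Rightarrow> (nat \<Rightarrow> nat \<Rightarrow> real) \<Rightarrow> nat \<Rightarrow> nat \<Rightarrow> real" where
  "inverse_matrix n h =
     (THE k. (\<forall>i<n. \<forall>j<n. (\<Sum>l<n. k i l * h l j) = (if i = j then 1 else 0)) \<and>
             (\<forall>i j. n \<le> i \<or> n \<le> j \<longrightarrow> k i j = 0))"

text \<open>\<open>christoffel n G l i j\<close> is $\Gamma^l_{ij}$.\<close>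

definition christoffel ::
  "nat \<Rightarrow> ((nat \<Rightarrow> real) \<Rightarrow> nat \<Rightarrow> nat \<Rightarrow> real) \<Rightarrow> nat \<Rightarrow> nat \<Rightarrow> nat \<Rightarrow> (nat \<Rightarrow> real) \<Rightarrow> real" where
  "christoffel n G l i j x =
     (\<Sum>r<n. inverse_matrix n (G x) l r *
        (pdiff i (\<lambda>y. G y j r) x + pdiff j (\<lambda>y. G y i r) x - pdiff r (\<lambda>y. G y i j) x)) / 2"

type_synonym vfield = "(nat \<Rightarrow> real) \<Rightarrow> nat \<Rightarrow> real"

definition cov_deriv ::
  "nat \<Rightarrow> ((nat \<Rightarrow> real) \<Rightarrow> nat \<Rightarrow> nat \<Rightarrow> real) \<Rightarrow> vfield \<Rightarrow> vfield \<Rightarrow> vfield" where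
  "cov_deriv n G X Y = (\<lambda>x l. \<Sum>i<n. X x i *
     (pdiff i (\<lambda>y. Y y l) x + (\<Sum>j<n. christoffel n G l i j x * Y x j)))"

definition lie_bracket :: "nat \<Rightarrow> vfield \<Rightarrow> vfield \<Rightarrow> vfield" where
  "lie_bracket n X Y = (\<lambda>x l. \<Sum>i<n. X x i * pdiff i (\<lambda>y. Y y l) x - Y x i * pdiff i (\<lambda>y. X y l) x)"

definition curvature ::
  "nat \<Rightarrow> ((nat \<Rightarrow> real) \<Rightarrow> nat \<Rightarrow> nat \<Rightarrow> real) \<Rightarrow> vfield \<Rightarrow> vfield \<Rightarrow> vfield \<Rightarrow> vfield" where
  "curvature n G X Y Z = (\<lambda>x l.
     cov_deriv n G X (cov_deriv n G Y Z) x l - cov_deriv n G Y (cov_deriv n G X Z) x l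
     - cov_deriv n G (lie_bracket n X Y) Z x l)"

text \<open>Curvature and Hessian are tensorial, so that tangent vectors may be extended to vector
  fields with constant coefficients.\<close>

definition ricci ::
  "nat \<Rightarrow> ((nat \<Rightarrow> real) \<Rightarrow> nat \<Rightarrow> nat \<Rightarrow> real) \<Rightarrow> (nat \<Rightarrow> real) \<Rightarrow>
   (nat \<Rightarrow> real) \<Rightarrow> (nat \<Rightarrow> real) \<Rightarrow> real" where
  "ricci n G x u v = metric_trace n (G x)
     (\<lambda>a b. inner_by n (G x) (curvature n G (\<lambda>_. a) (\<lambda>_. v) (\<lambda>_. u) x) b)"

definition hessian ::
  "nat \<Rightarrow> ((nat \<Rightarrow> real) \<Rightarrow> nat \<Rightarrow> nat \<Rightarrow> real) \<Rightarrow> ((nat \<Rightarrow> real) \<Rightarrow> real) \<Rightarrow> (nat \<Rightarrow> real) \<Rightarrow>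
   (nat \<Rightarrow> real) \<Rightarrow> (nat \<Rightarrow> real) \<Rightarrow> real" where
  "hessian n G f x u v =
     (\<Sum>i<n. \<Sum>j<n. u i * v j *
        (pdiff i (pdiff j f) x - (\<Sum>l<n. christoffel n G l i j x * pdiff l f x)))"

section \<open>Scalar curvature, Laplace-Beltrami operator and gradient\<close>

definition scalar_curvature :: "('a, 'z) pr_manifold_scheme \<Rightarrow> 'a \<Rightarrow> real" where
  "scalar_curvature M p =
     (let c = chart_at M p; n = mdim M; G = metric_comp M c; x = chart_map c p
      in metric_trace n (G x) (ricci n G x))"

definition laplacian :: "('a, 'z) pr_manifold_scheme \<Rightarrow> ('a \<Rightarrow> real) \<Rightarrow> 'a \<Rightarrow> real" where
  "laplacian M f p =
     (let c = chart_at M p; n = mdim M; G = metric_comp M c; x = chart_map c p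
      in metric_trace n (G x) (hessian n G (f \<circ> chart_inv c) x))"

definition gradient :: "('a, 'z) pr_manifold_scheme \<Rightarrow> ('a \<Rightarrow> real) \<Rightarrow> 'a \<Rightarrow> 'a tvec" where
  "gradient M f p =
     (THE v. v \<in> tangent_space M p \<and> (\<forall>w \<in> tangent_space M p. metric M p v w = w f))"

definition grad_norm_sq :: "('a, 'z) pr_manifold_scheme \<Rightarrow> ('a \<Rightarrow> real) \<Rightarrow> 'a \<Rightarrow> real" where
  "grad_norm_sq M f p = metric M p (gradient M f p) (gradient M f p)"

section \<open>The product with a base conformal warped metric\<close>

definition prod_chart :: "nat \<Rightarrow> 'a chart \<Rightarrow> 'b chart \<Rightarrow> ('a \<times> 'b) chart" where
  "prod_chart m c d =
     \<lparr>chart_dom = chart_dom c \<times> chart_dom d,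
      chart_map = (\<lambda>(p, q) i. if i < m then chart_map c p i else chart_map d q (i - m))\<rparr>"

text \<open>\<open>B \<times> F\<close> with the metric
  $(\psi\circ\pi)^{2\mu}\pi^*g_B + (\psi\circ\pi)^2\sigma^*g_F$.\<close>

definition bcwp ::
  "'a pr_manifold \<Rightarrow> 'b pr_manifold \<Rightarrow> real \<Rightarrow> ('a \<Rightarrow> real) \<Rightarrow> ('a \<times> 'b) pr_manifold" where
  "bcwp B F \<mu> \<psi> =
     \<lparr>mtop = prod_topology (mtop B) (mtop F),
      mdim = mdim B + mdim F,
      atlas = {prod_chart (mdim B) c d |c d. c \<in> atlas B \<and> d \<in> atlas F},
      chart_at = (\<lambda>(p, q). prod_chart (mdim B) (chart_at B p) (chart_at F q)),
      metric = (\<lambda>(p, q) v w.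
        \<psi> p powr (2 * \<mu>) * metric B p (pushforward B fst p v) (pushforward B fst p w) +
        (\<psi> p)\<^sup>2 * metric F q (pushforward F snd q v) (pushforward F snd q w))\<rparr>"

end

theory Submission
  imports Defs "Jordan_Normal_Form.Determinant"
begin

text \<open>
  Write \<open>g = \<psi>\<^sup>2 (g\<^sub>1 \<oplus> g\<^sub>F)\<close> with \<open>g\<^sub>1 = \<psi>\<^sup>2\<^sup>(\<^sup>\<mu>\<^sup>-\<^sup>1\<^sup>) g\<^sub>B\<close> and \<open>\<phi> = ln \<psi>\<close>.  Scalar curvatures of a
      direct
  product add up, and under a conformal change in dimension \<open>n\<close>
  \<open>S[exp (2 f) g] = exp (- 2 f) (S[g] - 2 (n - 1) \<Delta>f - (n - 2) (n - 1) |\<nabla>f|\<^sup>2)\<close>.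
  Applying the latter to \<open>g\<^sub>B\<close> with \<open>f = (\<mu> - 1) \<phi>\<close> and to \<open>g\<^sub>1 \<oplus> g\<^sub>F\<close> with \<open>f = \<phi>\<close> gives
  \<open>\<psi>\<^sup>2\<^sup>\<mu> S = S\<^sub>B + \<psi>\<^sup>2\<^sup>(\<^sup>\<mu>\<^sup>-\<^sup>1\<^sup>) S\<^sub>F - 2 A \<Delta>\<phi> - D |\<nabla>\<phi>|\<^sup>2\<close> with \<open>A = k + (m - 1) \<mu>\<close> and \<open>D\<close> the
  denominator of \<open>\<alpha>\<close>.  For \<open>A \<noteq> 0\<close> the choice \<open>\<alpha> = 2 A / D\<close> is the one for which \<open>\<psi> = u\<^sup>\<alpha>\<close> absorbs
  the gradient term into \<open>\<Delta>u / u\<close>; for \<open>A = 0\<close> the Laplacian term is absent.  All of this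
  is computed in coordinates, where only derivatives along coordinate lines occur.
\<close>

section \<open>Nondegenerate symmetric forms\<close>


text \<open>Trace, Ricci tensor and Laplacian are defined through an unspecified orthonormal frame
  and the gradient through a definite description, so each has to become a contraction with the
  inverse metric before anything can be computed; for an indefinite metric, frames must be found in
  the presence of null vectors. The computations are arranged so that mixed partial derivatives
  never have to commute: Hessian terms with exchanged indices are kept apart until they meet the
  symmetric inverse metric. The chain rule in several variables enters only in the comparison of
  coordinate vectors of different charts, by which a single chart spans the tangent space. Factoring
  the warped metric through a product spares its mixed Christoffel symbols, which do not vanish. Its
  components are read off from pushforwards of coordinate vectors; these are totalised by 0 on
  functions that are not smooth, whence the lemmas on smoothness of pulled back functions.\<close>

definition nondeg_form :: "nat \<Rightarrow> (nat \<Rightarrow> nat \<Rightarrow> real) \<Rightarrow> bool" where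
  "nondeg_form n h \<longleftrightarrow>
     (\<forall>i<n. \<forall>j<n. h i j = h j i) \<and>
     (\<forall>a. (\<forall>j<n. (\<Sum>i<n. h i j * a i) = 0) \<longrightarrow> (\<forall>i<n. a i = 0))"

section \<open>Bilinear algebra and orthonormal frames of possibly indefinite forms\<close>

lemma inner_by_add_left: "inner_by n h (\<lambda>l. u l + v l) w = inner_by n h u w + inner_by n h v w"
  by (simp add: inner_by_def sum.distrib algebra_simps)

lemma inner_by_diff_left: "inner_by n h (\<lambda>l. u l - v l) w = inner_by n h u w - inner_by n h v w"
  by (simp add: inner_by_def sum_subtractf algebra_simps)

lemma inner_by_scale_left: "inner_by n h (\<lambda>l. a * u l) w = a * inner_by n h u w"
  by (simp add: inner_by_def sum_distrib_left algebra_simps)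

lemma inner_by_sum_left:
  assumes "finite I"
  shows "inner_by n h (\<lambda>l. \<Sum>i\<in>I. a i * u i l) w = (\<Sum>i\<in>I. a i * inner_by n h (u i) w)"
  using assms
proof (induction I)
  case empty
  then show ?case by (simp add: inner_by_def)
next
  case (insert i I)
  then show ?case by (simp add: inner_by_add_left inner_by_scale_left)
qed

lemma inner_by_commute:
  assumes "\<forall>i<n. \<forall>j<n. h i j = h j i"
  shows "inner_by n h u v = inner_by n h v u"
  unfolding inner_by_def
  by (subst sum.swap) (auto intro!: sum.cong simp: assms)

lemma inner_by_unit_right:
  assumes "l < n"
  shows "inner_by n h u (\<lambda>i. if i = l then 1 else 0) = (\<Sum>i<n. h i l * u i)"
  using assms by (simp add: inner_by_def sum.delta if_distrib cong: if_cong)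

lemma inner_by_unit_left:
  assumes "l < n"
  shows "inner_by n h (\<lambda>i. if i = l then 1 else 0) u = (\<Sum>j<n. h l j * u j)"
proof -
  have "inner_by n h (\<lambda>i. if i = l then 1 else 0) u =
      (\<Sum>i<n. if i = l then (\<Sum>j<n. h i j * u j) else 0)"
    unfolding inner_by_def by (intro sum.cong) auto
  then show ?thesis using assms by simp
qed

text \<open>Gram-Schmidt in the presence of null vectors. The vectors \<open>w j\<close> are the
  projections of the standard basis to the orthogonal complement of the frame built so far. It
  suffices that the form is not identically zero there, since polarisation then yields a vector that
  can be normalised.\<close>

lemma ex_orthonormal_family:
  assumes h: "nondeg_form n h" and "r \<le> n"
  shows "\<exists>E. (\<forall>i<r. \<bar>inner_by n h (E i) (E i)\<bar> = 1) \<and>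
             (\<forall>i<r. \<forall>j<r. i \<noteq> j \<longrightarrow> inner_by n h (E i) (E j) = 0)"
  using \<open>r \<le> n\<close>
proof (induction r)
  case 0
  show ?case by simp
next
  case (Suc r)
  have sym: "\<forall>i<n. \<forall>j<n. h i j = h j i"
    and nondeg: "(\<forall>j<n. (\<Sum>i<n. h i j * a i) = 0) \<Longrightarrow> i < n \<Longrightarrow> a i = 0" for a i
    using h unfolding nondeg_form_def by blast+
  from Suc obtain E where E1: "\<forall>i<r. \<bar>inner_by n h (E i) (E i)\<bar> = 1"
    and E2: "\<forall>i<r. \<forall>j<r. i \<noteq> j \<longrightarrow> inner_by n h (E i) (E j) = 0" by auto
  define \<epsilon> where "\<epsilon> i = inner_by n h (E i) (E i)" for i
  have eps: "\<epsilon> i * \<epsilon> i = 1" if "i < r" for i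
    using E1 that by (metis \<epsilon>_def abs_mult_self mult_1)
  define e :: "nat \<Rightarrow> nat \<Rightarrow> real" where "e j = (\<lambda>i. if i = j then 1 else 0)" for j
  define w where "w j = (\<lambda>l. e j l - (\<Sum>i<r. (\<epsilon> i * inner_by n h (e j) (E i)) * E i l))" for j
  have w_left: "inner_by n h (w j) v =
      inner_by n h (e j) v - (\<Sum>i<r. (\<epsilon> i * inner_by n h (e j) (E i)) * inner_by n h (E i) v)" for j v
    unfolding w_def inner_by_diff_left by (subst inner_by_sum_left) auto
  have w_orth: "inner_by n h (w j) (E i) = 0" if i: "i < r" for i j
  proof -
    have "(\<Sum>i'<r. (\<epsilon> i' * inner_by n h (e j) (E i')) * inner_by n h (E i') (E i)) =
        (\<Sum>i'<r. if i' = i then inner_by n h (e j) (E i) else 0)"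
    proof (intro sum.cong refl)
      fix i' assume "i' \<in> {..<r}"
      then show "(\<epsilon> i' * inner_by n h (e j) (E i')) * inner_by n h (E i') (E i) =
          (if i' = i then inner_by n h (e j) (E i) else 0)"
        using E2 i eps[OF i] by (auto simp: \<epsilon>_def algebra_simps)
    qed
    then show ?thesis using i by (simp add: w_left)
  qed
  \<comment> \<open>The projection to the complement has trace n - r > 0, so some \<open>w j\<close>
    has a nonzero entry.\<close>
  have "(\<Sum>j<n. w j j) = real n - (\<Sum>i<r. \<epsilon> i * (\<Sum>j<n. inner_by n h (e j) (E i) * E i j))"
    unfolding w_def e_def sum_subtractf
    by (subst sum.swap) (simp add: sum_distrib_left mult.assoc)
  also have "(\<Sum>i<r. \<epsilon> i * (\<Sum>j<n. inner_by n h (e j) (E i) * E i j)) = (\<Sum>i<r. 1)"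
  proof (intro sum.cong refl)
    fix i assume i: "i \<in> {..<r}"
    have "(\<Sum>j<n. inner_by n h (e j) (E i) * E i j) = \<epsilon> i"
      unfolding \<epsilon>_def e_def
      by (simp add: inner_by_unit_left) (simp add: inner_by_def sum_distrib_left sum_distrib_right
          algebra_simps)
    then show "\<epsilon> i * (\<Sum>j<n. inner_by n h (e j) (E i) * E i j) = 1" using eps i by simp
  qed
  finally have "(\<Sum>j<n. w j j) \<noteq> 0" using Suc.prems by simp
  then obtain j where j: "j < n" "w j j \<noteq> 0" by (meson lessThan_iff sum.neutral)
  then obtain l where l: "l < n" "(\<Sum>i<n. h i l * w j i) \<noteq> 0" using nondeg[of "w j" j] by blast
  \<comment> \<open>Since \<open>w j\<close> is orthogonal to the frame, its product with
    \<open>w l\<close> equals that with the basis vector \<open>e l\<close>; nondegeneracy thus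
    gives a nonzero product within the complement.\<close>
  have "inner_by n h (w j) (w l) = inner_by n h (w l) (w j)" by (rule inner_by_commute[OF sym])
  also have "\<dots> = inner_by n h (e l) (w j)"
    unfolding w_left[of l] using w_orth by (simp add: inner_by_commute[OF sym, of _ "w j"])
  also have "\<dots> \<noteq> 0"
    using l by (simp add: inner_by_commute[OF sym, of _ "w j"] e_def inner_by_unit_right)
  finally have jl: "inner_by n h (w j) (w l) \<noteq> 0" .
  \<comment> \<open>If \<open>w j\<close>, \<open>w l\<close> and their sum were all null,
    \<open>w j\<close> and \<open>w l\<close> would be orthogonal.\<close>
  have "\<exists>v. inner_by n h v v \<noteq> 0 \<and> (\<forall>i<r. inner_by n h v (E i) = 0)"
  proof (rule ccontr)
    assume neg: "\<not> ?thesis"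
    have *: "inner_by n h v v = 0" if "\<forall>i<r. inner_by n h v (E i) = 0" for v using neg that by blast
    have "inner_by n h (\<lambda>i. w j i + w l i) (\<lambda>i. w j i + w l i) = 0"
      by (rule *) (simp add: inner_by_add_left w_orth)
    moreover have "inner_by n h (w j) (w j) = 0" "inner_by n h (w l) (w l) = 0"
      using * w_orth by auto
    ultimately show False using jl
      by (simp add: inner_by_add_left inner_by_commute[OF sym, of _ "\<lambda>i. w j i + w l i"]
          inner_by_commute[OF sym, of "w l" "w j"])
  qed
  then obtain v where v: "inner_by n h v v \<noteq> 0" "\<forall>i<r. inner_by n h v (E i) = 0" by blast
  define v' where "v' = (\<lambda>i. (1 / sqrt \<bar>inner_by n h v v\<bar>) * v i)"
  have scale: "inner_by n h v' u = inner_by n h v u / sqrt \<bar>inner_by n h v v\<bar>" for u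
    unfolding v'_def by (simp only: inner_by_scale_left) simp
  have v'v': "\<bar>inner_by n h v' v'\<bar> = 1"
    using v(1)
    by (simp add: scale inner_by_commute[OF sym, of v v'] abs_divide)
  have v'E: "inner_by n h v' (E i) = 0" "inner_by n h (E i) v' = 0" if "i < r" for i
    using v(2) that by (simp_all add: scale inner_by_commute[OF sym, of _ v'])
  show ?case
    by (rule exI[of _ "E(r := v')"]) (use E1 E2 v'v' v'E in \<open>auto simp: less_Suc_eq\<close>)
qed

lemma ex_orthonormal_frame: "nondeg_form n h \<Longrightarrow> \<exists>E. orthonormal_frame n h E"
  using ex_orthonormal_family[of n h n] by (auto simp: orthonormal_frame_def)

text \<open>The square matrix whose rows are \<open>\<epsilon>\<^sub>a E\<^sub>a\<^sup>T h\<close> is a left inverse of the one whose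
  columns are the \<open>E\<^sub>a\<close>, hence also a right inverse.\<close>

lemma orthonormal_frame_complete:
  assumes E: "orthonormal_frame n h E" and "i < n" "j < n"
  shows "(\<Sum>l<n. (\<Sum>a<n. inner_by n h (E a) (E a) * E a i * E a l) * h l j) = (if i = j then 1 else 0)"
proof -
  define \<epsilon> where "\<epsilon> a = inner_by n h (E a) (E a)" for a
  have eps: "\<epsilon> a * \<epsilon> a = 1" if "a < n" for a
    using E that unfolding orthonormal_frame_def by (metis \<epsilon>_def abs_mult_self mult_1)
  define A where "A = mat n n (\<lambda>(a, l). \<epsilon> a * (\<Sum>s<n. h s l * E a s))"
  define C where "C = mat n n (\<lambda>(l, b). E b l)"
  have AC: "A \<in> carrier_mat n n" "C \<in> carrier_mat n n" by (auto simp: A_def C_def)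
  have "A * C = 1\<^sub>m n"
  proof (rule eq_matI)
    fix a b assume "a < dim_row (1\<^sub>m n :: real mat)" "b < dim_col (1\<^sub>m n :: real mat)"
    then have ab: "a < n" "b < n" by auto
    have "(A * C) $$ (a, b) = (\<Sum>l<n. \<epsilon> a * (\<Sum>s<n. h s l * E a s) * E b l)"
      using ab by (simp add: A_def C_def scalar_prod_def lessThan_atLeast0)
    also have "\<dots> = \<epsilon> a * inner_by n h (E a) (E b)"
      unfolding inner_by_def
      by (subst sum.swap) (simp add: sum_distrib_left sum_distrib_right algebra_simps)
    also have "\<dots> = (if a = b then 1 else 0)"
      using E ab eps[OF ab(1)] by (auto simp: orthonormal_frame_def \<epsilon>_def)
    finally show "(A * C) $$ (a, b) = 1\<^sub>m n $$ (a, b)" using ab by simp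
  qed (auto simp: A_def C_def)
  then have "C * A = 1\<^sub>m n" by (rule mat_mult_left_right_inverse[OF AC])
  then have "(C * A) $$ (i, j) = (if i = j then 1 else 0)" using assms by simp
  moreover have "(C * A) $$ (i, j) = (\<Sum>a<n. E a i * (\<epsilon> a * (\<Sum>s<n. h s j * E a s)))"
    using assms by (simp add: A_def C_def scalar_prod_def lessThan_atLeast0)
  moreover have "\<dots> = (\<Sum>l<n. (\<Sum>a<n. \<epsilon> a * E a i * E a l) * h l j)"
    by (simp add: sum_distrib_left sum_distrib_right algebra_simps) (rule sum.swap)
  ultimately show ?thesis by (simp add: \<epsilon>_def)
qed

section \<open>Inverse matrices and metric traces\<close>

lemma sum_inverse_cancel:
  fixes h k k' :: "nat \<Rightarrow> nat \<Rightarrow> real"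
  assumes L: "\<And>i j. i < n \<Longrightarrow> j < n \<Longrightarrow> (\<Sum>l<n. k i l * h l j) = (if i = j then 1 else 0)"
    and R: "\<And>i j. i < n \<Longrightarrow> j < n \<Longrightarrow> (\<Sum>l<n. h i l * k' l j) = (if i = j then 1 else 0)"
    and ij: "i < n" "j < n"
  shows "k i j = k' i j"
proof -
  have "(\<Sum>l<n. (\<Sum>s<n. k i s * h s l) * k' l j) = (\<Sum>s<n. k i s * (\<Sum>l<n. h s l * k' l j))"
    by (simp add: sum_distrib_left sum_distrib_right algebra_simps) (rule sum.swap)
  moreover have "(\<Sum>l<n. (\<Sum>s<n. k i s * h s l) * k' l j) = (\<Sum>l<n. if l = i then k' l j else 0)"
    by (intro sum.cong) (auto simp: L ij)
  moreover have "(\<Sum>s<n. k i s * (\<Sum>l<n. h s l * k' l j)) = (\<Sum>s<n. if s = j then k i s else 0)"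
    by (intro sum.cong) (auto simp: R ij)
  ultimately show ?thesis using ij by simp
qed

text \<open>A one-sided inverse of a square matrix is two-sided; the passage to the matrix type
  imports this fact.\<close>

lemma sum_inverse_swap:
  fixes h k :: "nat \<Rightarrow> nat \<Rightarrow> real"
  assumes L: "\<And>i j. i < n \<Longrightarrow> j < n \<Longrightarrow> (\<Sum>l<n. k i l * h l j) = (if i = j then 1 else 0)"
    and ij: "i < n" "j < n"
  shows "(\<Sum>l<n. h i l * k l j) = (if i = j then 1 else 0)"
proof -
  define A where "A = mat n n (\<lambda>(i, j). k i j)"
  define C where "C = mat n n (\<lambda>(i, j). h i j)"
  have AC: "A \<in> carrier_mat n n" "C \<in> carrier_mat n n" by (auto simp: A_def C_def)
  have "A * C = 1\<^sub>m n"
    by (rule eq_matI) (auto simp: A_def C_def scalar_prod_def L simp flip: lessThan_atLeast0)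
  then have "C * A = 1\<^sub>m n" by (rule mat_mult_left_right_inverse[OF AC])
  then have "(C * A) $$ (i, j) = (if i = j then 1 else 0)" using ij by simp
  then show ?thesis using ij by (simp add: A_def C_def scalar_prod_def lessThan_atLeast0)
qed

text \<open>The description behind \<open>inverse_matrix\<close> also prescribes zeros outside the n
  x n block, which makes the matrix unique as a function on all pairs of indices.\<close>

lemma inverse_matrix_unique:
  assumes L: "\<And>i j. i < n \<Longrightarrow> j < n \<Longrightarrow> (\<Sum>l<n. k i l * h l j) = (if i = j then 1 else 0)"
  shows "inverse_matrix n h = (\<lambda>i j. if i < n \<and> j < n then k i j else 0)"
  unfolding inverse_matrix_def
proof (rule the_equality, goal_cases)
  case 1
  then show ?case using L by (simp add: if_distrib cong: if_cong)
next
  case (2 k')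
  have "k' i j = k i j" if "i < n" "j < n" for i j
    by (rule sum_inverse_cancel[of n k' h k]) (use 2 that sum_inverse_swap[of n k h] L in auto)
  then show ?case using 2 by fastforce
qed

lemma inverse_matrix_eqI:
  assumes "\<And>i j. i < n \<Longrightarrow> j < n \<Longrightarrow> (\<Sum>l<n. k i l * h l j) = (if i = j then 1 else 0)"
    and "i < n" "j < n"
  shows "inverse_matrix n h i j = k i j"
  using assms by (subst inverse_matrix_unique[of n k h]) auto

lemma inverse_matrix_left:
  assumes "nondeg_form n h" "i < n" "j < n"
  shows "(\<Sum>l<n. inverse_matrix n h i l * h l j) = (if i = j then 1 else 0)"
proof -
  obtain E where "orthonormal_frame n h E" using ex_orthonormal_frame[OF assms(1)] by blast
  then show ?thesis
    using inverse_matrix_unique[OF orthonormal_frame_complete] orthonormal_frame_complete assms(2,3)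
    by simp
qed

lemma inverse_matrix_right:
  assumes "nondeg_form n h" "i < n" "j < n"
  shows "(\<Sum>l<n. h i l * inverse_matrix n h l j) = (if i = j then 1 else 0)"
  using sum_inverse_swap[of n "inverse_matrix n h" h] inverse_matrix_left[OF assms(1)] assms by blast

lemma inverse_matrix_sym:
  assumes "nondeg_form n h" "i < n" "j < n"
  shows "inverse_matrix n h i j = inverse_matrix n h j i"
proof (rule sum_inverse_cancel[of n "inverse_matrix n h" h "\<lambda>i j. inverse_matrix n h j i"])
  fix i j assume ij: "i < n" "j < n"
  show "(\<Sum>l<n. h i l * inverse_matrix n h j l) = (if i = j then 1 else 0)"
  proof -
    have "(\<Sum>l<n. h i l * inverse_matrix n h j l) = (\<Sum>l<n. inverse_matrix n h j l * h l i)"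
      using assms(1) ij by (intro sum.cong) (auto simp: nondeg_form_def)
    then show ?thesis using inverse_matrix_left[OF assms(1) ij(2,1)] by auto
  qed
qed (use assms inverse_matrix_left in auto)

text \<open>Serves for conformal and product metrics, whose inverses are known explicitly.\<close>

lemma nondeg_formI_inverse:
  assumes "\<And>i j. i < n \<Longrightarrow> j < n \<Longrightarrow> h i j = h j i"
    and L: "\<And>i j. i < n \<Longrightarrow> j < n \<Longrightarrow> (\<Sum>l<n. k i l * h l j) = (if i = j then 1 else 0)"
  shows "nondeg_form n h"
  unfolding nondeg_form_def
proof (intro conjI allI impI)
  fix a i assume a: "\<forall>j<n. (\<Sum>i<n. h i j * a i) = 0" and i: "i < n"
  have "(\<Sum>j<n. k i j * (\<Sum>s<n. h s j * a s)) = (\<Sum>j<n. \<Sum>s<n. k i j * h j s * a s)"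
    unfolding sum_distrib_left
    by (intro sum.cong) (auto simp: assms(1) algebra_simps)
  also have "\<dots> = (\<Sum>s<n. (\<Sum>j<n. k i j * h j s) * a s)"
    by (subst sum.swap) (simp add: sum_distrib_right)
  also have "\<dots> = (\<Sum>s<n. if s = i then a s else 0)" by (intro sum.cong) (auto simp: L i)
  also have "\<dots> = a i" using i by simp
  finally show "a i = 0" using a by simp
qed (use assms in auto)

text \<open>By completeness, the sum over a of \<epsilon>_a E_a^i E_a^j is the inverse matrix for
  any orthonormal frame E, in particular for the one chosen by \<open>SOME\<close>.\<close>

lemma metric_trace_eq:
  assumes h: "nondeg_form n h"
    and T: "\<And>u v. T u v = (\<Sum>i<n. \<Sum>j<n. t i j * u i * v j)"
  shows "metric_trace n h T = (\<Sum>i<n. \<Sum>j<n. inverse_matrix n h i j * t i j)"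
proof -
  define E where "E = (SOME E. orthonormal_frame n h E)"
  have E: "orthonormal_frame n h E" unfolding E_def using ex_orthonormal_frame[OF h] by (rule someI_ex)
  have K: "inverse_matrix n h i j = (\<Sum>a<n. inner_by n h (E a) (E a) * E a i * E a j)"
    if "i < n" "j < n" for i j
    by (rule inverse_matrix_eqI) (use orthonormal_frame_complete[OF E] that in auto)
  have "metric_trace n h T = (\<Sum>a<n. inner_by n h (E a) (E a) * T (E a) (E a))"
    unfolding metric_trace_def Let_def E_def ..
  also have "\<dots> = (\<Sum>a<n. \<Sum>i<n. \<Sum>j<n. inner_by n h (E a) (E a) * E a i * E a j * t i j)"
    by (simp add: T sum_distrib_left algebra_simps)
  also have "\<dots> = (\<Sum>i<n. \<Sum>j<n. \<Sum>a<n. inner_by n h (E a) (E a) * E a i * E a j * t i j)"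
    by (subst sum.swap, rule sum.cong[OF refl], rule sum.swap)
  also have "\<dots> = (\<Sum>i<n. \<Sum>j<n. inverse_matrix n h i j * t i j)"
    by (intro sum.cong) (auto simp: K sum_distrib_right)
  finally show ?thesis .
qed

section \<open>Differentiability of the inverse matrix\<close>

lemma det_differentiable:
  fixes M :: "real \<Rightarrow> real mat"
  assumes "\<And>s. M s \<in> carrier_mat n n"
    and "\<And>i j. i < n \<Longrightarrow> j < n \<Longrightarrow> (\<lambda>s. M s $$ (i, j)) differentiable (at t)"
  shows "(\<lambda>s. Determinant.det (M s)) differentiable (at t)"
proof -
  have prod: "(\<lambda>s. \<Prod>i\<in>I. f i s) differentiable (at t)"
    if "finite I" "\<And>i. i \<in> I \<Longrightarrow> f i differentiable (at t)" for I :: "nat set" and f :: "nat \<Rightarrow> real \<Rightarrow>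
        real"
    using that by (induction I) auto
  have "Determinant.det (M s) =
      (\<Sum>p\<in>{p. p permutes {0..<n}}. of_int (sign p) * (\<Prod>i = 0..<n. M s $$ (i, p i)))" for s
    using assms(1)[of s] by (auto simp: Determinant.det_def)
  moreover have "(\<lambda>s. \<Sum>p\<in>{p. p permutes {0..<n}}. of_int (sign p) * (\<Prod>i = 0..<n. M s $$ (i, p i)))
      differentiable (at t)"
  proof (intro differentiable_sum ballI differentiable_mult differentiable_const prod
      finite_permutations)
    fix p i assume "p \<in> {p. p permutes {0..<n}}" "i \<in> {0..<n}"
    then have "p i < n" using permutes_in_image[of p "{0..<n}" i] by auto
    then show "(\<lambda>s. M s $$ (i, p i)) differentiable (at t)" using assms(2) \<open>i \<in> {0..<n}\<close> by auto
  qed auto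
  ultimately show ?thesis by simp
qed

text \<open>Cramer's rule: the entries of the inverse are rational in those of h with nonzero
  denominator, and inherit differentiability from them.\<close>

lemma inverse_matrix_cofactor:
  fixes h :: "nat \<Rightarrow> nat \<Rightarrow> real"
  assumes "nondeg_form n h" "i < n" "j < n"
  defines "A \<equiv> mat n n (\<lambda>(i, j). h i j)"
  shows "Determinant.det A \<noteq> 0"
    and "inverse_matrix n h i j = cofactor A j i / Determinant.det A"
proof -
  define K where "K = mat n n (\<lambda>(i, j). inverse_matrix n h i j)"
  have carr: "A \<in> carrier_mat n n" "K \<in> carrier_mat n n" by (auto simp: A_def K_def)
  have KA: "K * A = 1\<^sub>m n"
    by (rule eq_matI)
      (auto simp: A_def K_def scalar_prod_def inverse_matrix_left[OF assms(1)] simp flip: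
          lessThan_atLeast0)
  then have "Determinant.det K * Determinant.det A = 1" using det_mult[OF carr(2,1)] by simp
  then show det: "Determinant.det A \<noteq> 0" by auto
  have "K * (A * adj_mat A) = adj_mat A"
    using KA carr adj_mat(1)[OF carr(1)] by (simp flip: assoc_mult_mat)
  then have "Determinant.det A \<cdot>\<^sub>m K = adj_mat A"
    using carr by (simp add: adj_mat(2)[OF carr(1)] mult_smult_distrib[of K n n "1\<^sub>m n" n])
  then have "(Determinant.det A \<cdot>\<^sub>m K) $$ (i, j) = adj_mat A $$ (i, j)" by simp
  then have "Determinant.det A * inverse_matrix n h i j = cofactor A j i"
    using assms carr by (simp add: K_def adj_mat_def A_def)
  then show "inverse_matrix n h i j = cofactor A j i / Determinant.det A"
    using det by (simp add: field_simps)
qed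

text \<open>The quotient of cofactor and determinant is known to be the inverse only where the form
  is nondegenerate, hence the hypothesis on a whole neighbourhood of t.\<close>

lemma inverse_matrix_differentiable:
  fixes H :: "real \<Rightarrow> nat \<Rightarrow> nat \<Rightarrow> real"
  assumes d: "\<And>i j. i < n \<Longrightarrow> j < n \<Longrightarrow> (\<lambda>s. H s i j) differentiable (at t)"
    and sp: "\<forall>\<^sub>F s in nhds t. nondeg_form n (H s)"
    and ij: "i < n" "j < n"
  shows "(\<lambda>s. inverse_matrix n (H s) i j) differentiable (at t)"
proof -
  define A where "A s = mat n n (\<lambda>(i, j). H s i j)" for s
  have carr: "A s \<in> carrier_mat n n" for s by (simp add: A_def)
  have dA: "(\<lambda>s. Determinant.det (A s)) differentiable (at t)"
    by (rule det_differentiable[OF carr]) (simp add: A_def d)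
  have "(\<lambda>s. Determinant.det (mat_delete (A s) j i)) differentiable (at t)"
  proof (rule det_differentiable[of _ "n - 1"])
    show "mat_delete (A s) j i \<in> carrier_mat (n - 1) (n - 1)" for s
      using carr[of s] by (rule mat_delete_carrier)
    show "(\<lambda>s. mat_delete (A s) j i $$ (a, b)) differentiable (at t)" if "a < n - 1" "b < n - 1" for a b
      using that ij by (simp add: mat_delete_def A_def d)
  qed
  then have "(\<lambda>s. cofactor (A s) j i) differentiable (at t)"
    unfolding cofactor_def by (intro differentiable_mult differentiable_const)
  moreover have det: "Determinant.det (A t) \<noteq> 0"
    using inverse_matrix_cofactor(1)[OF eventually_nhds_x_imp_x[OF sp] ij] by (simp add: A_def)
  ultimately have "(\<lambda>s. cofactor (A s) j i / Determinant.det (A s)) differentiable (at t)"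
    using dA by (intro differentiable_divide) auto
  then obtain D where D: "((\<lambda>s. cofactor (A s) j i / Determinant.det (A s)) has_field_derivative D)
      (at t)"
    by (auto simp: real_differentiable_def)
  have "\<forall>\<^sub>F s in nhds t. inverse_matrix n (H s) i j = cofactor (A s) j i / Determinant.det (A s)"
    using sp by eventually_elim (use inverse_matrix_cofactor(2) ij in \<open>simp add: A_def\<close>)
  then have "((\<lambda>s. inverse_matrix n (H s) i j) has_field_derivative D) (at t)"
    using D by (simp add: DERIV_cong_ev[OF refl _ refl])
  then show ?thesis by (auto simp: real_differentiable_def)
qed

section \<open>Conformal change at a point\<close>


lemma sum_delta_left:
  fixes a b :: "nat \<Rightarrow> real"
  assumes "i < n"
  shows "(\<Sum>l<n. (if l = i then a l else 0) * b l) = a i * b i"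
    and "(\<Sum>l<n. (if i = l then a l else 0) * b l) = a i * b i"
    and "(\<Sum>l<n. b l * (if l = i then a l else 0)) = b i * a i"
    and "(\<Sum>l<n. b l * (if i = l then a l else 0)) = b i * a i"
  using assms by (simp_all add: mult_delta_left mult_delta_right)

lemma sum_symmetric_swap:
  fixes K a :: "nat \<Rightarrow> nat \<Rightarrow> real"
  assumes "\<And>i j. i < n \<Longrightarrow> j < n \<Longrightarrow> K i j = K j i"
  shows "(\<Sum>i<n. \<Sum>j<n. K i j * a i j) = (\<Sum>i<n. \<Sum>j<n. K i j * a j i)"
  by (subst sum.swap) (intro sum.cong refl, simp add: assms)

text \<open>First-order data at one point: the metric \<open>g\<close>, its inverse \<open>K\<close> and its partial
  derivatives \<open>dg\<close>; the differential \<open>f\<close> of a function with its derivatives \<open>df\<close>, and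
  the gradient \<open>F\<close> with its derivatives \<open>dF\<close>.  \<open>C\<close> is the difference of the
  Christoffel symbols of \<open>exp (2 f) g\<close> and of \<open>g\<close>.\<close>

locale conformal_jet =
  fixes n :: nat and g K :: "nat \<Rightarrow> nat \<Rightarrow> real" and dg \<Gamma> :: "nat \<Rightarrow> nat \<Rightarrow> nat \<Rightarrow> real"
    and f F :: "nat \<Rightarrow> real" and df dF :: "nat \<Rightarrow> nat \<Rightarrow> real"
  assumes g_sym: "\<And>i j. i < n \<Longrightarrow> j < n \<Longrightarrow> g i j = g j i"
    and K_sym: "\<And>i j. i < n \<Longrightarrow> j < n \<Longrightarrow> K i j = K j i"
    and Kg: "\<And>i j. i < n \<Longrightarrow> j < n \<Longrightarrow> (\<Sum>l<n. K i l * g l j) = (if i = j then 1 else 0)"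
    and gK: "\<And>i j. i < n \<Longrightarrow> j < n \<Longrightarrow> (\<Sum>l<n. g i l * K l j) = (if i = j then 1 else 0)"
    and dg_sym: "\<And>r i j. r < n \<Longrightarrow> i < n \<Longrightarrow> j < n \<Longrightarrow> dg r i j = dg r j i"
    and \<Gamma>_eq: "\<And>l i j. l < n \<Longrightarrow> i < n \<Longrightarrow> j < n \<Longrightarrow>
      \<Gamma> l i j = (\<Sum>r<n. K l r * (dg i j r + dg j i r - dg r i j)) / 2"
    and f_eq: "\<And>r. r < n \<Longrightarrow> f r = (\<Sum>l<n. g r l * F l)"
    and df_eq: "\<And>i r. i < n \<Longrightarrow> r < n \<Longrightarrow> df i r = (\<Sum>l<n. dg i r l * F l + g r l * dF i l)"
begin

definition C :: "nat \<Rightarrow> nat \<Rightarrow> nat \<Rightarrow> real" where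
  "C l i j = (if l = i then f j else 0) + (if l = j then f i else 0) - g i j * F l"

text \<open>The derivative of \<open>C\<close> in direction r that the product rule dictates;
  \<open>pdiff_christoffel_G'\<close> later justifies it.\<close>

definition dC :: "nat \<Rightarrow> nat \<Rightarrow> nat \<Rightarrow> nat \<Rightarrow> real" where
  "dC r l i j = (if l = i then df r j else 0) + (if l = j then df r i else 0)
     - (dg r i j * F l + g i j * dF r l)"

text \<open>The squared length of the gradient; \<open>H\<close> and \<open>L\<close> below are the
  Hessian and the Laplacian. Symmetry of \<open>df\<close>, and so of \<open>H\<close>, is not part
  of the data.\<close>

definition N :: real where "N = (\<Sum>s<n. f s * F s)"

definition H :: "nat \<Rightarrow> nat \<Rightarrow> real" where
  "H i j = df i j - (\<Sum>l<n. \<Gamma> l i j * f l)"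

definition L :: real where "L = (\<Sum>i<n. \<Sum>j<n. K i j * H i j)"

section \<open>Raising and lowering indices, metric compatibility, divergence\<close>

lemma K_contract:
  assumes "i < n"
  shows "(\<Sum>r<n. K i r * (\<Sum>l<n. g r l * a l)) = a i"
proof -
  have "(\<Sum>r<n. K i r * (\<Sum>l<n. g r l * a l)) = (\<Sum>l<n. (\<Sum>r<n. K i r * g r l) * a l)"
    by (simp add: sum_distrib_left sum_distrib_right mult.assoc) (rule sum.swap)
  also have "\<dots> = (\<Sum>l<n. (if i = l then 1 else 0) * a l)" by (intro sum.cong) (auto simp: Kg assms)
  finally show ?thesis using assms by (simp add: sum_delta_left)
qed

lemma g_contract:
  assumes "i < n"
  shows "(\<Sum>l<n. g i l * (\<Sum>r<n. K l r * a r)) = a i"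
proof -
  have "(\<Sum>r<n. g i r * (\<Sum>l<n. K r l * a l)) = (\<Sum>l<n. (\<Sum>r<n. g i r * K r l) * a l)"
    by (simp add: sum_distrib_left sum_distrib_right mult.assoc) (rule sum.swap)
  also have "\<dots> = (\<Sum>l<n. (if i = l then 1 else 0) * a l)" by (intro sum.cong) (auto simp: gK assms)
  finally show ?thesis using assms by (simp add: sum_delta_left)
qed

lemma F_eq: "l < n \<Longrightarrow> F l = (\<Sum>r<n. K l r * f r)"
  using K_contract[of l F] by (simp add: f_eq)

lemma f_eq': "r < n \<Longrightarrow> (\<Sum>l<n. F l * g l r) = f r"
  by (simp add: f_eq mult.commute) (intro sum.cong refl, simp add: g_sym)

lemma f_eq'': "r < n \<Longrightarrow> (\<Sum>l<n. g l r * F l) = f r"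
  using f_eq' by (simp add: mult.commute)

lemma K_trace:
  shows "(\<Sum>i<n. \<Sum>j<n. K i j * g i j) = real n"
    and "(\<Sum>i<n. \<Sum>j<n. K i j * (f i * f j)) = N"
proof -
  have "(\<Sum>i<n. \<Sum>j<n. K i j * g i j) = (\<Sum>i<n. \<Sum>j<n. K i j * g j i)"
    by (intro sum.cong refl) (simp add: g_sym)
  then show "(\<Sum>i<n. \<Sum>j<n. K i j * g i j) = real n" by (simp add: Kg)
  have "(\<Sum>i<n. \<Sum>j<n. K i j * (f i * f j)) = (\<Sum>i<n. f i * (\<Sum>j<n. K i j * f j))"
    by (simp add: sum_distrib_left algebra_simps)
  then show "(\<Sum>i<n. \<Sum>j<n. K i j * (f i * f j)) = N" by (simp add: F_eq N_def)
qed

lemma lower_\<Gamma>: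
  assumes "s < n" "i < n" "j < n"
  shows "(\<Sum>l<n. g s l * \<Gamma> l i j) = (dg i j s + dg j i s - dg s i j) / 2"
proof -
  have "(\<Sum>l<n. g s l * \<Gamma> l i j) = (\<Sum>l<n. g s l * (\<Sum>r<n. K l r * ((dg i j r + dg j i r - dg r i j) /
      2)))"
    by (intro sum.cong refl) (simp add: \<Gamma>_eq assms sum_divide_distrib)
  also have "\<dots> = (dg i j s + dg j i s - dg s i j) / 2" by (rule g_contract[OF assms(1)])
  finally show ?thesis .
qed

text \<open>The covariant derivative of the metric vanishes. This trades \<open>dg\<close> for
  Christoffel symbols, which then cancel in \<open>ricci_difference\<close>.\<close>

lemma dg_compat:
  assumes "i < n" "j < n" "k < n"
  shows "dg i j k = (\<Sum>s<n. g j s * \<Gamma> s i k) + (\<Sum>s<n. g k s * \<Gamma> s i j)"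
  using assms dg_sym by (simp add: lower_\<Gamma> field_simps)

lemma \<Gamma>_sym: "l < n \<Longrightarrow> i < n \<Longrightarrow> j < n \<Longrightarrow> \<Gamma> l i j = \<Gamma> l j i"
  by (simp add: \<Gamma>_eq) (intro sum.cong refl, simp add: dg_sym algebra_simps)

lemma \<Gamma>_f: 
  assumes "i < n" "j < n"
  shows "(\<Sum>l<n. \<Gamma> l i j * f l) = (\<Sum>s<n. (dg i j s + dg j i s - dg s i j) / 2 * F s)"
proof -
  have "(\<Sum>l<n. \<Gamma> l i j * f l) = (\<Sum>l<n. \<Sum>s<n. \<Gamma> l i j * (F s * g s l))"
    unfolding sum_distrib_left[symmetric] by (simp add: f_eq')
  also have "\<dots> = (\<Sum>s<n. (\<Sum>l<n. g s l * \<Gamma> l i j) * F s)"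
    by (subst sum.swap) (simp add: sum_distrib_right sum_distrib_left algebra_simps)
  finally show ?thesis by (simp add: lower_\<Gamma> assms)
qed

text \<open>The Laplacian as divergence of the gradient, the form in which it comes out of the
  derivatives of \<open>C\<close>. In the traced Christoffel symbol two of the three terms cancel by
  symmetry of \<open>K\<close>; the same symmetry removes the corresponding pair of terms from the
  trace of \<open>H\<close>.\<close>

lemma divergence:
  "(\<Sum>i<n. dF i i) + (\<Sum>i<n. \<Sum>s<n. \<Gamma> i i s * F s) = L"
proof -
  have 1: "(\<Sum>i<n. \<Gamma> i i s) = (\<Sum>i<n. \<Sum>r<n. K i r * dg s i r) / 2" if "s < n" for s
  proof -
    have "(\<Sum>i<n. \<Gamma> i i s) = (\<Sum>i<n. \<Sum>r<n. K i r * dg i s r) / 2 + (\<Sum>i<n. \<Sum>r<n. K i r * dg s i r) / 2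
        - (\<Sum>i<n. \<Sum>r<n. K i r * dg r i s) / 2"
      using that by (simp add: \<Gamma>_eq sum_divide_distrib[symmetric] sum.distrib sum_subtractf
          algebra_simps
          add_divide_distrib diff_divide_distrib)
    also have "(\<Sum>i<n. \<Sum>r<n. K i r * dg r i s) = (\<Sum>i<n. \<Sum>r<n. K i r * dg i r s)"
      by (rule sum_symmetric_swap) (rule K_sym)
    also have "\<dots> = (\<Sum>i<n. \<Sum>r<n. K i r * dg i s r)"
      using that by (intro sum.cong refl) (simp add: dg_sym)
    finally show ?thesis by simp
  qed
  have 2: "(\<Sum>i<n. \<Sum>s<n. \<Gamma> i i s * F s) = (\<Sum>i<n. \<Sum>r<n. K i r * (\<Sum>s<n. dg s i r / 2 * F s))"
  proof -
    have "(\<Sum>i<n. \<Sum>s<n. \<Gamma> i i s * F s) = (\<Sum>s<n. (\<Sum>i<n. \<Sum>r<n. K i r * dg s i r) / 2 * F s)"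
      by (subst sum.swap) (simp add: 1 flip: sum_distrib_right)
    also have "\<dots> = (\<Sum>s<n. \<Sum>i<n. \<Sum>r<n. K i r * (dg s i r / 2 * F s))"
      by (simp add: sum_distrib_right sum_divide_distrib mult.assoc)
    also have "\<dots> = (\<Sum>i<n. \<Sum>r<n. \<Sum>s<n. K i r * (dg s i r / 2 * F s))"
      by (subst sum.swap, rule sum.cong[OF refl], rule sum.swap)
    finally show ?thesis by (simp add: sum_distrib_left)
  qed
  have 3: "(\<Sum>i<n. \<Sum>j<n. K i j * (\<Sum>s<n. dg i j s * F s)) =
      (\<Sum>i<n. \<Sum>j<n. K i j * (\<Sum>s<n. dg j i s * F s))"
    by (rule sum_symmetric_swap) (rule K_sym)
  have H: "H i j = (\<Sum>s<n. dg i j s * F s) / 2 - (\<Sum>s<n. dg j i s * F s) / 2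
      + (\<Sum>s<n. dg s i j / 2 * F s) + (\<Sum>l<n. g j l * dF i l)" if "i < n" "j < n" for i j
    unfolding H_def \<Gamma>_f[OF that]
    using that by (simp add: df_eq sum.distrib sum_subtractf algebra_simps
        add_divide_distrib diff_divide_distrib sum_divide_distrib)
      (simp add: sum_divide_distrib[symmetric])
  have "L = (\<Sum>i<n. \<Sum>j<n. K i j * (\<Sum>s<n. dg i j s * F s)) / 2
      - (\<Sum>i<n. \<Sum>j<n. K i j * (\<Sum>s<n. dg j i s * F s)) / 2
      + (\<Sum>i<n. \<Sum>j<n. K i j * (\<Sum>s<n. dg s i j / 2 * F s))
      + (\<Sum>i<n. \<Sum>j<n. K i j * (\<Sum>l<n. g j l * dF i l))"
    unfolding L_def
    by (simp add: H distrib_left right_diff_distrib sum.distrib sum_subtractf flip: sum_divide_distrib)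
  then show ?thesis by (simp add: K_contract 2 3)
qed

section \<open>Contractions of the difference tensor and the change of curvature\<close>

lemma C_trace:
  assumes "s < n"
  shows "(\<Sum>i<n. C i i s) = real n * f s" and "(\<Sum>i<n. C i s i) = real n * f s"
  using assms by (simp_all add: C_def sum.distrib sum_subtractf f_eq'' f_eq[symmetric])

lemma dC_trace:
  assumes "r < n" "s < n"
  shows "(\<Sum>i<n. dC r i i s) = real n * df r s"
  using assms df_eq[of r s] by (simp add: dC_def sum.distrib sum_subtractf g_sym dg_sym)

lemma dC_div:
  assumes "j < n" "k < n"
  shows "(\<Sum>i<n. dC i i j k) = df j k + df k j - (\<Sum>i<n. dg i j k * F i) - g j k * (\<Sum>i<n. dF i i)"
  using assms by (simp add: dC_def sum.distrib sum_subtractf sum_distrib_left)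

text \<open>The factor \<open>X\<close> is arbitrary so that products of \<open>C\<close> with
  itself and with \<open>\<Gamma>\<close> are both instances.\<close>

lemma C_contract:
  assumes "j < n"
  shows "(\<Sum>i<n. \<Sum>s<n. C i j s * X i s) =
    (\<Sum>s<n. f s * X j s) + f j * (\<Sum>i<n. X i i) - (\<Sum>i<n. F i * (\<Sum>s<n. g j s * X i s))"
proof -
  have "(\<Sum>s<n. C i j s * X i s) = (if i = j then (\<Sum>s<n. f s * X i s) else 0) + f j * X i i
      - F i * (\<Sum>s<n. g j s * X i s)" if "i < n" for i
    using that
    by (cases "i = j") (simp_all add: C_def distrib_right left_diff_distrib sum.distrib sum_subtractf
        sum_delta_left sum_distrib_left mult.assoc mult.left_commute[of _ "F _"])
  then show ?thesis using assms by (simp add: sum.distrib sum_subtractf sum_distrib_left)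
qed

lemma f_C:
  assumes "j < n" "k < n"
  shows "(\<Sum>s<n. f s * C s j k) = 2 * f j * f k - g j k * N"
  using assms by (simp add: C_def distrib_left right_diff_distrib sum.distrib sum_subtractf
      sum_delta_left N_def
      sum_distrib_left mult_ac)

lemma g_C:
  assumes "i < n" "j < n" "k < n"
  shows "(\<Sum>s<n. g j s * C s i k) = g j i * f k + g j k * f i - g i k * f j"
proof -
  have "(\<Sum>s<n. g j s * (g i k * F s)) = g i k * f j"
    using assms by (simp add: f_eq sum_distrib_left mult_ac)
  then show ?thesis
    using assms by (simp add: C_def distrib_left right_diff_distrib sum.distrib sum_subtractf
        sum_delta_left)
qed

text \<open>The part of the Ricci tensor that is quadratic in f. The traces of \<open>C\<close> are
  multiples of f, so that both products reduce to \<open>C\<close> contracted once with f or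
  g.\<close>

lemma CC:
  assumes "j < n" "k < n"
  shows "(\<Sum>i<n. \<Sum>s<n. C i i s * C s j k) - (\<Sum>i<n. \<Sum>s<n. C i j s * C s i k)
    = (real n - 2) * (f j * f k - g j k * N)"
proof -
  have "(\<Sum>i<n. \<Sum>s<n. C i i s * C s j k) = (\<Sum>s<n. (\<Sum>i<n. C i i s) * C s j k)"
    by (subst sum.swap) (simp add: sum_distrib_right)
  also have "\<dots> = real n * (\<Sum>s<n. f s * C s j k)" by (simp add: C_trace sum_distrib_left mult.assoc)
  finally have 1: "(\<Sum>i<n. \<Sum>s<n. C i i s * C s j k) = real n * (2 * f j * f k - g j k * N)"
    using assms by (simp add: f_C)
  have "(\<Sum>i<n. F i * (\<Sum>s<n. g j s * C s i k)) =
      (\<Sum>i<n. F i * (g j i * f k + g j k * f i - g i k * f j))"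
    using assms by (intro sum.cong refl) (simp add: g_C)
  also have "\<dots> = f k * (\<Sum>i<n. g j i * F i) + g j k * N - f j * (\<Sum>i<n. g i k * F i)"
    by (simp add: N_def algebra_simps sum.distrib sum_subtractf sum_distrib_left)
  also have "\<dots> = g j k * N" using assms by (simp add: f_eq'' f_eq[symmetric])
  finally have 2: "(\<Sum>i<n. F i * (\<Sum>s<n. g j s * C s i k)) = g j k * N" .
  show ?thesis
    unfolding 1 C_contract[OF assms(1)] 2 using assms by (simp add: f_C C_trace algebra_simps)
qed

text \<open>The cross terms, which are not tensorial one by one. They are sorted so that the
  multiples of f by traced Christoffel symbols cancel in the signed sum. The fourth is the third
  with j and k exchanged, by symmetry of \<open>C\<close> and \<open>\<Gamma>\<close> in the lower
  indices.\<close>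

lemma C\<Gamma>:
  assumes "j < n" "k < n"
  shows "(\<Sum>i<n. \<Sum>s<n. C i i s * \<Gamma> s j k) = real n * (\<Sum>s<n. \<Gamma> s j k * f s)"
    and "(\<Sum>i<n. \<Sum>s<n. \<Gamma> i i s * C s j k) =
      f k * (\<Sum>i<n. \<Gamma> i i j) + f j * (\<Sum>i<n. \<Gamma> i i k) - g j k * (\<Sum>i<n. \<Sum>s<n. \<Gamma> i i s * F s)"
    and "(\<Sum>i<n. \<Sum>s<n. C i j s * \<Gamma> s i k) =
      (\<Sum>s<n. \<Gamma> s j k * f s) + f j * (\<Sum>i<n. \<Gamma> i i k) - (\<Sum>i<n. F i * (\<Sum>s<n. g j s * \<Gamma> s i k))"
    and "(\<Sum>i<n. \<Sum>s<n. \<Gamma> i j s * C s i k) =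
      (\<Sum>s<n. \<Gamma> s j k * f s) + f k * (\<Sum>i<n. \<Gamma> i i j) - (\<Sum>i<n. F i * (\<Sum>s<n. g k s * \<Gamma> s i j))"
proof -
  have "(\<Sum>i<n. \<Sum>s<n. C i i s * \<Gamma> s j k) = (\<Sum>s<n. (\<Sum>i<n. C i i s) * \<Gamma> s j k)"
    by (subst sum.swap) (simp add: sum_distrib_right)
  then show "(\<Sum>i<n. \<Sum>s<n. C i i s * \<Gamma> s j k) = real n * (\<Sum>s<n. \<Gamma> s j k * f s)"
    by (simp add: C_trace sum_distrib_left mult_ac)
  have "(\<Sum>s<n. \<Gamma> i i s * C s j k) = \<Gamma> i i j * f k + \<Gamma> i i k * f j - g j k * (\<Sum>s<n. \<Gamma> i i s * F s)"
    if "i < n" for i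
    using assms that by (simp add: C_def distrib_left right_diff_distrib sum.distrib sum_subtractf
        sum_delta_left
        sum_distrib_left mult_ac)
  then show "(\<Sum>i<n. \<Sum>s<n. \<Gamma> i i s * C s j k) =
      f k * (\<Sum>i<n. \<Gamma> i i j) + f j * (\<Sum>i<n. \<Gamma> i i k) - g j k * (\<Sum>i<n. \<Sum>s<n. \<Gamma> i i s * F s)"
    by (simp add: sum.distrib sum_subtractf sum_distrib_left mult_ac)
  have X: "(\<Sum>i<n. \<Sum>s<n. C i j s * \<Gamma> s i k) =
      (\<Sum>s<n. \<Gamma> s j k * f s) + f j * (\<Sum>i<n. \<Gamma> i i k) - (\<Sum>i<n. F i * (\<Sum>s<n. g j s * \<Gamma> s i k))"
    if "j < n" "k < n" for j k
    unfolding C_contract[OF that(1)] by (simp add: mult.commute)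
  show "(\<Sum>i<n. \<Sum>s<n. C i j s * \<Gamma> s i k) =
      (\<Sum>s<n. \<Gamma> s j k * f s) + f j * (\<Sum>i<n. \<Gamma> i i k) - (\<Sum>i<n. F i * (\<Sum>s<n. g j s * \<Gamma> s i k))"
    using X assms .
  have C_sym: "C l i j = C l j i" if "i < n" "j < n" for l i j
    using g_sym[OF that] by (simp add: C_def)
  have "(\<Sum>i<n. \<Sum>s<n. \<Gamma> i j s * C s i k) = (\<Sum>i<n. \<Sum>s<n. C i k s * \<Gamma> s i j)"
    using assms by (subst sum.swap) (intro sum.cong refl, simp add: \<Gamma>_sym C_sym mult.commute)
  then show "(\<Sum>i<n. \<Sum>s<n. \<Gamma> i j s * C s i k) =
      (\<Sum>s<n. \<Gamma> s j k * f s) + f k * (\<Sum>i<n. \<Gamma> i i j) - (\<Sum>i<n. F i * (\<Sum>s<n. g k s * \<Gamma> s i j))"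
    unfolding X[OF assms(2,1)] using assms by (simp add: \<Gamma>_sym)
qed

text \<open>Metric compatibility cancels the terms that are not tensorial; the remaining Christoffel
  symbols complete \<open>df\<close> to \<open>H\<close> and the divergence of F to
  \<open>L\<close>. \<open>H k j\<close> comes from the divergence of \<open>C\<close> and stays
  apart from \<open>H j k\<close>; for symmetric \<open>H\<close> both combine to the classical
  coefficient 2 - n.\<close>

lemma ricci_difference:
  assumes "j < n" "k < n"
  shows "(\<Sum>i<n. dC i i j k - dC j i i k)
     + (\<Sum>i<n. \<Sum>s<n. (\<Gamma> i i s + C i i s) * (\<Gamma> s j k + C s j k) - (\<Gamma> i j s + C i j s) * (\<Gamma> s i k + C s
         i k))
     - (\<Sum>i<n. \<Sum>s<n. \<Gamma> i i s * \<Gamma> s j k - \<Gamma> i j s * \<Gamma> s i k)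
     = H k j + (1 - real n) * H j k - g j k * L + (real n - 2) * (f j * f k - g j k * N)"
proof -
  have "(\<Sum>i<n. dg i j k * F i) =
      (\<Sum>i<n. F i * (\<Sum>s<n. g j s * \<Gamma> s i k)) + (\<Sum>i<n. F i * (\<Sum>s<n. g k s * \<Gamma> s i j))"
    using assms by (simp add: dg_compat algebra_simps sum.distrib)
  moreover have "(\<Sum>s<n. \<Gamma> s k j * f s) = (\<Sum>s<n. \<Gamma> s j k * f s)"
    using assms by (simp add: \<Gamma>_sym)
  moreover have "(\<Sum>i<n. \<Sum>s<n. (\<Gamma> i i s + C i i s) * (\<Gamma> s j k + C s j k) - (\<Gamma> i j s + C i j s) * (\<Gamma> s
      i k + C s i k))
     - (\<Sum>i<n. \<Sum>s<n. \<Gamma> i i s * \<Gamma> s j k - \<Gamma> i j s * \<Gamma> s i k)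
     = (\<Sum>i<n. \<Sum>s<n. C i i s * \<Gamma> s j k) + (\<Sum>i<n. \<Sum>s<n. \<Gamma> i i s * C s j k)
       - (\<Sum>i<n. \<Sum>s<n. C i j s * \<Gamma> s i k) - (\<Sum>i<n. \<Sum>s<n. \<Gamma> i j s * C s i k)
       + ((\<Sum>i<n. \<Sum>s<n. C i i s * C s j k) - (\<Sum>i<n. \<Sum>s<n. C i j s * C s i k))"
    by (simp add: distrib_left distrib_right sum.distrib sum_subtractf)
  ultimately show ?thesis
    unfolding CC[OF assms] C\<Gamma>[OF assms] divergence[symmetric] H_def sum_subtractf
    using assms by (simp add: dC_div dC_trace algebra_simps)
qed

text \<open>Contraction with the symmetric \<open>K\<close> turns both Hessian terms into
  \<open>L\<close>. The coefficients add up to 1 + (1 - n) - n for \<open>L\<close> and to (n - 2)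
  (1 - n) for \<open>N\<close>.\<close>

lemma scal_difference:
  "(\<Sum>k<n. \<Sum>j<n. K k j * ((\<Sum>i<n. dC i i j k - dC j i i k)
     + (\<Sum>i<n. \<Sum>s<n. (\<Gamma> i i s + C i i s) * (\<Gamma> s j k + C s j k) - (\<Gamma> i j s + C i j s) * (\<Gamma> s i k + C s
         i k))
     - (\<Sum>i<n. \<Sum>s<n. \<Gamma> i i s * \<Gamma> s j k - \<Gamma> i j s * \<Gamma> s i k)))
   = - 2 * (real n - 1) * L - (real n - 2) * (real n - 1) * N"
proof -
  have "?thesis \<longleftrightarrow> (\<Sum>k<n. \<Sum>j<n. K k j * (H k j + (1 - real n) * H j k - g j k * L
      + (real n - 2) * (f j * f k - g j k * N))) = - 2 * (real n - 1) * L - (real n - 2) * (real n -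
          1) * N"
    by (simp add: ricci_difference)
  moreover have "(\<Sum>k<n. \<Sum>j<n. K k j * (H k j + (1 - real n) * H j k - g j k * L
      + (real n - 2) * (f j * f k - g j k * N))) =
      (\<Sum>k<n. \<Sum>j<n. K k j * H k j) + (1 - real n) * (\<Sum>k<n. \<Sum>j<n. K k j * H j k)
      - L * (\<Sum>k<n. \<Sum>j<n. K k j * g j k) + (real n - 2) * (\<Sum>k<n. \<Sum>j<n. K k j * (f j * f k))
      - (real n - 2) * N * (\<Sum>k<n. \<Sum>j<n. K k j * g j k)"
    by (simp add: sum_distrib_left distrib_left right_diff_distrib sum.distrib sum_subtractf mult_ac)
  moreover have "(\<Sum>k<n. \<Sum>j<n. K k j * H j k) = L" "(\<Sum>k<n. \<Sum>j<n. K k j * g j k) = n"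
      "(\<Sum>k<n. \<Sum>j<n. K k j * (f j * f k)) = N"
    using sum_symmetric_swap[of n K H] sum_symmetric_swap[of n K g]
      sum_symmetric_swap[of n K "\<lambda>i j. f i * f j"] K_sym K_trace by (auto simp: L_def)
  ultimately show ?thesis by (simp add: L_def[symmetric] algebra_simps)
qed

text \<open>The metric trace of \<open>C\<close> is (2 - n) F: each delta term contributes F and the
  metric term - n F. The covector h is free, as the Laplacian may act on a function other than the
  conformal exponent.\<close>

lemma laplacian_difference:
  "(\<Sum>i<n. \<Sum>j<n. K i j * (\<Sum>l<n. C l i j * h l)) = (2 - real n) * (\<Sum>i<n. \<Sum>j<n. K i j * (f i * h j))"
proof -
  have C: "(\<Sum>l<n. C l i j * h l) = f j * h i + f i * h j - g i j * (\<Sum>l<n. F l * h l)" if "i < n" "j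
      < n" for i j
    using that by (simp add: C_def distrib_right left_diff_distrib sum.distrib sum_subtractf
        sum_delta_left
        sum_distrib_left mult.assoc)
  have "(\<Sum>i<n. \<Sum>j<n. K i j * (\<Sum>l<n. C l i j * h l)) =
     (\<Sum>i<n. \<Sum>j<n. K i j * (f j * h i)) + (\<Sum>i<n. \<Sum>j<n. K i j * (f i * h j))
     - (\<Sum>i<n. \<Sum>j<n. K i j * g i j) * (\<Sum>l<n. F l * h l)"
    by (simp add: C distrib_left right_diff_distrib sum.distrib sum_subtractf sum_distrib_right
        mult.assoc
        del: sum_distrib_right[symmetric])
  moreover have "(\<Sum>i<n. \<Sum>j<n. K i j * (f j * h i)) = (\<Sum>i<n. \<Sum>j<n. K i j * (f i * h j))"
    using sum_symmetric_swap[of n K "\<lambda>i j. f j * h i"] K_sym by simp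
  moreover have "(\<Sum>l<n. F l * h l) = (\<Sum>i<n. \<Sum>j<n. K i j * (f j * h i))"
    by (simp add: F_eq sum_distrib_right mult.assoc)
  ultimately show ?thesis by (simp add: K_trace algebra_simps)
qed

end

section \<open>Differentiation along coordinate lines and local curvature\<close>


text \<open>Openness and differentiability along coordinate lines are all that \<^const>\<open>pdiff\<close> sees.\<close>

definition lopen :: "nat \<Rightarrow> (nat \<Rightarrow> real) set \<Rightarrow> bool" where
  "lopen n U \<longleftrightarrow> (\<forall>x\<in>U. \<forall>i<n. \<forall>\<^sub>F t in nhds (x i). x(i := t) \<in> U)"

definition has_pdiff :: "nat \<Rightarrow> ((nat \<Rightarrow> real) \<Rightarrow> real) \<Rightarrow> real \<Rightarrow> (nat \<Rightarrow> real) \<Rightarrow> bool" where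
  "has_pdiff i f D x \<longleftrightarrow> ((\<lambda>t. f (x(i := t))) has_field_derivative D) (at (x i))"

definition ldiff :: "nat \<Rightarrow> ((nat \<Rightarrow> real) \<Rightarrow> real) \<Rightarrow> (nat \<Rightarrow> real) \<Rightarrow> bool" where
  "ldiff n f x \<longleftrightarrow> (\<forall>i<n. (\<lambda>t. f (x(i := t))) differentiable (at (x i)))"

text \<open>Despite the name, no continuity is asked: the first and second partial derivatives
  merely exist along coordinate lines.\<close>

definition C2_lines :: "nat \<Rightarrow> (nat \<Rightarrow> real) set \<Rightarrow> ((nat \<Rightarrow> real) \<Rightarrow> real) \<Rightarrow> bool" where
  "C2_lines n U f \<longleftrightarrow> (\<forall>x\<in>U. ldiff n f x \<and> (\<forall>i<n. ldiff n (pdiff i f) x))"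

section \<open>Calculus of partial derivatives\<close>

lemma lopenD: "lopen n U \<Longrightarrow> x \<in> U \<Longrightarrow> i < n \<Longrightarrow> \<forall>\<^sub>F t in nhds (x i). x(i := t) \<in> U"
  by (simp add: lopen_def)

lemma has_pdiff_imp_pdiff: "has_pdiff i f D x \<Longrightarrow> pdiff i f x = D"
  by (simp add: has_pdiff_def pdiff_def DERIV_imp_deriv)

lemma ldiff_iff: "ldiff n f x \<longleftrightarrow> (\<forall>i<n. has_pdiff i f (pdiff i f x) x)"
  by (simp add: ldiff_def has_pdiff_def pdiff_def DERIV_deriv_iff_real_differentiable)

lemma ldiffD: "ldiff n f x \<Longrightarrow> i < n \<Longrightarrow> has_pdiff i f (pdiff i f x) x"
  by (simp add: ldiff_iff)

lemma ldiffI: "(\<And>i. i < n \<Longrightarrow> has_pdiff i f (D i) x) \<Longrightarrow> ldiff n f x"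
  using has_pdiff_imp_pdiff by (fastforce simp: ldiff_iff)

lemma has_pdiff_const: "has_pdiff i (\<lambda>_. c) 0 x"
  by (simp add: has_pdiff_def)

lemma pdiff_const [simp]: "pdiff i (\<lambda>_. c) = (\<lambda>_. 0)"
  by (rule ext) (rule has_pdiff_imp_pdiff[OF has_pdiff_const])

lemma has_pdiff_add: "has_pdiff i f D x \<Longrightarrow> has_pdiff i g E x \<Longrightarrow> has_pdiff i (\<lambda>y. f y + g y) (D + E) x"
  unfolding has_pdiff_def by (rule DERIV_add)

lemma has_pdiff_diff: "has_pdiff i f D x \<Longrightarrow> has_pdiff i g E x \<Longrightarrow> has_pdiff i (\<lambda>y. f y - g y) (D - E) x"
  unfolding has_pdiff_def by (rule DERIV_diff)

lemma has_pdiff_mult: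
  "has_pdiff i f D x \<Longrightarrow> has_pdiff i g E x \<Longrightarrow> has_pdiff i (\<lambda>y. f y * g y) (D * g x + f x * E) x"
  unfolding has_pdiff_def by (auto intro!: derivative_eq_intros)

lemma has_pdiff_cmult: "has_pdiff i f D x \<Longrightarrow> has_pdiff i (\<lambda>y. c * f y) (c * D) x"
  unfolding has_pdiff_def by (rule DERIV_cmult)

lemma has_pdiff_if: "has_pdiff i f D x \<Longrightarrow> has_pdiff i (\<lambda>y. if b then f y else 0) (if b then D else 0) x"
  by (simp add: has_pdiff_const)

lemma has_pdiff_sum:
  "(\<And>a. a \<in> A \<Longrightarrow> has_pdiff i (f a) (D a) x) \<Longrightarrow>
   has_pdiff i (\<lambda>y. \<Sum>a\<in>A. f a y) (\<Sum>a\<in>A. D a) x"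
  unfolding has_pdiff_def by (rule DERIV_sum)

lemma has_pdiff_compose:
  assumes "(h has_field_derivative h') (at (f x))" and "has_pdiff i f D x"
  shows "has_pdiff i (\<lambda>y. h (f y)) (h' * D) x"
  unfolding has_pdiff_def
  by (rule DERIV_chain2) (use assms in \<open>auto simp: has_pdiff_def\<close>)

lemma has_pdiff_cong:
  assumes "lopen n U" "x \<in> U" "i < n" "\<And>y. y \<in> U \<Longrightarrow> f y = g y"
  shows "has_pdiff i f D x \<longleftrightarrow> has_pdiff i g D x"
proof -
  have "\<forall>\<^sub>F t in nhds (x i). f (x(i := t)) = g (x(i := t))"
    by (rule eventually_mono[OF lopenD[OF assms(1-3)]]) (rule assms(4))
  then show ?thesis unfolding has_pdiff_def by (intro DERIV_cong_ev) auto
qed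

text \<open>Holds without differentiability: \<open>deriv\<close> selects from the set of
  derivatives at the point, and this set depends only on the germ of the function along the
  line.\<close>

lemma pdiff_cong:
  assumes "lopen n U" "x \<in> U" "i < n" "\<And>y. y \<in> U \<Longrightarrow> f y = g y"
  shows "pdiff i f x = pdiff i g x"
  unfolding pdiff_def deriv_def
  using has_pdiff_cong[OF assms(1-3), of f g] assms(4) by (simp add: has_pdiff_def)

lemma ldiff_cong:
  assumes "lopen n U" "x \<in> U" "\<And>y. y \<in> U \<Longrightarrow> f y = g y"
  shows "ldiff n f x \<longleftrightarrow> ldiff n g x"
  using has_pdiff_cong[OF assms(1,2) _ assms(3)] pdiff_cong[OF assms(1,2) _ assms(3)]
  by (auto simp: ldiff_iff)

lemma C2_lines_cong:
  assumes U: "lopen n U" and eq: "\<And>y. y \<in> U \<Longrightarrow> f y = g y"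
  shows "C2_lines n U f \<longleftrightarrow> C2_lines n U g"
proof -
  have "ldiff n f x \<longleftrightarrow> ldiff n g x" if "x \<in> U" for x
    by (rule ldiff_cong[OF U that eq])
  moreover have "ldiff n (pdiff i f) x \<longleftrightarrow> ldiff n (pdiff i g) x" if "x \<in> U" "i < n" for x i
    by (rule ldiff_cong[OF U that(1)]) (rule pdiff_cong[OF U _ that(2) eq])
  ultimately show ?thesis by (simp add: C2_lines_def)
qed

lemma ldiff_const: "ldiff n (\<lambda>_. c) x"
  by (rule ldiffI[OF has_pdiff_const])

lemma ldiff_add: "ldiff n f x \<Longrightarrow> ldiff n g x \<Longrightarrow> ldiff n (\<lambda>y. f y + g y) x"
  by (rule ldiffI[OF has_pdiff_add]) (auto dest: ldiffD)

lemma ldiff_diff: "ldiff n f x \<Longrightarrow> ldiff n g x \<Longrightarrow> ldiff n (\<lambda>y. f y - g y) x"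
  by (rule ldiffI[OF has_pdiff_diff]) (auto dest: ldiffD)

lemma ldiff_mult: "ldiff n f x \<Longrightarrow> ldiff n g x \<Longrightarrow> ldiff n (\<lambda>y. f y * g y) x"
  by (rule ldiffI[OF has_pdiff_mult]) (auto dest: ldiffD)

lemma ldiff_sum: "(\<And>a. a \<in> A \<Longrightarrow> ldiff n (f a) x) \<Longrightarrow> ldiff n (\<lambda>y. \<Sum>a\<in>A. f a y) x"
  by (rule ldiffI[OF has_pdiff_sum]) (auto dest: ldiffD)

lemma ldiff_compose:
  "(h has_field_derivative h') (at (f x)) \<Longrightarrow> ldiff n f x \<Longrightarrow> ldiff n (\<lambda>y. h (f y)) x"
  by (rule ldiffI[OF has_pdiff_compose]) (auto dest: ldiffD)

lemma C2_lines_mult: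
  assumes U: "lopen n U" and f: "C2_lines n U f" and g: "C2_lines n U g"
  shows "C2_lines n U (\<lambda>y. f y * g y)"
  unfolding C2_lines_def
proof (intro ballI conjI allI impI)
  fix x i assume x: "x \<in> U" and i: "i < n"
  have "ldiff n (pdiff i (\<lambda>y. f y * g y)) x \<longleftrightarrow> ldiff n (\<lambda>y. pdiff i f y * g y + f y * pdiff i g y) x"
    by (rule ldiff_cong[OF U x], rule has_pdiff_imp_pdiff, rule has_pdiff_mult)
      (use f g i in \<open>auto simp: C2_lines_def intro: ldiffD\<close>)
  then show "ldiff n (pdiff i (\<lambda>y. f y * g y)) x"
    using f g x i by (simp add: C2_lines_def ldiff_add ldiff_mult)
qed (use f g in \<open>auto simp: C2_lines_def intro: ldiff_mult\<close>)

lemma C2_lines_compose: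
  assumes U: "lopen n U" and f: "C2_lines n U f"
    and h: "\<And>x. x \<in> U \<Longrightarrow> (h has_field_derivative h' (f x)) (at (f x))"
    and h': "\<And>x. x \<in> U \<Longrightarrow> (h' has_field_derivative h'' (f x)) (at (f x))"
  shows "C2_lines n U (\<lambda>y. h (f y))"
  unfolding C2_lines_def
proof (intro ballI conjI allI impI)
  fix x i assume x: "x \<in> U" and i: "i < n"
  have "ldiff n (pdiff i (\<lambda>y. h (f y))) x \<longleftrightarrow> ldiff n (\<lambda>y. h' (f y) * pdiff i f y) x"
    by (rule ldiff_cong[OF U x], rule has_pdiff_imp_pdiff, rule has_pdiff_compose)
      (use f h i in \<open>auto simp: C2_lines_def intro: ldiffD\<close>)
  then show "ldiff n (pdiff i (\<lambda>y. h (f y))) x"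
    using f x i ldiff_mult[OF ldiff_compose[of h' "h'' (f x)" f, OF h'[OF x]]] by (simp add:
        C2_lines_def)
qed (use f h in \<open>auto simp: C2_lines_def intro: ldiff_compose\<close>)

text \<open>The component R^l_kij, the coefficient of the l-th coordinate field in R(X_i, X_j) X_k
  for coordinate fields X.\<close>

definition riem :: "nat \<Rightarrow> ((nat \<Rightarrow> real) \<Rightarrow> nat \<Rightarrow> nat \<Rightarrow> real) \<Rightarrow> (nat \<Rightarrow> real) \<Rightarrow>
    nat \<Rightarrow> nat \<Rightarrow> nat \<Rightarrow> nat \<Rightarrow> real" where
  "riem n G x l k i j = pdiff i (christoffel n G l j k) x - pdiff j (christoffel n G l i k) x
     + (\<Sum>s<n. christoffel n G l i s x * christoffel n G s j k x
            - christoffel n G l j s x * christoffel n G s i k x)"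

definition scal :: "nat \<Rightarrow> ((nat \<Rightarrow> real) \<Rightarrow> nat \<Rightarrow> nat \<Rightarrow> real) \<Rightarrow> (nat \<Rightarrow> real) \<Rightarrow> real" where
  "scal n G x = (\<Sum>k<n. \<Sum>j<n. inverse_matrix n (G x) k j * (\<Sum>i<n. riem n G x i k i j))"

definition lap :: "nat \<Rightarrow> ((nat \<Rightarrow> real) \<Rightarrow> nat \<Rightarrow> nat \<Rightarrow> real) \<Rightarrow> ((nat \<Rightarrow> real) \<Rightarrow> real) \<Rightarrow>
    (nat \<Rightarrow> real) \<Rightarrow> real" where
  "lap n G f x = (\<Sum>i<n. \<Sum>j<n. inverse_matrix n (G x) i j *
     (pdiff i (pdiff j f) x - (\<Sum>l<n. christoffel n G l i j x * pdiff l f x)))"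

definition grad_prod :: "nat \<Rightarrow> ((nat \<Rightarrow> real) \<Rightarrow> nat \<Rightarrow> nat \<Rightarrow> real) \<Rightarrow> ((nat \<Rightarrow> real) \<Rightarrow> real) \<Rightarrow>
    ((nat \<Rightarrow> real) \<Rightarrow> real) \<Rightarrow> (nat \<Rightarrow> real) \<Rightarrow> real" where
  "grad_prod n G f h x = (\<Sum>i<n. \<Sum>j<n. inverse_matrix n (G x) i j * (pdiff i f x * pdiff j h x))"

lemma metric_trace_hessian:
  "nondeg_form n (G x) \<Longrightarrow> metric_trace n (G x) (hessian n G f x) = lap n G f x"
  unfolding lap_def by (rule metric_trace_eq) (auto simp: hessian_def intro!: sum.cong)

locale local_metric =
  fixes n :: nat and U :: "(nat \<Rightarrow> real) set" and G :: "(nat \<Rightarrow> real) \<Rightarrow> nat \<Rightarrow> nat \<Rightarrow> real"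
  assumes U: "lopen n U"
    and G_sp: "\<And>x. x \<in> U \<Longrightarrow> nondeg_form n (G x)"
    and G_C2: "\<And>i j. i < n \<Longrightarrow> j < n \<Longrightarrow> C2_lines n U (\<lambda>x. G x i j)"
begin

abbreviation "K x \<equiv> inverse_matrix n (G x)"
abbreviation "\<Gamma> \<equiv> christoffel n G"

lemma G_sym: "x \<in> U \<Longrightarrow> i < n \<Longrightarrow> j < n \<Longrightarrow> G x i j = G x j i"
  using G_sp by (simp add: nondeg_form_def)

lemma ldiff_G: "x \<in> U \<Longrightarrow> i < n \<Longrightarrow> j < n \<Longrightarrow> ldiff n (\<lambda>x. G x i j) x"
  using G_C2 by (simp add: C2_lines_def)

lemma ldiff_dG: "x \<in> U \<Longrightarrow> r < n \<Longrightarrow> i < n \<Longrightarrow> j < n \<Longrightarrow> ldiff n (pdiff r (\<lambda>x. G x i j)) x"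
  using G_C2 by (simp add: C2_lines_def)

lemma ldiff_K:
  assumes "x \<in> U" "i < n" "j < n"
  shows "ldiff n (\<lambda>x. K x i j) x"
  unfolding ldiff_def
proof (intro allI impI)
  fix r assume r: "r < n"
  show "(\<lambda>t. K (x(r := t)) i j) differentiable at (x r)"
  proof (rule inverse_matrix_differentiable)
    show "\<forall>\<^sub>F s in nhds (x r). nondeg_form n (G (x(r := s)))"
      by (rule eventually_mono[OF lopenD[OF U assms(1) r]]) (rule G_sp)
    show "(\<lambda>s. G (x(r := s)) a b) differentiable at (x r)" if "a < n" "b < n" for a b
      using ldiff_G[OF assms(1) that] r by (simp add: ldiff_def)
  qed (use assms in auto)
qed

lemma ldiff_\<Gamma>:
  assumes "x \<in> U" "l < n" "i < n" "j < n"
  shows "ldiff n (\<Gamma> l i j) x"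
proof -
  have *: "\<Gamma> l i j = (\<lambda>x. (1/2) * (\<Sum>r<n. K x l r *
        (pdiff i (\<lambda>y. G y j r) x + pdiff j (\<lambda>y. G y i r) x - pdiff r (\<lambda>y. G y i j) x)))"
    by (rule ext) (simp add: christoffel_def)
  show ?thesis
    unfolding * by (intro ldiff_mult ldiff_sum ldiff_add ldiff_diff ldiff_const ldiff_K ldiff_dG)
        (use assms in auto)
qed

text \<open>Fields with constant coefficients commute, so the bracket term drops and only
  Christoffel symbols get differentiated.\<close>

lemma curvature_const:
  assumes x: "x \<in> U" and l: "l < n"
  shows "curvature n G (\<lambda>_. a) (\<lambda>_. v) (\<lambda>_. u) x l =
    (\<Sum>i<n. a i * (\<Sum>j<n. v j * (\<Sum>k<n. u k * riem n G x l k i j)))"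
proof -
  have D: "cov_deriv n G (\<lambda>_. b) (\<lambda>_. c) = (\<lambda>x l. \<Sum>j<n. b j * (\<Sum>k<n. c k * \<Gamma> l j k x))" for b c
    by (rule ext)+ (simp add: cov_deriv_def mult.commute)
  have bracket: "lie_bracket n (\<lambda>_. b) (\<lambda>_. c) = (\<lambda>x l. 0)" for b c
    by (rule ext)+ (simp add: lie_bracket_def)
  have DD: "cov_deriv n G (\<lambda>_. b) (cov_deriv n G (\<lambda>_. c) (\<lambda>_. d)) x l =
    (\<Sum>i<n. b i * (\<Sum>j<n. c j * (\<Sum>k<n. d k *
       (pdiff i (\<Gamma> l j k) x + (\<Sum>s<n. \<Gamma> l i s x * \<Gamma> s j k x)))))" for b c d
  proof -
    have 1: "pdiff i (\<lambda>y. \<Sum>j<n. c j * (\<Sum>k<n. d k * \<Gamma> l j k y)) x =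
        (\<Sum>j<n. c j * (\<Sum>k<n. d k * pdiff i (\<Gamma> l j k) x))" if "i < n" for i
      by (rule has_pdiff_imp_pdiff)
        (use that l x in \<open>auto intro!: has_pdiff_sum has_pdiff_cmult ldiffD[OF ldiff_\<Gamma>]\<close>)
    have 2: "(\<Sum>s<n. \<Gamma> l i s x * (\<Sum>j<n. c j * (\<Sum>k<n. d k * \<Gamma> s j k x))) =
        (\<Sum>j<n. c j * (\<Sum>k<n. d k * (\<Sum>s<n. \<Gamma> l i s x * \<Gamma> s j k x)))" for i
    proof -
      have "(\<Sum>s<n. \<Gamma> l i s x * (\<Sum>j<n. c j * (\<Sum>k<n. d k * \<Gamma> s j k x))) =
        (\<Sum>s<n. \<Sum>j<n. \<Sum>k<n. c j * (d k * (\<Gamma> l i s x * \<Gamma> s j k x)))"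
        by (simp add: sum_distrib_left mult_ac)
      also have "\<dots> = (\<Sum>j<n. \<Sum>k<n. \<Sum>s<n. c j * (d k * (\<Gamma> l i s x * \<Gamma> s j k x)))"
        by (subst sum.swap, rule sum.cong[OF refl], rule sum.swap)
      finally show ?thesis by (simp add: sum_distrib_left)
    qed
    show ?thesis
      unfolding D by (simp add: cov_deriv_def 1 2 distrib_left sum.distrib)
  qed
  \<comment> \<open>Renames indices in the second iterated derivative, so that both are contracted
    with a, v, u in the same order.\<close>
  have swap: "(\<Sum>i<n. v i * (\<Sum>j<n. a j * (\<Sum>k<n. u k * X i j k))) =
      (\<Sum>i<n. a i * (\<Sum>j<n. v j * (\<Sum>k<n. u k * X j i k)))" for X :: "nat \<Rightarrow> nat \<Rightarrow> nat \<Rightarrow> real"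
    by (simp add: sum_distrib_left mult.left_commute[of "v _"]) (rule sum.swap)
  have "curvature n G (\<lambda>_. a) (\<lambda>_. v) (\<lambda>_. u) x l =
      cov_deriv n G (\<lambda>_. a) (cov_deriv n G (\<lambda>_. v) (\<lambda>_. u)) x l
      - cov_deriv n G (\<lambda>_. v) (cov_deriv n G (\<lambda>_. a) (\<lambda>_. u)) x l"
    by (simp add: curvature_def bracket) (simp add: cov_deriv_def)
  then show ?thesis
    unfolding DD swap riem_def
    by (simp add: sum_subtractf distrib_left right_diff_distrib sum.distrib)
qed

text \<open>Both frame sums become contractions with the inverse metric; the inner one cancels the
  metric in \<open>inner_by\<close> and leaves an ordinary trace.\<close>

lemma metric_trace_ricci:
  assumes x: "x \<in> U"
  shows "metric_trace n (G x) (ricci n G x) = scal n G x"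
  unfolding scal_def
proof (rule metric_trace_eq[OF G_sp[OF x]])
  fix u v
  \<comment> \<open>The matrix of the endomorphism that sends a to R(a, v) u; its trace is the Ricci
    tensor at u and v.\<close>
  define Q where "Q l i = (\<Sum>j<n. v j * (\<Sum>k<n. u k * riem n G x l k i j))" for l i
  have "ricci n G x u v = (\<Sum>i<n. \<Sum>q<n. K x i q * (\<Sum>l<n. G x l q * Q l i))"
    unfolding ricci_def
  proof (rule metric_trace_eq[OF G_sp[OF x]])
    fix a b
    have "inner_by n (G x) (curvature n G (\<lambda>_. a) (\<lambda>_. v) (\<lambda>_. u) x) b =
        (\<Sum>l<n. \<Sum>q<n. G x l q * (\<Sum>i<n. a i * Q l i) * b q)"
      unfolding inner_by_def by (intro sum.cong refl) (simp add: curvature_const[OF x] Q_def)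
    also have "\<dots> = (\<Sum>l<n. \<Sum>i<n. \<Sum>q<n. G x l q * Q l i * a i * b q)"
      by (rule sum.cong[OF refl], subst sum.swap) (simp add: sum_distrib_left sum_distrib_right mult_ac)
    also have "\<dots> = (\<Sum>i<n. \<Sum>q<n. \<Sum>l<n. G x l q * Q l i * a i * b q)"
      by (subst sum.swap, rule sum.cong[OF refl], rule sum.swap)
    finally show "inner_by n (G x) (curvature n G (\<lambda>_. a) (\<lambda>_. v) (\<lambda>_. u) x) b =
        (\<Sum>i<n. \<Sum>q<n. (\<Sum>l<n. G x l q * Q l i) * a i * b q)"
      by (simp add: sum_distrib_right)
  qed
  also have "\<dots> = (\<Sum>i<n. Q i i)"
  proof (intro sum.cong refl)
    fix i assume i: "i \<in> {..<n}"
    have "(\<Sum>q<n. K x i q * (\<Sum>l<n. G x l q * Q l i)) = (\<Sum>l<n. (\<Sum>q<n. K x i q * G x q l) * Q l i)"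
      by (subst sum_distrib_left, subst sum.swap, subst sum_distrib_right)
        (intro sum.cong refl, use x G_sym in \<open>simp add: mult.assoc\<close>)
    also have "\<dots> = (\<Sum>l<n. (if i = l then 1 else 0) * Q l i)"
      using i by (intro sum.cong refl) (simp add: inverse_matrix_left[OF G_sp[OF x]])
    finally show "(\<Sum>q<n. K x i q * (\<Sum>l<n. G x l q * Q l i)) = Q i i"
      using i by (simp add: sum_delta_left)
  qed
  also have "\<dots> = (\<Sum>i<n. \<Sum>k<n. \<Sum>j<n. riem n G x i k i j * u k * v j)"
    unfolding Q_def by (rule sum.cong[OF refl], subst sum.swap) (simp add: sum_distrib_left mult_ac)
  also have "\<dots> = (\<Sum>k<n. \<Sum>j<n. \<Sum>i<n. riem n G x i k i j * u k * v j)"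
    by (subst sum.swap, rule sum.cong[OF refl], rule sum.swap)
  finally show "ricci n G x u v = (\<Sum>k<n. \<Sum>j<n. (\<Sum>i<n. riem n G x i k i j) * u k * v j)"
    by (simp add: sum_distrib_right)
qed

end

section \<open>Conformal change of a metric\<close>


text \<open>The relation to \<open>G'\<close> is restricted to \<open>U\<close> and the index block,
  where the components of the warped metric are known.\<close>

locale conformal_change = local_metric +
  fixes f :: "(nat \<Rightarrow> real) \<Rightarrow> real" and G' :: "(nat \<Rightarrow> real) \<Rightarrow> nat \<Rightarrow> nat \<Rightarrow> real"
  assumes f: "C2_lines n U f"
    and G': "\<And>x i j. x \<in> U \<Longrightarrow> i < n \<Longrightarrow> j < n \<Longrightarrow> G' x i j = exp (2 * f x) * G x i j"
begin

lemma inverse_G'_left: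
  assumes x: "x \<in> U" and ab: "a < n" "b < n"
  shows "(\<Sum>l<n. exp (- 2 * f x) * K x a l * G' x l b) = (if a = b then 1 else 0)"
proof -
  have "(\<Sum>l<n. exp (- 2 * f x) * K x a l * G' x l b) = (\<Sum>l<n. K x a l * G x l b)"
    using x ab by (intro sum.cong refl) (simp add: G' exp_minus)
  then show ?thesis
    using ab inverse_matrix_left[OF G_sp[OF x]] by simp
qed

lemma inverse_G':
  "x \<in> U \<Longrightarrow> i < n \<Longrightarrow> j < n \<Longrightarrow> inverse_matrix n (G' x) i j = exp (- 2 * f x) * K x i j"
  by (rule inverse_matrix_eqI[OF inverse_G'_left])

text \<open>Allows conformal changes to be followed by products and by further conformal
  changes.\<close>

lemma local_metric_G': "local_metric n U G'"
proof
  show "lopen n U" by (rule U)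
  show "nondeg_form n (G' x)" if x: "x \<in> U" for x
    by (rule nondeg_formI_inverse[OF _ inverse_G'_left[OF x]]) (simp_all add: x G' G_sym)
  show "C2_lines n U (\<lambda>x. G' x i j)" if ij: "i < n" "j < n" for i j
  proof -
    have "C2_lines n U (\<lambda>x. exp (2 * f x))"
      by (rule C2_lines_compose[OF U f, of "\<lambda>s. exp (2 * s)" "\<lambda>s. 2 * exp (2 * s)" "\<lambda>s. 4 * exp (2 *
          s)"])
        (auto intro!: derivative_eq_intros)
    then have "C2_lines n U (\<lambda>x. exp (2 * f x) * G x i j)"
      by (rule C2_lines_mult[OF U _ G_C2[OF ij]])
    then show ?thesis by (subst C2_lines_cong[OF U]) (use G' ij in auto)
  qed
qed

definition F :: "nat \<Rightarrow> (nat \<Rightarrow> real) \<Rightarrow> real" where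
  "F l x = (\<Sum>r<n. K x l r * pdiff r f x)"

lemma ldiff_f: "x \<in> U \<Longrightarrow> ldiff n f x" and ldiff_df: "x \<in> U \<Longrightarrow> i < n \<Longrightarrow> ldiff n (pdiff i f) x"
  using f by (auto simp: C2_lines_def)

lemma ldiff_F: "x \<in> U \<Longrightarrow> l < n \<Longrightarrow> ldiff n (F l) x"
  unfolding F_def by (intro ldiff_sum ldiff_mult ldiff_K ldiff_df) auto

lemma lower_F:
  assumes x: "x \<in> U" and r: "r < n"
  shows "(\<Sum>l<n. G x r l * F l x) = pdiff r f x"
proof -
  have "(\<Sum>l<n. G x r l * F l x) = (\<Sum>s<n. (\<Sum>l<n. G x r l * K x l s) * pdiff s f x)"
    unfolding F_def by (simp add: sum_distrib_left sum_distrib_right mult.assoc) (rule sum.swap)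
  also have "\<dots> = (\<Sum>s<n. (if r = s then 1 else 0) * pdiff s f x)"
    using r by (intro sum.cong refl) (simp add: inverse_matrix_right[OF G_sp[OF x]])
  finally show ?thesis using r by (simp add: sum_delta_left)
qed

text \<open>The differentiated relation between differential and gradient holds because
  \<open>lower_F\<close> is an identity on all of \<open>U\<close>, not only at x.\<close>

lemma conformal_jet_at:
  assumes x: "x \<in> U"
  shows "conformal_jet n (G x) (K x) (\<lambda>r i j. pdiff r (\<lambda>y. G y i j) x) (\<lambda>l i j. \<Gamma> l i j x)
    (\<lambda>r. pdiff r f x) (\<lambda>l. F l x) (\<lambda>i j. pdiff i (pdiff j f) x) (\<lambda>i l. pdiff i (F l) x)"
proof
  show "pdiff r (\<lambda>y. G y i j) x = pdiff r (\<lambda>y. G y j i) x" if "r < n" "i < n" "j < n" for r i j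
    by (rule pdiff_cong[OF U x that(1)]) (rule G_sym[OF _ that(2,3)])
  show "pdiff i (pdiff r f) x = (\<Sum>l<n. pdiff i (\<lambda>y. G y r l) x * F l x + G x r l * pdiff i (F l) x)"
    if "i < n" "r < n" for i r
  proof -
    have "pdiff i (pdiff r f) x = pdiff i (\<lambda>y. \<Sum>l<n. G y r l * F l y) x"
      by (rule pdiff_cong[OF U x that(1)]) (rule lower_F[OF _ that(2), symmetric])
    also have "\<dots> = (\<Sum>l<n. pdiff i (\<lambda>y. G y r l) x * F l x + G x r l * pdiff i (F l) x)"
      by (rule has_pdiff_imp_pdiff)
        (intro has_pdiff_sum has_pdiff_mult ldiffD[OF ldiff_G] ldiffD[OF ldiff_F], use that x in auto)
    finally show ?thesis .
  qed
  show "G x i j = G x j i" if "i < n" "j < n" for i j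
    using G_sym[OF x that] .
  show "K x i j = K x j i" if "i < n" "j < n" for i j
    using inverse_matrix_sym[OF G_sp[OF x] that] .
qed (simp_all add: inverse_matrix_left[OF G_sp[OF x]] inverse_matrix_right[OF G_sp[OF x]] lower_F[OF x]
      christoffel_def)

lemma pdiff_G':
  assumes x: "x \<in> U" and "r < n" "i < n" "j < n"
  shows "pdiff r (\<lambda>y. G' y i j) x = exp (2 * f x) * (2 * pdiff r f x * G x i j + pdiff r (\<lambda>y. G y i
      j) x)"
proof -
  have "pdiff r (\<lambda>y. G' y i j) x = pdiff r (\<lambda>y. exp (2 * f y) * G y i j) x"
    by (rule pdiff_cong[OF U x]) (use assms G' in auto)
  also have "\<dots> = (2 * exp (2 * f x) * pdiff r f x) * G x i j + exp (2 * f x) * pdiff r (\<lambda>y. G y i j) x"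
    by (rule has_pdiff_imp_pdiff, rule has_pdiff_mult, rule has_pdiff_compose)
      (auto intro!: derivative_eq_intros ldiffD[OF ldiff_f] ldiffD[OF ldiff_G] assms)
  finally show ?thesis by (simp add: algebra_simps)
qed

context
  fixes x assumes x: "x \<in> U"
begin

interpretation jet: conformal_jet n "G x" "K x" "\<lambda>r i j. pdiff r (\<lambda>y. G y i j) x" "\<lambda>l i j. \<Gamma> l i j x"
    "\<lambda>r. pdiff r f x" "\<lambda>l. F l x" "\<lambda>i j. pdiff i (pdiff j f) x" "\<lambda>i l. pdiff i (F l) x"
  by (rule conformal_jet_at[OF x])

lemma christoffel_G'_jet:
  assumes "l < n" "i < n" "j < n"
  shows "christoffel n G' l i j x = \<Gamma> l i j x + jet.C l i j"
proof -
  have "christoffel n G' l i j x =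
      (\<Sum>r<n. K x l r * ((pdiff i (\<lambda>y. G y j r) x + pdiff j (\<lambda>y. G y i r) x - pdiff r (\<lambda>y. G y i j) x)
        + 2 * (pdiff i f x * G x r j + pdiff j f x * G x r i - G x i j * pdiff r f x))) / 2"
    unfolding christoffel_def
  proof (intro arg_cong2[of _ _ _ _ "(/)"] sum.cong refl)
    fix r assume "r \<in> {..<n}"
    then have r: "r < n" by simp
    \<comment> \<open>The factors of the inverse metric and of the metric cancel, so only the
      logarithmic derivative of the conformal factor survives.\<close>
    have E: "exp (- 2 * f x) * k * (exp (2 * f x) * a + exp (2 * f x) * b - exp (2 * f x) * c) = k *
        (a + b - c)"
      for k a b c
    proof -
      have "exp (- 2 * f x) * k * (exp (2 * f x) * a + exp (2 * f x) * b - exp (2 * f x) * c) =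
          (exp (- 2 * f x) * exp (2 * f x)) * (k * (a + b - c))"
        by (simp only: algebra_simps)
      then show ?thesis by (simp add: exp_minus)
    qed
    show "inverse_matrix n (G' x) l r * (pdiff i (\<lambda>y. G' y j r) x + pdiff j (\<lambda>y. G' y i r) x - pdiff
        r (\<lambda>y. G' y i j) x) =
      K x l r * ((pdiff i (\<lambda>y. G y j r) x + pdiff j (\<lambda>y. G y i r) x - pdiff r (\<lambda>y. G y i j) x)
        + 2 * (pdiff i f x * G x r j + pdiff j f x * G x r i - G x i j * pdiff r f x))"
      unfolding inverse_G'[OF x assms(1) r] pdiff_G'[OF x assms(2,3) r] pdiff_G'[OF x assms(3,2) r]
        pdiff_G'[OF x r assms(2,3)] E G_sym[OF x r assms(2)] G_sym[OF x r assms(3)]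
      by (rule arg_cong[of _ _ "(*) _"]) simp
  qed
  also have "\<dots> = \<Gamma> l i j x + (\<Sum>r<n. K x l r *
      (pdiff i f x * G x r j + pdiff j f x * G x r i - G x i j * pdiff r f x))"
    by (simp only: christoffel_def distrib_left[of "K x l _"] sum.distrib add_divide_distrib
        mult.left_commute[of _ 2] sum_distrib_left[symmetric])
  also have "(\<Sum>r<n. K x l r * (pdiff i f x * G x r j + pdiff j f x * G x r i - G x i j * pdiff r f x)) =
      pdiff i f x * (\<Sum>r<n. K x l r * G x r j) + pdiff j f x * (\<Sum>r<n. K x l r * G x r i) - G x i j *
          F l x"
    by (simp add: F_def distrib_left right_diff_distrib sum.distrib sum_subtractf sum_distrib_left
        mult_ac)
  finally show ?thesis using assms by (simp add: jet.Kg jet.C_def)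
qed

end

text \<open>Released from the jet at a fixed point, the formula becomes an identity of functions on
  \<open>U\<close>, which can be differentiated next.\<close>

lemma christoffel_G':
  assumes x: "x \<in> U" and "l < n" "i < n" "j < n"
  shows "christoffel n G' l i j x = \<Gamma> l i j x +
    ((if l = i then pdiff j f x else 0) + (if l = j then pdiff i f x else 0) - G x i j * F l x)"
  using christoffel_G'_jet[OF assms] conformal_jet.C_def[OF conformal_jet_at[OF x]] by simp

context
  fixes x assumes x: "x \<in> U"
begin

interpretation jet: conformal_jet n "G x" "K x" "\<lambda>r i j. pdiff r (\<lambda>y. G y i j) x" "\<lambda>l i j. \<Gamma> l i j x"
    "\<lambda>r. pdiff r f x" "\<lambda>l. F l x" "\<lambda>i j. pdiff i (pdiff j f) x" "\<lambda>i l. pdiff i (F l) x"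
  by (rule conformal_jet_at[OF x])

lemma pdiff_christoffel_G':
  assumes "r < n" "l < n" "i < n" "j < n"
  shows "pdiff r (christoffel n G' l i j) x = pdiff r (\<Gamma> l i j) x + jet.dC r l i j"
proof -
  have "pdiff r (christoffel n G' l i j) x = pdiff r (\<lambda>y. \<Gamma> l i j y +
    ((if l = i then pdiff j f y else 0) + (if l = j then pdiff i f y else 0) - G y i j * F l y)) x"
    by (rule pdiff_cong[OF U x assms(1)]) (rule christoffel_G'[OF _ assms(2-4)])
  also have "\<dots> = pdiff r (\<Gamma> l i j) x + ((if l = i then pdiff r (pdiff j f) x else 0)
     + (if l = j then pdiff r (pdiff i f) x else 0) - (pdiff r (\<lambda>y. G y i j) x * F l x + G x i j *
         pdiff r (F l) x))"
    by (rule has_pdiff_imp_pdiff)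
      (intro has_pdiff_add has_pdiff_diff has_pdiff_if has_pdiff_mult ldiffD[OF ldiff_\<Gamma>] ldiffD[OF
          ldiff_F]
        ldiffD[OF ldiff_df] ldiffD[OF ldiff_G], use assms x in auto)
  finally show ?thesis by (simp add: jet.dC_def)
qed

lemma N_eq: "jet.N = grad_prod n G f f x"
  using jet.K_trace(2) by (simp add: grad_prod_def)

lemma L_eq: "jet.L = lap n G f x"
  by (simp add: jet.L_def jet.H_def lap_def)

text \<open>The curvature tensor with one upper index changes exactly by the terms of the jet
  computation; the factor exp (- 2 f) stems from the inverse metric in the last contraction.\<close>

theorem scal_conformal:
  "scal n G' x = exp (- 2 * f x) *
     (scal n G x - 2 * (real n - 1) * lap n G f x - (real n - 2) * (real n - 1) * grad_prod n G f f x)"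
proof -
  have "scal n G' x = (\<Sum>k<n. \<Sum>j<n. exp (- 2 * f x) * (K x k j * ((\<Sum>i<n. riem n G x i k i j) +
      ((\<Sum>i<n. jet.dC i i j k - jet.dC j i i k)
      + (\<Sum>i<n. \<Sum>s<n. (\<Gamma> i i s x + jet.C i i s) * (\<Gamma> s j k x + jet.C s j k)
          - (\<Gamma> i j s x + jet.C i j s) * (\<Gamma> s i k x + jet.C s i k))
      - (\<Sum>i<n. \<Sum>s<n. \<Gamma> i i s x * \<Gamma> s j k x - \<Gamma> i j s x * \<Gamma> s i k x)))))"
    unfolding scal_def
  proof (intro sum.cong refl)
    fix k j assume "k \<in> {..<n}" "j \<in> {..<n}"
    then have kj: "k < n" "j < n" by auto
    have "(\<Sum>i<n. riem n G' x i k i j) = (\<Sum>i<n. riem n G x i k i j + ((jet.dC i i j k - jet.dC j i i k)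
      + (\<Sum>s<n. (\<Gamma> i i s x + jet.C i i s) * (\<Gamma> s j k x + jet.C s j k)
          - (\<Gamma> i j s x + jet.C i j s) * (\<Gamma> s i k x + jet.C s i k))
      - (\<Sum>s<n. \<Gamma> i i s x * \<Gamma> s j k x - \<Gamma> i j s x * \<Gamma> s i k x)))"
    proof (intro sum.cong refl)
      fix i assume i: "i \<in> {..<n}"
      have "(\<Sum>s<n. christoffel n G' i i s x * christoffel n G' s j k x
            - christoffel n G' i j s x * christoffel n G' s i k x) =
          (\<Sum>s<n. (\<Gamma> i i s x + jet.C i i s) * (\<Gamma> s j k x + jet.C s j k)
          - (\<Gamma> i j s x + jet.C i j s) * (\<Gamma> s i k x + jet.C s i k))"
        using kj i by (intro sum.cong refl) (simp add: christoffel_G'_jet[OF x])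
      then show "riem n G' x i k i j = riem n G x i k i j + ((jet.dC i i j k - jet.dC j i i k)
        + (\<Sum>s<n. (\<Gamma> i i s x + jet.C i i s) * (\<Gamma> s j k x + jet.C s j k)
            - (\<Gamma> i j s x + jet.C i j s) * (\<Gamma> s i k x + jet.C s i k))
        - (\<Sum>s<n. \<Gamma> i i s x * \<Gamma> s j k x - \<Gamma> i j s x * \<Gamma> s i k x))"
        unfolding riem_def using kj i by (simp add: pdiff_christoffel_G')
    qed
    then show "inverse_matrix n (G' x) k j * (\<Sum>i<n. riem n G' x i k i j) =
      exp (- 2 * f x) * (K x k j * ((\<Sum>i<n. riem n G x i k i j) +
      ((\<Sum>i<n. jet.dC i i j k - jet.dC j i i k)
      + (\<Sum>i<n. \<Sum>s<n. (\<Gamma> i i s x + jet.C i i s) * (\<Gamma> s j k x + jet.C s j k)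
          - (\<Gamma> i j s x + jet.C i j s) * (\<Gamma> s i k x + jet.C s i k))
      - (\<Sum>i<n. \<Sum>s<n. \<Gamma> i i s x * \<Gamma> s j k x - \<Gamma> i j s x * \<Gamma> s i k x))))"
      using inverse_G'[OF x kj] by (simp only: sum.distrib sum_subtractf mult.assoc)
  qed
  also have "\<dots> = exp (- 2 * f x) * (scal n G x + (\<Sum>k<n. \<Sum>j<n. K x k j * (
      (\<Sum>i<n. jet.dC i i j k - jet.dC j i i k)
      + (\<Sum>i<n. \<Sum>s<n. (\<Gamma> i i s x + jet.C i i s) * (\<Gamma> s j k x + jet.C s j k)
          - (\<Gamma> i j s x + jet.C i j s) * (\<Gamma> s i k x + jet.C s i k))
      - (\<Sum>i<n. \<Sum>s<n. \<Gamma> i i s x * \<Gamma> s j k x - \<Gamma> i j s x * \<Gamma> s i k x))))"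
    unfolding scal_def sum_distrib_left[symmetric] distrib_left[of "K x _ _"] sum.distrib ..
  finally show ?thesis unfolding jet.scal_difference by (simp add: N_eq L_eq algebra_simps)
qed

theorem lap_conformal:
  "lap n G' h x = exp (- 2 * f x) * (lap n G h x + (real n - 2) * grad_prod n G f h x)"
proof -
  have "lap n G' h x = (\<Sum>i<n. \<Sum>j<n. exp (- 2 * f x) * (K x i j * (pdiff i (pdiff j h) x
      - (\<Sum>l<n. \<Gamma> l i j x * pdiff l h x) - (\<Sum>l<n. jet.C l i j * pdiff l h x))))"
    unfolding lap_def
  proof (intro sum.cong refl)
    fix i j assume ij: "i \<in> {..<n}" "j \<in> {..<n}"
    then have "(\<Sum>l<n. christoffel n G' l i j x * pdiff l h x) =
        (\<Sum>l<n. \<Gamma> l i j x * pdiff l h x) + (\<Sum>l<n. jet.C l i j * pdiff l h x)"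
      by (simp add: christoffel_G'_jet[OF x] distrib_right sum.distrib)
    then show "inverse_matrix n (G' x) i j * (pdiff i (pdiff j h) x - (\<Sum>l<n. christoffel n G' l i j
        x * pdiff l h x))
      = exp (- 2 * f x) * (K x i j * (pdiff i (pdiff j h) x
      - (\<Sum>l<n. \<Gamma> l i j x * pdiff l h x) - (\<Sum>l<n. jet.C l i j * pdiff l h x)))"
      using ij inverse_G'[OF x, of i j] by (simp add: mult.assoc)
  qed
  also have "\<dots> = exp (- 2 * f x) * (lap n G h x - (\<Sum>i<n. \<Sum>j<n. K x i j * (\<Sum>l<n. jet.C l i j * pdiff
      l h x)))"
    unfolding lap_def sum_distrib_left[symmetric] right_diff_distrib[of "K x _ _"] sum_subtractf
    by simp
  finally show ?thesis unfolding jet.laplacian_difference by (simp add: grad_prod_def algebra_simps)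
qed

lemma grad_prod_conformal: "grad_prod n G' h h' x = exp (- 2 * f x) * grad_prod n G h h' x"
  unfolding grad_prod_def sum_distrib_left
  by (intro sum.cong refl) (simp add: inverse_G'[OF x] mult.assoc)

end

end

section \<open>Products of metrics\<close>


text \<open>Points of \<open>\<real>\<^sup>m\<close> have to vanish from coordinate \<open>m\<close> on, hence the truncation in \<open>proj1\<close>.\<close>

definition proj1 :: "nat \<Rightarrow> (nat \<Rightarrow> real) \<Rightarrow> nat \<Rightarrow> real" where
  "proj1 m x = (\<lambda>i. if i < m then x i else 0)"

definition proj2 :: "nat \<Rightarrow> (nat \<Rightarrow> real) \<Rightarrow> nat \<Rightarrow> real" where
  "proj2 m x = (\<lambda>i. x (m + i))"

definition prod_dom :: "nat \<Rightarrow> (nat \<Rightarrow> real) set \<Rightarrow> (nat \<Rightarrow> real) set \<Rightarrow> (nat \<Rightarrow> real) set" where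
  "prod_dom m U V = {x. proj1 m x \<in> U \<and> proj2 m x \<in> V}"

lemma proj_upd1:
  assumes "i < m"
  shows "proj1 m (x(i := t)) = (proj1 m x)(i := t)" "proj2 m (x(i := t)) = proj2 m x" "proj1 m x i =
      x i"
  using assms by (auto simp: proj1_def proj2_def)

lemma proj_upd2:
  shows "proj1 m (x(m + i := t)) = proj1 m x" "proj2 m (x(m + i := t)) = (proj2 m x)(i := t)"
    "proj2 m x i = x (m + i)"
  by (auto simp: proj1_def proj2_def)

lemma add_less_cases:
  fixes i :: nat
  assumes "i < m + k"
  obtains "i < m" | j where "i = m + j" "j < k"
  using assms by (metis less_imp_add_positive linorder_less_linear nat_add_left_cancel_less add_0_right)

lemma sum_lessThan_add: "(\<Sum>i<m + k. h i) = (\<Sum>i<m. h i) + (\<Sum>i<k. h (m + i))" for h :: "nat \<Rightarrow> real"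
  by (induction k) (simp_all add: add.assoc)

lemma lopen_prod_dom:
  assumes "lopen m U" "lopen k V"
  shows "lopen (m + k) (prod_dom m U V)"
  unfolding lopen_def
proof (intro ballI allI impI)
  fix x i assume x: "x \<in> prod_dom m U V" and "i < m + k"
  from this(2) show "\<forall>\<^sub>F t in nhds (x i). x(i := t) \<in> prod_dom m U V"
  proof (cases rule: add_less_cases)
    case 1
    have "\<forall>\<^sub>F t in nhds (proj1 m x i). (proj1 m x)(i := t) \<in> U"
      using lopenD[OF assms(1) _ 1] x by (simp add: prod_dom_def)
    then show ?thesis
      using x 1 by (simp add: proj_upd1 prod_dom_def eventually_mono)
  next
    case (2 j)
    have "\<forall>\<^sub>F t in nhds (proj2 m x j). (proj2 m x)(j := t) \<in> V"
      using lopenD[OF assms(2) _ 2(2)] x by (simp add: prod_dom_def)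
    then show ?thesis
      using x 2 by (simp add: proj_upd2 prod_dom_def eventually_mono)
  qed
qed

text \<open>Along a coordinate line the pulled back function is either the original one or constant,
  so differentiability is no issue.\<close>

lemma pdiff_proj1:
  shows "i < m \<Longrightarrow> pdiff i (\<lambda>y. f (proj1 m y)) x = pdiff i f (proj1 m x)"
    and "pdiff (m + i) (\<lambda>y. f (proj1 m y)) x = 0"
  by (simp_all add: pdiff_def proj_upd1 proj_upd2)

lemma pdiff_proj2:
  shows "i < m \<Longrightarrow> pdiff i (\<lambda>y. f (proj2 m y)) x = 0"
    and "pdiff (m + i) (\<lambda>y. f (proj2 m y)) x = pdiff i f (proj2 m x)"
  by (simp_all add: pdiff_def proj_upd1 proj_upd2)

lemma ldiff_proj1:
  assumes "ldiff m f (proj1 m x)"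
  shows "ldiff (m + k) (\<lambda>y. f (proj1 m y)) x"
  unfolding ldiff_def
proof (intro allI impI)
  fix i assume "i < m + k"
  then show "(\<lambda>t. f (proj1 m (x(i := t)))) differentiable at (x i)"
    by (cases rule: add_less_cases) (use assms in \<open>auto simp: proj_upd1 proj_upd2 ldiff_def\<close>)
qed

lemma ldiff_proj2:
  assumes "ldiff k f (proj2 m x)"
  shows "ldiff (m + k) (\<lambda>y. f (proj2 m y)) x"
  unfolding ldiff_def
proof (intro allI impI)
  fix i assume "i < m + k"
  then show "(\<lambda>t. f (proj2 m (x(i := t)))) differentiable at (x i)"
    by (cases rule: add_less_cases) (use assms in \<open>auto simp: proj_upd1 proj_upd2 ldiff_def\<close>)
qed

lemma C2_lines_proj1:
  assumes "C2_lines m U f"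
  shows "C2_lines (m + k) (prod_dom m U V) (\<lambda>y. f (proj1 m y))"
  unfolding C2_lines_def
proof (intro ballI conjI allI impI)
  fix x i assume x: "x \<in> prod_dom m U V" and "i < m + k"
  from this(2) show "ldiff (m + k) (pdiff i (\<lambda>y. f (proj1 m y))) x"
  proof (cases rule: add_less_cases)
    case 1
    then have "pdiff i (\<lambda>y. f (proj1 m y)) = (\<lambda>y. pdiff i f (proj1 m y))" by (intro ext pdiff_proj1)
    then show ?thesis using assms x 1 by (simp add: C2_lines_def prod_dom_def ldiff_proj1)
  next
    case (2 j)
    then have "pdiff i (\<lambda>y. f (proj1 m y)) = (\<lambda>y. 0)" by (intro ext) (simp add: pdiff_proj1)
    then show ?thesis by (simp add: ldiff_const)
  qed
qed (use assms in \<open>simp add: C2_lines_def prod_dom_def ldiff_proj1\<close>)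

lemma C2_lines_proj2:
  assumes "C2_lines k V f"
  shows "C2_lines (m + k) (prod_dom m U V) (\<lambda>y. f (proj2 m y))"
  unfolding C2_lines_def
proof (intro ballI conjI allI impI)
  fix x i assume x: "x \<in> prod_dom m U V" and "i < m + k"
  from this(2) show "ldiff (m + k) (pdiff i (\<lambda>y. f (proj2 m y))) x"
  proof (cases rule: add_less_cases)
    case 1
    then have "pdiff i (\<lambda>y. f (proj2 m y)) = (\<lambda>y. 0)" by (intro ext pdiff_proj2)
    then show ?thesis by (simp add: ldiff_const)
  next
    case (2 j)
    then have "pdiff i (\<lambda>y. f (proj2 m y)) = (\<lambda>y. pdiff j f (proj2 m y))" by (intro ext) (simp add:
        pdiff_proj2)
    then show ?thesis using assms x 2 by (simp add: C2_lines_def prod_dom_def ldiff_proj2)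
  qed
qed (use assms in \<open>simp add: C2_lines_def prod_dom_def ldiff_proj2\<close>)

section \<open>Block diagonal metrics\<close>

definition prod_metric :: "nat \<Rightarrow> ((nat \<Rightarrow> real) \<Rightarrow> nat \<Rightarrow> nat \<Rightarrow> real) \<Rightarrow>
    ((nat \<Rightarrow> real) \<Rightarrow> nat \<Rightarrow> nat \<Rightarrow> real) \<Rightarrow> (nat \<Rightarrow> real) \<Rightarrow> nat \<Rightarrow> nat \<Rightarrow> real" where
  "prod_metric m G1 G2 x i j =
     (if i < m then if j < m then G1 (proj1 m x) i j else 0
      else if j < m then 0 else G2 (proj2 m x) (i - m) (j - m))"

lemma prod_metric_simps:
  "i < m \<Longrightarrow> j < m \<Longrightarrow> prod_metric m G1 G2 x i j = G1 (proj1 m x) i j"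
  "i < m \<Longrightarrow> prod_metric m G1 G2 x i (m + j) = 0"
  "j < m \<Longrightarrow> prod_metric m G1 G2 x (m + i) j = 0"
  "prod_metric m G1 G2 x (m + i) (m + j) = G2 (proj2 m x) i j"
  by (simp_all add: prod_metric_def)

locale product_metric = M1: local_metric m U G1 + M2: local_metric k V G2
  for m U G1 k V G2
begin

abbreviation "W \<equiv> prod_dom m U V"
abbreviation "G \<equiv> prod_metric m G1 G2"

lemma W: "x \<in> W \<Longrightarrow> proj1 m x \<in> U" "x \<in> W \<Longrightarrow> proj2 m x \<in> V"
  by (simp_all add: prod_dom_def)

lemma product_inverse_left:
  assumes x: "x \<in> W" and ij: "i < m + k" "j < m + k"
  shows "(\<Sum>l<m + k. prod_metric m (\<lambda>y. M1.K y) (\<lambda>y. M2.K y) x i l * G x l j) = (if i = j then 1 else 0)"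
proof -
  note inv = inverse_matrix_left[OF M1.G_sp[OF W(1)[OF x]]] inverse_matrix_left[OF M2.G_sp[OF
      W(2)[OF x]]]
  from ij(1) show ?thesis
  proof (cases rule: add_less_cases)
    case i: 1
    from ij(2) show ?thesis
      by (cases rule: add_less_cases) (use i inv in \<open>auto simp: sum_lessThan_add prod_metric_simps\<close>)
  next
    case i: (2 i')
    from ij(2) show ?thesis
      by (cases rule: add_less_cases) (use i inv in \<open>auto simp: sum_lessThan_add prod_metric_simps\<close>)
  qed
qed

lemma prod_metric_sym:
  assumes x: "x \<in> W" and ij: "i < m + k" "j < m + k"
  shows "G x i j = G x j i"
  using ij M1.G_sym[OF W(1)[OF x]] M2.G_sym[OF W(2)[OF x]] by (simp add: prod_metric_def)

lemma inverse_prod_metric: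
  "x \<in> W \<Longrightarrow> i < m + k \<Longrightarrow> j < m + k \<Longrightarrow>
    inverse_matrix (m + k) (G x) i j = prod_metric m (\<lambda>y. M1.K y) (\<lambda>y. M2.K y) x i j"
  by (rule inverse_matrix_eqI[OF product_inverse_left]) auto

lemma local_metric_prod: "local_metric (m + k) W G"
proof
  show "lopen (m + k) W" by (rule lopen_prod_dom[OF M1.U M2.U])
  show "nondeg_form (m + k) (G x)" if "x \<in> W" for x
    by (rule nondeg_formI_inverse[OF prod_metric_sym product_inverse_left]) (use that in auto)
  show "C2_lines (m + k) W (\<lambda>x. G x i j)" if ij: "i < m + k" "j < m + k" for i j
  proof -
    have const: "C2_lines (m + k) W (\<lambda>x. 0)" by (simp add: C2_lines_def ldiff_const)
    have "C2_lines (m + k) W (\<lambda>x. G1 (proj1 m x) i j)" if "i < m" "j < m"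
      by (rule C2_lines_proj1[OF M1.G_C2[OF that]])
    moreover have "C2_lines (m + k) W (\<lambda>x. G2 (proj2 m x) (i - m) (j - m))" if "\<not> i < m" "\<not> j < m"
      by (rule C2_lines_proj2[OF M2.G_C2]) (use ij that in auto)
    ultimately show ?thesis
      unfolding prod_metric_def using const by (cases "i < m"; cases "j < m") simp_all
  qed
qed

text \<open>Index patterns that meet both blocks give 0: the inverse is block diagonal, and each
  block of the metric depends on its own coordinates only.\<close>

lemma christoffel_prod:
  assumes x: "x \<in> W"
  shows "l < m \<Longrightarrow> i < m \<Longrightarrow> j < m \<Longrightarrow> christoffel (m + k) G l i j x = M1.\<Gamma> l i j (proj1 m x)"
    and "l < k \<Longrightarrow> i < k \<Longrightarrow> j < k \<Longrightarrow>
      christoffel (m + k) G (m + l) (m + i) (m + j) x = M2.\<Gamma> l i j (proj2 m x)"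
    and "l < k \<Longrightarrow> i < m \<Longrightarrow> j < m \<Longrightarrow> christoffel (m + k) G (m + l) i j x = 0"
    and "l < m \<Longrightarrow> i < k \<Longrightarrow> j < m \<Longrightarrow> christoffel (m + k) G l (m + i) j x = 0"
    and "l < m \<Longrightarrow> i < m \<Longrightarrow> j < k \<Longrightarrow> christoffel (m + k) G l i (m + j) x = 0"
    and "l < k \<Longrightarrow> i < k \<Longrightarrow> j < m \<Longrightarrow> christoffel (m + k) G (m + l) (m + i) j x = 0"
    and "l < k \<Longrightarrow> i < m \<Longrightarrow> j < k \<Longrightarrow> christoffel (m + k) G (m + l) i (m + j) x = 0"
    and "l < m \<Longrightarrow> i < k \<Longrightarrow> j < k \<Longrightarrow> christoffel (m + k) G l (m + i) (m + j) x = 0"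
  using x by (simp_all add: christoffel_def sum_lessThan_add inverse_prod_metric prod_metric_simps
      pdiff_proj1[of _ _ "\<lambda>y. G1 y _ _"] pdiff_proj1(2)[of _ _ "\<lambda>y. G1 y _ _"]
      pdiff_proj2[of _ _ "\<lambda>y. G2 y _ _"] pdiff_proj2(2)[of _ _ "\<lambda>y. G2 y _ _"])

text \<open>The formulas of \<open>christoffel_prod\<close> hold throughout \<open>W\<close>, which
  is open along lines, and may therefore be differentiated.\<close>

lemma pdiff_christoffel_prod:
  assumes x: "x \<in> W" and r: "r < m + k"
  shows "l < m \<Longrightarrow> i < m \<Longrightarrow> j < m \<Longrightarrow> pdiff r (christoffel (m + k) G l i j) x =
      (if r < m then pdiff r (M1.\<Gamma> l i j) (proj1 m x) else 0)"
    and "l < k \<Longrightarrow> i < k \<Longrightarrow> j < k \<Longrightarrow> pdiff r (christoffel (m + k) G (m + l) (m + i) (m + j)) x =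
      (if r < m then 0 else pdiff (r - m) (M2.\<Gamma> l i j) (proj2 m x))"
    and "l < k \<Longrightarrow> i < m \<Longrightarrow> j < m \<Longrightarrow> pdiff r (christoffel (m + k) G (m + l) i j) x = 0"
    and "l < m \<Longrightarrow> i < k \<Longrightarrow> j < m \<Longrightarrow> pdiff r (christoffel (m + k) G l (m + i) j) x = 0"
    and "l < m \<Longrightarrow> i < m \<Longrightarrow> j < k \<Longrightarrow> pdiff r (christoffel (m + k) G l i (m + j)) x = 0"
    and "l < k \<Longrightarrow> i < k \<Longrightarrow> j < m \<Longrightarrow> pdiff r (christoffel (m + k) G (m + l) (m + i) j) x = 0"
    and "l < k \<Longrightarrow> i < m \<Longrightarrow> j < k \<Longrightarrow> pdiff r (christoffel (m + k) G (m + l) i (m + j)) x = 0"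
    and "l < m \<Longrightarrow> i < k \<Longrightarrow> j < k \<Longrightarrow> pdiff r (christoffel (m + k) G l (m + i) (m + j)) x = 0"
proof -
  note cong = pdiff_cong[OF lopen_prod_dom[OF M1.U M2.U] x r]
  show "pdiff r (christoffel (m + k) G l i j) x = (if r < m then pdiff r (M1.\<Gamma> l i j) (proj1 m x)
      else 0)"
    if "l < m" "i < m" "j < m"
  proof -
    have "pdiff r (christoffel (m + k) G l i j) x = pdiff r (\<lambda>y. M1.\<Gamma> l i j (proj1 m y)) x"
      by (rule cong) (use that christoffel_prod in auto)
    with r show ?thesis by (cases rule: add_less_cases) (simp_all add: pdiff_proj1)
  qed
  show "pdiff r (christoffel (m + k) G (m + l) (m + i) (m + j)) x =
      (if r < m then 0 else pdiff (r - m) (M2.\<Gamma> l i j) (proj2 m x))" if "l < k" "i < k" "j < k"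
  proof -
    have "pdiff r (christoffel (m + k) G (m + l) (m + i) (m + j)) x = pdiff r (\<lambda>y. M2.\<Gamma> l i j (proj2
        m y)) x"
      by (rule cong) (use that christoffel_prod in auto)
    with r show ?thesis by (cases rule: add_less_cases) (simp_all add: pdiff_proj2)
  qed
  have zero: "pdiff r h x = 0" if "\<And>y. y \<in> W \<Longrightarrow> h y = 0" for h
    using cong[of h "\<lambda>_. 0"] that by simp
  show "l < k \<Longrightarrow> i < m \<Longrightarrow> j < m \<Longrightarrow> pdiff r (christoffel (m + k) G (m + l) i j) x = 0"
    "l < m \<Longrightarrow> i < k \<Longrightarrow> j < m \<Longrightarrow> pdiff r (christoffel (m + k) G l (m + i) j) x = 0"
    "l < m \<Longrightarrow> i < m \<Longrightarrow> j < k \<Longrightarrow> pdiff r (christoffel (m + k) G l i (m + j)) x = 0"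
    "l < k \<Longrightarrow> i < k \<Longrightarrow> j < m \<Longrightarrow> pdiff r (christoffel (m + k) G (m + l) (m + i) j) x = 0"
    "l < k \<Longrightarrow> i < m \<Longrightarrow> j < k \<Longrightarrow> pdiff r (christoffel (m + k) G (m + l) i (m + j)) x = 0"
    "l < m \<Longrightarrow> i < k \<Longrightarrow> j < k \<Longrightarrow> pdiff r (christoffel (m + k) G l (m + i) (m + j)) x = 0"
    by (intro zero christoffel_prod; assumption)+
qed

theorem scal_prod:
  assumes x: "x \<in> W"
  shows "scal (m + k) G x = scal m G1 (proj1 m x) + scal k G2 (proj2 m x)"
  using x
  by (simp add: scal_def riem_def sum_lessThan_add inverse_prod_metric prod_metric_simps
      christoffel_prod
      pdiff_christoffel_prod)

theorem lap_prod:
  assumes x: "x \<in> W"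
  shows "lap (m + k) G (\<lambda>y. f (proj1 m y)) x = lap m G1 f (proj1 m x)"
proof -
  have "pdiff i (pdiff j (\<lambda>y. f (proj1 m y))) x = pdiff i (pdiff j f) (proj1 m x)" if "i < m" "j <
      m" for i j
  proof -
    have "pdiff j (\<lambda>y. f (proj1 m y)) = (\<lambda>y. pdiff j f (proj1 m y))"
      using that by (intro ext pdiff_proj1)
    then show ?thesis using that by (simp add: pdiff_proj1)
  qed
  moreover have "pdiff i (pdiff (m + j) (\<lambda>y. f (proj1 m y))) x = 0" for i j
  proof -
    have "pdiff (m + j) (\<lambda>y. f (proj1 m y)) = (\<lambda>y. 0)" by (intro ext pdiff_proj1)
    then show ?thesis by simp
  qed
  ultimately show ?thesis
    using x by (simp add: lap_def sum_lessThan_add inverse_prod_metric prod_metric_simps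
        christoffel_prod
      pdiff_proj1)
qed

theorem grad_prod_prod:
  assumes x: "x \<in> W"
  shows "grad_prod (m + k) G (\<lambda>y. f (proj1 m y)) (\<lambda>y. h (proj1 m y)) x = grad_prod m G1 f h (proj1 m x)"
  using x by (simp add: grad_prod_def sum_lessThan_add inverse_prod_metric prod_metric_simps
      pdiff_proj1)

end

section \<open>Charts and tangent spaces\<close>


lemma openin_Euclidean_space_box:
  assumes "openin (Euclidean_space n) U" "x \<in> U"
  obtains e where "e > 0" "\<And>y. (\<And>i. i < n \<Longrightarrow> \<bar>y i - x i\<bar> < e) \<Longrightarrow> (\<And>i. i \<ge> n \<Longrightarrow> y i = 0) \<Longrightarrow> y \<in> U"
proof -
  obtain T where T: "openin (powertop_real UNIV) T" and U: "U = T \<inter> {x. \<forall>i\<ge>n. x i = 0}"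
    using assms(1) unfolding Euclidean_space_def openin_subtopology by blast
  from T obtain A where A: "\<And>i. open (A i)" "\<And>i. x i \<in> A i" "Pi\<^sub>E UNIV A \<subseteq> T"
    using assms(2) U unfolding openin_product_topology_alt by (force simp: PiE_iff)
  have "\<exists>e>0. \<forall>t. \<bar>t - x i\<bar> < e \<longrightarrow> t \<in> A i" for i
    using A(1,2)[of i] by (simp add: open_real)
  then obtain e where e: "\<And>i. e i > 0" "\<And>i t. \<bar>t - x i\<bar> < e i \<Longrightarrow> t \<in> A i" by metis
  show thesis
  proof
    \<comment> \<open>The 1 keeps the set nonempty when n = 0.\<close>
    show "Min (insert 1 (e ` {..<n})) > 0" using e(1) by simp
    fix y assume y: "\<And>i. i < n \<Longrightarrow> \<bar>y i - x i\<bar> < Min (insert 1 (e ` {..<n}))" "\<And>i. i \<ge> n \<Longrightarrow> y i = 0"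
    have "y i \<in> A i" for i
    proof (cases "i < n")
      case True
      then show ?thesis using y(1)[OF True] by (intro e(2)) simp
    next
      case False
      \<comment> \<open>From coordinate n on both points are zero, so finitely many radii
        suffice.\<close>
      then have "y i = x i" using y(2)[of i] assms(2) U by auto
      then show ?thesis using A(2) by simp
    qed
    then show "y \<in> U" using A(3) y(2) U by auto
  qed
qed

lemma openin_Euclidean_space_imp_lopen:
  assumes U: "openin (Euclidean_space n) U"
  shows "lopen n U"
  unfolding lopen_def
proof (intro ballI allI impI)
  fix x i assume x: "x \<in> U" and i: "i < n"
  obtain e where e: "e > 0" "\<And>y. (\<And>i. i < n \<Longrightarrow> \<bar>y i - x i\<bar> < e) \<Longrightarrow> (\<And>i. i \<ge> n \<Longrightarrow> y i = 0) \<Longrightarrow> y \<in> U"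
    using openin_Euclidean_space_box[OF U x] by metis
  have "x \<in> topspace (Euclidean_space n)" using x U openin_subset by blast
  then have "x(i := t) \<in> U" if "dist t (x i) < e" for t
    using that i e(1) by (intro e(2)) (auto simp: topspace_Euclidean_space dist_real_def)
  then show "\<forall>\<^sub>F t in nhds (x i). x(i := t) \<in> U"
    unfolding eventually_nhds_metric using e(1) by blast
qed

lemma continuous_map_Euclidean_space_box:
  assumes U: "openin (Euclidean_space n) U" and g: "continuous_map (subtopology (Euclidean_space n)
      U) euclideanreal g"
    and x: "x \<in> U" and "\<epsilon> > 0"
  obtains e where "e > 0" "\<And>y. (\<And>i. i < n \<Longrightarrow> \<bar>y i - x i\<bar> < e) \<Longrightarrow> (\<And>i. i \<ge> n \<Longrightarrow> y i = 0) \<Longrightarrow>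
    y \<in> U \<and> \<bar>g y - g x\<bar> < \<epsilon>"
proof -
  have top: "topspace (subtopology (Euclidean_space n) U) = U"
    using openin_subset[OF U] by auto
  have "openin (subtopology (Euclidean_space n) U) {y \<in> U. g y \<in> ball (g x) \<epsilon>}"
    using openin_continuous_map_preimage[OF g, of "ball (g x) \<epsilon>"] unfolding top by simp
  then have "openin (Euclidean_space n) {y \<in> U. g y \<in> ball (g x) \<epsilon>}"
    using openin_trans_full U by blast
  moreover have "x \<in> {y \<in> U. g y \<in> ball (g x) \<epsilon>}" using x assms(4) by simp
  ultimately show thesis
    by (rule openin_Euclidean_space_box) (rule that, auto simp: dist_real_def abs_minus_commute)
qed

text \<open>Endpoints in either order, or equal, since a coordinate of a curve may move both ways or
  stand still.\<close>

lemma MVT_line: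
  fixes h h' :: "real \<Rightarrow> real"
  assumes "\<And>s. min a b \<le> s \<Longrightarrow> s \<le> max a b \<Longrightarrow> (h has_field_derivative h' s) (at s)"
  shows "\<exists>s. min a b \<le> s \<and> s \<le> max a b \<and> h b - h a = h' s * (b - a)"
proof -
  consider "a < b" | "b < a" | "a = b" by linarith
  then show ?thesis
  proof cases
    case 1
    obtain z where "a < z" "z < b" "h b - h a = (b - a) * h' z"
      using MVT2[OF 1, of h h'] assms 1 by auto
    then show ?thesis by (intro exI[of _ z]) auto
  next
    case 2
    obtain z where "b < z" "z < a" "h a - h b = (a - b) * h' z"
      using MVT2[OF 2, of h h'] assms 2 by auto
    then show ?thesis by (intro exI[of _ z]) (auto simp: algebra_simps)
  qed auto
qed

text \<open>Telescoping: one coordinate is moved at a time, and the continuity of the partial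
  derivatives controls the mean values.\<close>

lemma has_field_derivative_along_curve:
  fixes f :: "(nat \<Rightarrow> real) \<Rightarrow> real" and \<gamma> :: "real \<Rightarrow> nat \<Rightarrow> real"
  assumes U: "openin (Euclidean_space n) U"
    and f: "\<And>y. y \<in> U \<Longrightarrow> ldiff n f y"
    and cont: "\<And>i. i < n \<Longrightarrow> continuous_map (subtopology (Euclidean_space n) U) euclideanreal (pdiff i f)"
    and x: "\<gamma> t0 \<in> U"
    and \<gamma>: "\<And>i. i < n \<Longrightarrow> ((\<lambda>t. \<gamma> t i) has_field_derivative \<gamma>' i) (at t0)"
    and \<gamma>0: "\<forall>\<^sub>F t in nhds t0. \<forall>i\<ge>n. \<gamma> t i = 0"
  shows "((\<lambda>t. f (\<gamma> t)) has_field_derivative (\<Sum>i<n. pdiff i f (\<gamma> t0) * \<gamma>' i)) (at t0)"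
proof -
  define x where "x = \<gamma> t0"
  \<comment> \<open>The first j coordinates have already moved from x to \<open>\<gamma> t\<close>,
    the others are still those of x.\<close>
  define mix where "mix j t = (\<lambda>i. if i < j then \<gamma> t i else x i)" for j t
  have x_zero: "x i = 0" if "i \<ge> n" for i
    using eventually_nhds_x_imp_x[OF \<gamma>0] that by (simp add: x_def)
  have xU: "x \<in> U" using x by (simp add: x_def)
  have near: "\<forall>\<^sub>F t in at t0. \<forall>i<n. \<bar>\<gamma> t i - x i\<bar> < e" if "e > 0" for e
  proof -
    have "\<forall>\<^sub>F t in at t0. \<bar>\<gamma> t i - x i\<bar> < e" if "i < n" for i
    proof -
      have "((\<lambda>t. \<gamma> t i) \<longlongrightarrow> x i) (at t0)"
        using DERIV_isCont[OF \<gamma>[OF that]] by (simp add: isCont_def x_def)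
      then show ?thesis using \<open>e > 0\<close> by (simp add: tendsto_iff dist_real_def)
    qed
    then have "\<forall>\<^sub>F t in at t0. \<forall>i\<in>{..<n}. \<bar>\<gamma> t i - x i\<bar> < e"
      by (intro eventually_ball_finite) auto
    then show ?thesis by (rule eventually_mono) auto
  qed
  have mix_Suc: "mix (Suc j) t = (mix j t)(j := \<gamma> t j)" for j t
    by (auto simp: mix_def less_Suc_eq)
  have mix_j: "mix j t = (mix j t)(j := x j)" for j t
    by (auto simp: mix_def)
  have step: "((\<lambda>t. f (mix (Suc j) t) - f (mix j t)) has_field_derivative pdiff j f x * \<gamma>' j) (at t0)"
    if j: "j < n" for j
  proof -
    \<comment> \<open>States that s is a mean value point for the move of coordinate j at time
      t.\<close>
    define P where "P t s \<longleftrightarrow> min (x j) (\<gamma> t j) \<le> s \<and> s \<le> max (x j) (\<gamma> t j) \<and>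
      f (mix (Suc j) t) - f (mix j t) = pdiff j f ((mix j t)(j := s)) * (\<gamma> t j - x j)" for t s
    have box: "\<bar>((mix j t)(j := s)) i - x i\<bar> < e" "i \<ge> n \<Longrightarrow> ((mix j t)(j := s)) i = 0"
      if "\<forall>i<n. \<bar>\<gamma> t i - x i\<bar> < e" "min (x j) (\<gamma> t j) \<le> s" "s \<le> max (x j) (\<gamma> t j)" "e > 0" for t s i e
      using that j x_zero by (force simp: mix_def)+
    obtain e0 where e0: "e0 > 0" "\<And>y. (\<And>i. i < n \<Longrightarrow> \<bar>y i - x i\<bar> < e0) \<Longrightarrow> (\<And>i. i \<ge> n \<Longrightarrow> y i = 0) \<Longrightarrow> y \<in> U"
      using openin_Euclidean_space_box[OF U xU] by metis
    have ex: "\<forall>\<^sub>F t in at t0. \<exists>s. P t s"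
      using near[OF e0(1)]
    proof eventually_elim
      case (elim t)
      have "\<exists>s\<ge>min (x j) (\<gamma> t j). s \<le> max (x j) (\<gamma> t j) \<and>
        f ((mix j t)(j := \<gamma> t j)) - f ((mix j t)(j := x j)) = pdiff j f ((mix j t)(j := s)) * (\<gamma> t j
            - x j)"
      proof (rule MVT_line)
        fix s assume "min (x j) (\<gamma> t j) \<le> s" "s \<le> max (x j) (\<gamma> t j)"
        then have "(mix j t)(j := s) \<in> U"
          using box[OF elim] e0 by blast
        from ldiffD[OF f[OF this] j]
        show "((\<lambda>s. f ((mix j t)(j := s))) has_field_derivative pdiff j f ((mix j t)(j := s))) (at s)"
          by (simp add: has_pdiff_def)
      qed
      then show ?case unfolding P_def mix_Suc using mix_j[of j t] by auto
    qed
    \<comment> \<open>The partial derivative at a chosen mean value point. These points lie in the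
      boxes around x that contain \<open>\<gamma> t\<close>, so continuity of the partial derivative
      gives the limit of q.\<close>
    define q where "q t = pdiff j f ((mix j t)(j := (SOME s. P t s)))" for t
    have q: "\<forall>\<^sub>F t in at t0. P t (SOME s. P t s)"
      using ex by eventually_elim (rule someI_ex)
    have "(q \<longlongrightarrow> pdiff j f x) (at t0)"
      unfolding tendsto_iff
    proof (intro allI impI)
      fix \<epsilon> :: real assume "\<epsilon> > 0"
      then obtain e where e: "e > 0" "\<And>y. (\<And>i. i < n \<Longrightarrow> \<bar>y i - x i\<bar> < e) \<Longrightarrow> (\<And>i. i \<ge> n \<Longrightarrow> y i = 0) \<Longrightarrow>
          y \<in> U \<and> \<bar>pdiff j f y - pdiff j f x\<bar> < \<epsilon>"
        using continuous_map_Euclidean_space_box[OF U cont[OF j] xU] by metis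
      show "\<forall>\<^sub>F t in at t0. dist (q t) (pdiff j f x) < \<epsilon>"
        using near[OF e(1)] q
      proof eventually_elim
        case (elim t)
        have "\<bar>pdiff j f ((mix j t)(j := SOME s. P t s)) - pdiff j f x\<bar> < \<epsilon>"
          using e(2)[of "(mix j t)(j := SOME s. P t s)"] box[OF elim(1) _ _ e(1)] elim(2) unfolding
              P_def by blast
        then show ?case by (simp add: q_def dist_real_def)
      qed
    qed
    moreover have "((\<lambda>t. (\<gamma> t j - x j) / (t - t0)) \<longlongrightarrow> \<gamma>' j) (at t0)"
      using \<gamma>[OF j] by (simp add: has_field_derivative_iff x_def)
    ultimately have "((\<lambda>t. q t * ((\<gamma> t j - x j) / (t - t0))) \<longlongrightarrow> pdiff j f x * \<gamma>' j) (at t0)"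
      by (rule tendsto_mult)
    moreover have "\<forall>\<^sub>F t in at t0. q t * ((\<gamma> t j - x j) / (t - t0)) =
        (f (mix (Suc j) t) - f (mix j t) - (f (mix (Suc j) t0) - f (mix j t0))) / (t - t0)"
      using q
    proof eventually_elim
      case (elim t)
      have "mix (Suc j) t0 = mix j t0" by (auto simp: mix_def x_def)
      then show ?case using elim unfolding P_def q_def by simp
    qed
    ultimately show ?thesis
      unfolding has_field_derivative_iff by (rule Lim_transform_eventually)
  qed
  have "((\<lambda>t. f x + (\<Sum>j<n. f (mix (Suc j) t) - f (mix j t))) has_field_derivative
      (0 + (\<Sum>j<n. pdiff j f x * \<gamma>' j))) (at t0)"
    by (intro DERIV_add DERIV_const DERIV_sum step) auto
  moreover have "\<forall>\<^sub>F t in nhds t0. f (\<gamma> t) = f x + (\<Sum>j<n. f (mix (Suc j) t) - f (mix j t))"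
    using \<gamma>0
  proof eventually_elim
    case (elim t)
    have "mix n t = \<gamma> t" using elim x_zero by (auto simp: mix_def)
    moreover have "mix 0 t = x" by (simp add: mix_def)
    ultimately show ?case by (simp add: sum_lessThan_telescope[of "\<lambda>j. f (mix j t)"])
  qed
  ultimately show ?thesis by (simp add: DERIV_cong_ev[OF refl _ refl] x_def)
qed

section \<open>Charts and changes of coordinate vectors\<close>

lemma smooth_on_imp_C2_lines:
  assumes "smooth_on n U f"
  shows "C2_lines n U f"
proof -
  have "\<forall>x\<in>U. ldiff n (iter_pdiff js f) x" if "set js \<subseteq> {..<n}" for js
    using assms that by (simp add: smooth_on_def ldiff_def)
  from this[of "[]"] this[of "[i]" for i] show ?thesis by (auto simp: C2_lines_def)
qed

lemma smooth_on_continuous_pdiff: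
  assumes "smooth_on n U f" "i < n"
  shows "continuous_map (subtopology (Euclidean_space n) U) euclideanreal (pdiff i f)"
proof -
  have "continuous_map (subtopology (Euclidean_space n) U) euclideanreal (iter_pdiff [i] f)"
    using assms unfolding smooth_on_def by (metis empty_subsetI insert_subset lessThan_iff
        list.set(1,2))
  then show ?thesis by simp
qed

lemma smooth_manifoldD:
  assumes "smooth_manifold M" "c \<in> atlas M"
  shows "openin (mtop M) (chart_dom c)"
    and "openin (Euclidean_space (mdim M)) (chart_map c ` chart_dom c)"
    and "homeomorphic_map (subtopology (mtop M) (chart_dom c))
          (subtopology (Euclidean_space (mdim M)) (chart_map c ` chart_dom c)) (chart_map c)"
    and "d \<in> atlas M \<Longrightarrow> i < mdim M \<Longrightarrow>
        smooth_on (mdim M) (chart_map c ` (chart_dom c \<inter> chart_dom d)) (\<lambda>x. chart_map d (chart_inv c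
            x) i)"
  using assms unfolding smooth_manifold_def by blast+

lemma inj_on_chart_map:
  assumes "smooth_manifold M" "c \<in> atlas M"
  shows "inj_on (chart_map c) (chart_dom c)"
proof -
  have "inj_on (chart_map c) (topspace (subtopology (mtop M) (chart_dom c)))"
    using smooth_manifoldD(3)[OF assms] by (simp add: homeomorphic_eq_everything_map)
  moreover have "topspace (subtopology (mtop M) (chart_dom c)) = chart_dom c"
    using openin_subset[OF smooth_manifoldD(1)[OF assms]] by auto
  ultimately show ?thesis by simp
qed

lemma chart_inv_chart_map:
  "smooth_manifold M \<Longrightarrow> c \<in> atlas M \<Longrightarrow> p \<in> chart_dom c \<Longrightarrow> chart_inv c (chart_map c p) = p"
  by (rule inv_into_f_f[OF inj_on_chart_map])

lemma openin_chart_image: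
  assumes M: "smooth_manifold M" "c \<in> atlas M" and V: "openin (mtop M) V"
  shows "openin (Euclidean_space (mdim M)) (chart_map c ` (V \<inter> chart_dom c))"
proof -
  have "openin (subtopology (mtop M) (chart_dom c)) (V \<inter> chart_dom c)"
    using V by (auto simp: openin_subtopology)
  then have "openin (subtopology (Euclidean_space (mdim M)) (chart_map c ` chart_dom c))
      (chart_map c ` (V \<inter> chart_dom c))"
    using homeomorphic_imp_open_map[OF smooth_manifoldD(3)[OF M]] by (simp add: open_map_def)
  then show ?thesis using openin_trans_full smooth_manifoldD(2)[OF M] by blast
qed

lemma chart_map_zero:
  assumes M: "smooth_manifold M" "c \<in> atlas M" and "p \<in> chart_dom c" "i \<ge> mdim M"
  shows "chart_map c p i = 0"
  using openin_subset[OF smooth_manifoldD(2)[OF M]] assms by (auto simp: topspace_Euclidean_space)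

text \<open>Coordinate functions serve as test functions for coordinate vectors, which would return
  the default 0 without this smoothness.\<close>

lemma smooth_near_chart_map:
  assumes M: "smooth_manifold M" "c \<in> atlas M" and "p \<in> chart_dom c" "j < mdim M"
  shows "smooth_near M p (\<lambda>q. chart_map c q j)"
  unfolding smooth_near_def smooth_map_on_def
proof (intro exI conjI ballI)
  show "openin (mtop M) (chart_dom c)" by (rule smooth_manifoldD(1)[OF M])
  show "p \<in> chart_dom c" by fact
  fix d assume "d \<in> atlas M"
  then show "smooth_on (mdim M) (chart_map d ` (chart_dom c \<inter> chart_dom d)) ((\<lambda>q. chart_map c q j) \<circ>
      chart_inv d)"
    using smooth_manifoldD(4)[OF M(1) _ M(2) assms(4)] by (simp add: Int_commute[of _ "chart_dom d"]
        o_def)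
qed

lemma lopen_chart_image:
  assumes M: "smooth_manifold M" "c \<in> atlas M"
  shows "lopen (mdim M) (chart_map c ` chart_dom c)"
  by (rule openin_Euclidean_space_imp_lopen) (rule smooth_manifoldD(2)[OF M])

lemma coord_vec_chart_map:
  assumes M: "smooth_manifold M" "c \<in> atlas M" and p: "p \<in> chart_dom c" and ij: "i < mdim M" "j <
      mdim M"
  shows "coord_vec M c p i (\<lambda>q. chart_map c q j) = (if i = j then 1 else 0)"
proof -
  have "coord_vec M c p i (\<lambda>q. chart_map c q j) = pdiff i (\<lambda>x. chart_map c (chart_inv c x) j)
      (chart_map c p)"
    using smooth_near_chart_map[OF M p ij(2)] by (simp add: coord_vec_def o_def)
  also have "\<dots> = pdiff i (\<lambda>x. x j) (chart_map c p)"
    by (rule pdiff_cong[OF lopen_chart_image[OF M]]) (use p ij in \<open>auto simp: f_inv_into_f\<close>)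
  also have "\<dots> = (if i = j then 1 else 0)"
    by (rule has_pdiff_imp_pdiff) (auto simp: has_pdiff_def)
  finally show ?thesis .
qed

text \<open>The chain rule for f read in c along the transition map from d. On functions that are
  not smooth near p both sides take the default value 0.\<close>

lemma coord_vec_transform:
  assumes M: "smooth_manifold M" and c: "c \<in> atlas M" "p \<in> chart_dom c" and d: "d \<in> atlas M" "p \<in>
      chart_dom d"
    and i: "i < mdim M"
  shows "coord_vec M d p i f =
    (\<Sum>j<mdim M. pdiff i (\<lambda>x. chart_map c (chart_inv d x) j) (chart_map d p) * coord_vec M c p j f)"
proof (cases "smooth_near M p f")
  case False
  then show ?thesis by (simp add: coord_vec_def)
next
  case True
  then obtain V where V: "openin (mtop M) V" "p \<in> V" "smooth_map_on M V f"
    by (auto simp: smooth_near_def)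
  define n where "n = mdim M"
  define y where "y = chart_map d p"
  define U where "U = chart_map c ` (V \<inter> chart_dom c)"
  define W where "W = chart_map d ` (chart_dom c \<inter> V \<inter> chart_dom d)"
  \<comment> \<open>The i-th coordinate line of d through p, seen in the chart c.\<close>
  define \<gamma> where "\<gamma> t = chart_map c (chart_inv d (y(i := t)))" for t
  have U: "openin (Euclidean_space n) U" unfolding U_def n_def by (rule openin_chart_image[OF M c(1)
      V(1)])
  have W: "openin (Euclidean_space n) W" unfolding W_def n_def
    by (intro openin_chart_image[OF M d(1)] openin_Int smooth_manifoldD(1)[OF M c(1)] V(1))
  have yW: "y \<in> W" using c(2) d(2) V(2) by (auto simp: y_def W_def)
  have "\<forall>\<^sub>F t in nhds (y i). y(i := t) \<in> W"
    using lopenD[OF openin_Euclidean_space_imp_lopen[OF W] yW] i by (simp add: n_def)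
  moreover have W_inv: "chart_inv d z \<in> chart_dom c \<inter> V" if "z \<in> W" for z
    using that chart_inv_chart_map[OF M d(1)] by (auto simp: W_def)
  ultimately have ev: "\<forall>\<^sub>F t in nhds (y i). chart_inv d (y(i := t)) \<in> chart_dom c \<inter> V"
    by (auto elim: eventually_mono)
  have \<gamma>y: "\<gamma> (y i) = chart_map c p" unfolding \<gamma>_def y_def using chart_inv_chart_map[OF M d] by simp
  have smooth: "smooth_on n U (f \<circ> chart_inv c)"
    using V(3) c(1) by (simp add: smooth_map_on_def U_def n_def)
  have "((\<lambda>t. (f \<circ> chart_inv c) (\<gamma> t)) has_field_derivative
      (\<Sum>j<n. pdiff j (f \<circ> chart_inv c) (\<gamma> (y i)) * pdiff i (\<lambda>x. chart_map c (chart_inv d x) j) y))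
          (at (y i))"
  proof (rule has_field_derivative_along_curve[OF U])
    show "ldiff n (f \<circ> chart_inv c) z" if "z \<in> U" for z
      using smooth_on_imp_C2_lines[OF smooth] that by (simp add: C2_lines_def)
    show "continuous_map (subtopology (Euclidean_space n) U) euclideanreal (pdiff j (f \<circ> chart_inv c))"
      if "j < n" for j by (rule smooth_on_continuous_pdiff[OF smooth that])
    show "\<gamma> (y i) \<in> U" using c(2) V(2) by (auto simp: \<gamma>y U_def)
    show "((\<lambda>t. \<gamma> t j) has_field_derivative pdiff i (\<lambda>x. chart_map c (chart_inv d x) j) y) (at (y i))"
      if "j < n" for j
    proof -
      have "smooth_on n (chart_map d ` (chart_dom d \<inter> chart_dom c)) (\<lambda>x. chart_map c (chart_inv d x) j)"
        using smooth_manifoldD(4)[OF M d(1) c(1)] that by (simp add: n_def)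
      then have "ldiff n (\<lambda>x. chart_map c (chart_inv d x) j) y"
        using smooth_on_imp_C2_lines c(2) d(2) by (auto simp: C2_lines_def y_def)
      then show ?thesis using ldiffD[of n _ y i] i by (simp add: has_pdiff_def n_def \<gamma>_def)
    qed
    show "\<forall>\<^sub>F t in nhds (y i). \<forall>j\<ge>n. \<gamma> t j = 0"
      using ev by eventually_elim (use chart_map_zero[OF M c(1)] in \<open>auto simp: \<gamma>_def n_def\<close>)
  qed
  moreover have "\<forall>\<^sub>F t in nhds (y i). (f \<circ> chart_inv c) (\<gamma> t) = (f \<circ> chart_inv d) (y(i := t))"
    using ev by eventually_elim (use chart_inv_chart_map[OF M c(1)] in \<open>simp add: \<gamma>_def\<close>)
  ultimately have "has_pdiff i (f \<circ> chart_inv d)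
      (\<Sum>j<n. pdiff j (f \<circ> chart_inv c) (\<gamma> (y i)) * pdiff i (\<lambda>x. chart_map c (chart_inv d x) j) y) y"
    unfolding has_pdiff_def by (subst DERIV_cong_ev[OF refl _ refl, symmetric]) assumption+
  from has_pdiff_imp_pdiff[OF this] True show ?thesis
    by (simp add: coord_vec_def \<gamma>y[unfolded y_def] n_def y_def mult.commute)
qed

text \<open>\<open>tangent_space\<close> collects the vectors of all charts around p; the
  transformation rule reduces them to a single chart, in which the axioms for the metric become
  statements about components.\<close>

lemma tangent_space_chart:
  assumes M: "smooth_manifold M" and c: "c \<in> atlas M" "p \<in> chart_dom c"
  shows "tangent_space M p = {v. \<exists>a. v = (\<lambda>f. \<Sum>i<mdim M. a i * coord_vec M c p i f)}"
proof (intro equalityI subsetI)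
  fix v assume "v \<in> tangent_space M p"
  then obtain d a where d: "d \<in> atlas M" "p \<in> chart_dom d"
    and v: "v = (\<lambda>f. \<Sum>i<mdim M. a i * coord_vec M d p i f)" by (auto simp: tangent_space_def)
  define T where "T i j = pdiff i (\<lambda>x. chart_map c (chart_inv d x) j) (chart_map d p)" for i j
  have "v f = (\<Sum>j<mdim M. (\<Sum>i<mdim M. a i * T i j) * coord_vec M c p j f)" for f
  proof -
    have "v f = (\<Sum>i<mdim M. \<Sum>j<mdim M. a i * T i j * coord_vec M c p j f)"
      by (simp add: v coord_vec_transform[OF M c d] T_def sum_distrib_left mult.assoc)
    then show ?thesis by (subst (asm) sum.swap) (simp add: sum_distrib_right)
  qed
  then have "v = (\<lambda>f. \<Sum>j<mdim M. (\<Sum>i<mdim M. a i * T i j) * coord_vec M c p j f)" by (rule ext)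
  then show "v \<in> {v. \<exists>a. v = (\<lambda>f. \<Sum>i<mdim M. a i * coord_vec M c p i f)}"
    unfolding mem_Collect_eq by (rule exI[of _ "\<lambda>j. \<Sum>i<mdim M. a i * T i j"])
qed (use c in \<open>auto simp: tangent_space_def\<close>)

section \<open>The metric and the gradient in a chart\<close>

locale pr_chart =
  fixes M :: "('a, 'z) pr_manifold_scheme" and c :: "'a chart"
  assumes pr: "pseudo_riemannian M" and c: "c \<in> atlas M"
begin

abbreviation "n \<equiv> mdim M"
abbreviation "U \<equiv> chart_map c ` chart_dom c"
abbreviation "G \<equiv> metric_comp M c"

lemma M: "smooth_manifold M"
  using pr by (simp add: pseudo_riemannian_def)

lemma dom_points: "p \<in> chart_dom c \<Longrightarrow> p \<in> points M"
  using openin_subset[OF smooth_manifoldD(1)[OF M c]] by blast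

lemma
  assumes "p \<in> chart_dom c"
  shows metric_sym: "u \<in> tangent_space M p \<Longrightarrow> v \<in> tangent_space M p \<Longrightarrow> metric M p u v = metric M p v u"
    and metric_linear: "u \<in> tangent_space M p \<Longrightarrow> v \<in> tangent_space M p \<Longrightarrow> w \<in> tangent_space M p \<Longrightarrow>
      metric M p (\<lambda>f. a * u f + b * v f) w = a * metric M p u w + b * metric M p v w"
    and metric_nondeg: "u \<in> tangent_space M p \<Longrightarrow> (\<And>v. v \<in> tangent_space M p \<Longrightarrow> metric M p u v = 0) \<Longrightarrow>
      u = (\<lambda>f. 0)"
  using pr dom_points[OF assms] unfolding pseudo_riemannian_def by blast+

definition comb :: "'a \<Rightarrow> (nat \<Rightarrow> real) \<Rightarrow> 'a tvec" where
  "comb p a = (\<lambda>f. \<Sum>i<n. a i * coord_vec M c p i f)"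

lemma tangent_space_eq: "p \<in> chart_dom c \<Longrightarrow> tangent_space M p = range (comb p)"
  using tangent_space_chart[OF M c] by (auto simp: comb_def)

lemma coord_vec_eq_comb: "i < n \<Longrightarrow> coord_vec M c p i = comb p (\<lambda>j. if j = i then 1 else 0)"
  by (simp add: comb_def mult_delta_left)

text \<open>Evaluation at the coordinate functions recovers the coefficients.\<close>

lemma comb_inj:
  assumes p: "p \<in> chart_dom c" and eq: "comb p a = comb p b" and i: "i < n"
  shows "a i = b i"
proof -
  have "comb p a (\<lambda>q. chart_map c q i) = a i" for a
    using coord_vec_chart_map[OF M c p _ i] i by (simp add: comb_def mult_delta_right)
  then show ?thesis using eq by metis
qed

lemma metric_zero:
  assumes p: "p \<in> chart_dom c" and w: "w \<in> tangent_space M p"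
  shows "metric M p (\<lambda>f. 0) w = 0" and "metric M p w (\<lambda>f. 0) = 0"
proof -
  have "metric M p (\<lambda>f. 0 * w f + 0 * w f) w = 0"
    by (subst metric_linear[OF p w w w]) simp
  then show *: "metric M p (\<lambda>f. 0) w = 0" by simp
  have "(\<lambda>f. 0) = comb p (\<lambda>_. 0)" by (simp add: comb_def)
  then have "(\<lambda>f. 0) \<in> tangent_space M p" using tangent_space_eq[OF p] by auto
  then show "metric M p w (\<lambda>f. 0) = 0" using * metric_sym[OF p w] by simp
qed

lemma metric_comb_left:
  assumes p: "p \<in> chart_dom c" and w: "w \<in> tangent_space M p"
  shows "metric M p (comb p a) w = (\<Sum>i<n. a i * metric M p (coord_vec M c p i) w)"
proof -
  have "metric M p (\<lambda>f. \<Sum>i<r. a i * coord_vec M c p i f) w = (\<Sum>i<r. a i * metric M p (coord_vec M c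
      p i) w)"
    if "r \<le> n" for r
    using that
  proof (induction r)
    case 0
    then show ?case using metric_zero(1)[OF p w] by simp
  next
    case (Suc r)
    \<comment> \<open>Linearity of the metric is available only for tangent vectors; padding the
      coefficients with zeros shows that the partial sum is one.\<close>
    have "(\<lambda>f. \<Sum>i<r. a i * coord_vec M c p i f) = comb p (\<lambda>i. if i < r then a i else 0)"
    proof
      fix f
      have "(\<Sum>i<n. (if i < r then a i else 0) * coord_vec M c p i f) =
          (\<Sum>i\<in>{..<n} \<inter> {i. i < r}. a i * coord_vec M c p i f)"
        by (subst sum.inter_restrict) (auto intro: sum.cong)
      also have "{..<n} \<inter> {i. i < r} = {..<r}" using Suc.prems by auto
      finally show "(\<Sum>i<r. a i * coord_vec M c p i f) = comb p (\<lambda>i. if i < r then a i else 0) f"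
        by (simp add: comb_def)
    qed
    then have 1: "(\<lambda>f. \<Sum>i<r. a i * coord_vec M c p i f) \<in> tangent_space M p"
      using tangent_space_eq[OF p] by auto
    have 2: "coord_vec M c p r \<in> tangent_space M p"
      using Suc.prems coord_vec_eq_comb[of r p] tangent_space_eq[OF p] by auto
    have "metric M p (\<lambda>f. 1 * (\<Sum>i<r. a i * coord_vec M c p i f) + a r * coord_vec M c p r f) w =
        1 * metric M p (\<lambda>f. \<Sum>i<r. a i * coord_vec M c p i f) w + a r * metric M p (coord_vec M c p r) w"
      by (rule metric_linear[OF p 1 2 w])
    then show ?case using Suc by simp
  qed
  then show ?thesis by (simp add: comb_def)
qed

lemma metric_comp_chart_map:
  "p \<in> chart_dom c \<Longrightarrow> G (chart_map c p) i j = metric M p (coord_vec M c p i) (coord_vec M c p j)"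
  by (simp add: metric_comp_def Let_def chart_inv_chart_map[OF M c])

lemma coord_vec_tangent: "p \<in> chart_dom c \<Longrightarrow> i < n \<Longrightarrow> coord_vec M c p i \<in> tangent_space M p"
  using coord_vec_eq_comb[of i p] tangent_space_eq by auto

lemma comb_tangent: "p \<in> chart_dom c \<Longrightarrow> comb p a \<in> tangent_space M p"
  using tangent_space_eq by auto

lemma metric_comb:
  assumes p: "p \<in> chart_dom c"
  shows "metric M p (comb p a) (comb p b) = (\<Sum>i<n. \<Sum>j<n. a i * b j * G (chart_map c p) i j)"
proof -
  have "metric M p (coord_vec M c p i) (comb p b) = (\<Sum>j<n. b j * G (chart_map c p) i j)" if "i < n"
      for i
  proof -
    have "metric M p (coord_vec M c p i) (comb p b) = metric M p (comb p b) (coord_vec M c p i)"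
      using metric_sym[OF p] coord_vec_tangent[OF p that] comb_tangent[OF p] by blast
    also have "\<dots> = (\<Sum>j<n. b j * metric M p (coord_vec M c p j) (coord_vec M c p i))"
      by (rule metric_comb_left[OF p coord_vec_tangent[OF p that]])
    also have "\<dots> = (\<Sum>j<n. b j * G (chart_map c p) i j)"
      using metric_sym[OF p] coord_vec_tangent[OF p] that
      by (intro sum.cong refl) (simp add: metric_comp_chart_map[OF p])
    finally show ?thesis .
  qed
  then show ?thesis
    by (simp add: metric_comb_left[OF p comb_tangent[OF p]] sum_distrib_left mult.assoc)
qed

text \<open>A kernel vector of the matrix represents a tangent vector orthogonal to all others; this
  vector is 0, and \<open>comb_inj\<close> carries the conclusion back to the coefficients.\<close>

lemma nondeg_form_G:
  assumes p: "p \<in> chart_dom c"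
  shows "nondeg_form n (G (chart_map c p))"
  unfolding nondeg_form_def
proof (intro conjI allI impI)
  fix i j assume "i < n" "j < n"
  then show "G (chart_map c p) i j = G (chart_map c p) j i"
    using metric_sym[OF p] coord_vec_tangent[OF p] by (simp add: metric_comp_chart_map[OF p])
next
  fix a i assume a: "\<forall>j<n. (\<Sum>i<n. G (chart_map c p) i j * a i) = 0" and i: "i < n"
  have "comb p a = (\<lambda>f. 0)"
  proof (rule metric_nondeg[OF p comb_tangent[OF p]])
    fix v assume "v \<in> tangent_space M p"
    then obtain b where "v = comb p b" using tangent_space_eq[OF p] by auto
    then have "metric M p (comb p a) v = (\<Sum>j<n. b j * (\<Sum>i<n. G (chart_map c p) i j * a i))"
      by (simp add: metric_comb[OF p]) (subst sum.swap, simp add: sum_distrib_left mult_ac)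
    then show "metric M p (comb p a) v = 0" using a by simp
  qed
  also have "(\<lambda>f. 0) = comb p (\<lambda>_. 0)" by (simp add: comb_def)
  finally have "comb p a = comb p (\<lambda>_. 0)" .
  from comb_inj[OF p this i] show "a i = 0" .
qed

lemma local_metric_chart: "local_metric n U G"
proof
  show "lopen n U" by (rule lopen_chart_image[OF M c])
  show "nondeg_form n (G x)" if "x \<in> U" for x using that nondeg_form_G by auto
  show "C2_lines n U (\<lambda>x. G x i j)" if "i < n" "j < n" for i j
    using that pr c unfolding pseudo_riemannian_def by (intro smooth_on_imp_C2_lines) blast
qed

lemma C2_lines_chart:
  assumes "smooth_map_on M (points M) f"
  shows "C2_lines n U (f \<circ> chart_inv c)"
proof (rule smooth_on_imp_C2_lines)
  have "points M \<inter> chart_dom c = chart_dom c" using dom_points by auto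
  then show "smooth_on n U (f \<circ> chart_inv c)" using assms c by (metis smooth_map_on_def)
qed

text \<open>The gradient is the differential with its index raised; nondegeneracy makes it unique,
  as the definite description in \<open>gradient\<close> demands.\<close>

lemma grad_norm_sq_eq:
  assumes p: "p \<in> chart_dom c" and f: "smooth_map_on M (points M) f"
  shows "grad_norm_sq M f p = grad_prod n G (f \<circ> chart_inv c) (f \<circ> chart_inv c) (chart_map c p)"
proof -
  define x where "x = chart_map c p"
  define K where "K = inverse_matrix n (G x)"
  define d where "d i = pdiff i (f \<circ> chart_inv c) x" for i
  define a where "a i = (\<Sum>j<n. K i j * d j)" for i
  have sp: "nondeg_form n (G x)" unfolding x_def by (rule nondeg_form_G[OF p])
  have "smooth_near M p f" unfolding smooth_near_def using f dom_points[OF p] by (intro exI[of _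
      "points M"]) auto
  then have df: "comb p b f = (\<Sum>j<n. b j * d j)" for b by (simp add: comb_def coord_vec_def d_def x_def)
  have a: "(\<Sum>i<n. G x i j * a i) = d j" if "j < n" for j
  proof -
    have "(\<Sum>i<n. G x i j * a i) = (\<Sum>i<n. \<Sum>l<n. G x j i * K i l * d l)"
      using sp that by (intro sum.cong refl) (simp add: a_def sum_distrib_left nondeg_form_def
          mult.assoc)
    also have "\<dots> = (\<Sum>l<n. (if j = l then 1 else 0) * d l)"
      by (subst sum.swap) (use that in \<open>simp add: K_def inverse_matrix_right[OF sp] flip:
          sum_distrib_right\<close>)
    finally show ?thesis using that by (simp add: sum_delta_left)
  qed
  have grad: "metric M p (comb p a) w = w f" if w: "w \<in> tangent_space M p" for w
  proof -
    obtain b where b: "w = comb p b" using w tangent_space_eq[OF p] by auto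
    have "metric M p (comb p a) w = (\<Sum>j<n. b j * (\<Sum>i<n. G x i j * a i))"
      unfolding b metric_comb[OF p] x_def by (subst sum.swap) (simp add: sum_distrib_left mult_ac)
    then show ?thesis by (simp add: a b df)
  qed
  have "gradient M f p = comb p a"
    unfolding gradient_def
  proof (rule the_equality)
    show "comb p a \<in> tangent_space M p \<and> (\<forall>w\<in>tangent_space M p. metric M p (comb p a) w = w f)"
      using grad comb_tangent[OF p] by blast
    fix v assume v: "v \<in> tangent_space M p \<and> (\<forall>w\<in>tangent_space M p. metric M p v w = w f)"
    \<comment> \<open>The difference is spelled as a linear combination to fit the linearity axiom
      of the metric.\<close>
    have "(\<lambda>h. 1 * v h + (-1) * comb p a h) = (\<lambda>h. 0)"
    proof (rule metric_nondeg[OF p])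
      obtain b where "v = comb p b" using v tangent_space_eq[OF p] by auto
      then have "(\<lambda>h. 1 * v h + (-1) * comb p a h) = comb p (\<lambda>i. b i - a i)"
        by (auto simp: comb_def sum_subtractf left_diff_distrib)
      then show "(\<lambda>h. 1 * v h + (-1) * comb p a h) \<in> tangent_space M p"
        using comb_tangent[OF p] by metis
      show "metric M p (\<lambda>h. 1 * v h + (-1) * comb p a h) w = 0" if "w \<in> tangent_space M p" for w
        using metric_linear[OF p _ comb_tangent[OF p] that, of v 1 "-1" a] v grad that by simp
    qed
    then show "v = comb p a" by (metis (no_types, lifting) eq_iff_diff_eq_0 ext mult_1 mult_minus1
        diff_conv_add_uminus)
  qed
  then have "grad_norm_sq M f p = (\<Sum>j<n. a j * d j)"
    using grad[OF comb_tangent[OF p]] by (simp add: grad_norm_sq_def df)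
  also have "\<dots> = grad_prod n G (f \<circ> chart_inv c) (f \<circ> chart_inv c) x"
    by (simp add: grad_prod_def a_def sum_distrib_left K_def d_def mult_ac)
  finally show ?thesis by (simp add: x_def)
qed

end

lemma pseudo_riemannian_chart_at:
  assumes "pseudo_riemannian M" "p \<in> points M"
  shows "chart_at M p \<in> atlas M" and "p \<in> chart_dom (chart_at M p)"
  using assms unfolding pseudo_riemannian_def smooth_manifold_def by blast+

lemma scalar_curvature_eq:
  assumes "pseudo_riemannian M" "p \<in> points M"
  shows "scalar_curvature M p = scal (mdim M) (metric_comp M (chart_at M p)) (chart_map (chart_at M
      p) p)"
    and "laplacian M f p = lap (mdim M) (metric_comp M (chart_at M p)) (f \<circ> chart_inv (chart_at M p))
      (chart_map (chart_at M p) p)"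
proof -
  have at: "chart_at M p \<in> atlas M" "p \<in> chart_dom (chart_at M p)"
    by (rule pseudo_riemannian_chart_at[OF assms])+
  interpret pr_chart M "chart_at M p" by standard (use assms at in auto)
  interpret local_metric n U G by (rule local_metric_chart)
  show "scalar_curvature M p = scal n G (chart_map (chart_at M p) p)"
    unfolding scalar_curvature_def Let_def by (rule metric_trace_ricci) (use at in auto)
  show "laplacian M f p = lap n G (f \<circ> chart_inv (chart_at M p)) (chart_map (chart_at M p) p)"
    unfolding laplacian_def Let_def by (rule metric_trace_hessian) (use at in \<open>auto intro: G_sp\<close>)
qed

section \<open>Charts of the product manifold\<close>


lemma continuous_map_proj1:
  "continuous_map (subtopology (Euclidean_space (m + k)) (prod_dom m U V)) (subtopology
      (Euclidean_space m) U) (proj1 m)"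
proof -
  have "continuous_map (subtopology (Euclidean_space (m + k)) (prod_dom m U V)) euclideanreal (\<lambda>x.
      proj1 m x i)" for i
    unfolding Euclidean_space_def proj1_def
    by (cases "i < m") (auto intro!: continuous_map_from_subtopology continuous_map_product_projection)
  then show ?thesis
    unfolding continuous_map_in_subtopology Euclidean_space_def[of m]
    by (auto simp: continuous_map_componentwise_UNIV prod_dom_def proj1_def)
qed

lemma continuous_map_proj2:
  "continuous_map (subtopology (Euclidean_space (m + k)) (prod_dom m U V)) (subtopology
      (Euclidean_space k) V) (proj2 m)"
proof -
  have "continuous_map (subtopology (Euclidean_space (m + k)) (prod_dom m U V)) euclideanreal (\<lambda>x.
      proj2 m x i)" for i
    unfolding Euclidean_space_def proj2_def
    by (auto intro!: continuous_map_from_subtopology continuous_map_product_projection)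
  then show ?thesis
    unfolding continuous_map_in_subtopology Euclidean_space_def[of k]
    by (auto simp: continuous_map_componentwise_UNIV prod_dom_def proj2_def topspace_Euclidean_space)
qed

text \<open>Every iterated derivative of the pulled back function is itself a pullback, which
  reduces existence and continuity to the factor.\<close>

lemma smooth_on_proj1:
  assumes U: "lopen m U" and V: "lopen k V" and g: "smooth_on m U g"
    and h: "\<And>x. x \<in> prod_dom m U V \<Longrightarrow> h x = g (proj1 m x)"
  shows "smooth_on (m + k) (prod_dom m U V) h"
proof -
  let ?W = "prod_dom m U V"
  note W = lopen_prod_dom[OF U V]
  \<comment> \<open>A single direction from the other factor kills the whole iterated
    derivative.\<close>
  define D where "D js = (if set js \<subseteq> {..<m} then iter_pdiff js g else (\<lambda>_. 0))" for js
  have iter: "iter_pdiff js h x = D js (proj1 m x)" if "set js \<subseteq> {..<m + k}" "x \<in> ?W" for js x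
    using that
  proof (induction js arbitrary: x)
    case Nil
    then show ?case by (simp add: h D_def)
  next
    case (Cons i js)
    have i: "i < m + k" using Cons.prems by simp
    have "pdiff i (iter_pdiff js h) x = pdiff i (\<lambda>x. D js (proj1 m x)) x"
      by (rule pdiff_cong[OF W Cons.prems(2) i]) (rule Cons.IH, use Cons.prems in auto)
    also have "\<dots> = D (i # js) (proj1 m x)"
      using i by (cases rule: add_less_cases)
        (simp_all add: pdiff_proj1(1)[of _ _ "D js"] pdiff_proj1(2)[of _ _ "D js"], simp_all add: D_def)
    finally show ?case by simp
  qed
  have D: "continuous_map (subtopology (Euclidean_space m) U) euclideanreal (D js)"
    "y \<in> U \<Longrightarrow> ldiff m (D js) y" for js y
    using g unfolding D_def smooth_on_def ldiff_def by auto
  show ?thesis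
    unfolding smooth_on_def
  proof (intro allI impI conjI)
    fix js assume js: "set js \<subseteq> {..<m + k}"
    show "continuous_map (subtopology (Euclidean_space (m + k)) ?W) euclideanreal (iter_pdiff js h)"
      using continuous_map_compose[OF continuous_map_proj1 D(1)]
      by (rule continuous_map_eq) (use iter[OF js] in auto)
    have "ldiff (m + k) (iter_pdiff js h) x" if "x \<in> ?W" for x
    proof -
      have "ldiff (m + k) (iter_pdiff js h) x \<longleftrightarrow> ldiff (m + k) (\<lambda>y. D js (proj1 m y)) x"
        by (rule ldiff_cong[OF W that]) (rule iter[OF js])
      moreover have "proj1 m x \<in> U" using that by (simp add: prod_dom_def)
      then have "ldiff (m + k) (\<lambda>y. D js (proj1 m y)) x" by (intro ldiff_proj1 D(2))
      ultimately show ?thesis by (rule iffD2)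
    qed
    then show "\<forall>x\<in>?W. \<forall>i<m + k. (\<lambda>t. iter_pdiff js h (x(i := t))) differentiable at (x i)"
      by (simp add: ldiff_def)
  qed
qed

lemma smooth_on_proj2:
  assumes U: "lopen m U" and V: "lopen k V" and g: "smooth_on k V g"
    and h: "\<And>x. x \<in> prod_dom m U V \<Longrightarrow> h x = g (proj2 m x)"
  shows "smooth_on (m + k) (prod_dom m U V) h"
proof -
  let ?W = "prod_dom m U V"
  note W = lopen_prod_dom[OF U V]
  \<comment> \<open>Directions of the second factor are numbered from m on and have to be shifted
    back.\<close>
  define D where "D js = (if set js \<subseteq> {m..<m + k} then iter_pdiff (map (\<lambda>i. i - m) js) g else (\<lambda>_.
      0))" for js
  have iter: "iter_pdiff js h x = D js (proj2 m x)" if "set js \<subseteq> {..<m + k}" "x \<in> ?W" for js x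
    using that
  proof (induction js arbitrary: x)
    case Nil
    then show ?case by (simp add: h D_def)
  next
    case (Cons i js)
    have i: "i < m + k" using Cons.prems by simp
    have "pdiff i (iter_pdiff js h) x = pdiff i (\<lambda>x. D js (proj2 m x)) x"
      by (rule pdiff_cong[OF W Cons.prems(2) i]) (rule Cons.IH, use Cons.prems in auto)
    also have "\<dots> = D (i # js) (proj2 m x)"
      using i by (cases rule: add_less_cases)
        (simp_all add: pdiff_proj2(1)[of _ _ "D js"] pdiff_proj2(2)[of _ _ "D js"], simp_all add: D_def)
    finally show ?case by simp
  qed
  have D: "continuous_map (subtopology (Euclidean_space k) V) euclideanreal (D js)"
    "y \<in> V \<Longrightarrow> ldiff k (D js) y" for js y
  proof -
    have "set (map (\<lambda>i. i - m) js) \<subseteq> {..<k}" if "set js \<subseteq> {m..<m + k}"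
      using that by force
    then show "continuous_map (subtopology (Euclidean_space k) V) euclideanreal (D js)"
      "y \<in> V \<Longrightarrow> ldiff k (D js) y"
      using g unfolding D_def smooth_on_def ldiff_def by auto
  qed
  show ?thesis
    unfolding smooth_on_def
  proof (intro allI impI conjI)
    fix js assume js: "set js \<subseteq> {..<m + k}"
    show "continuous_map (subtopology (Euclidean_space (m + k)) ?W) euclideanreal (iter_pdiff js h)"
      using continuous_map_compose[OF continuous_map_proj2 D(1)]
      by (rule continuous_map_eq) (use iter[OF js] in auto)
    have "ldiff (m + k) (iter_pdiff js h) x" if "x \<in> ?W" for x
    proof -
      have "ldiff (m + k) (iter_pdiff js h) x \<longleftrightarrow> ldiff (m + k) (\<lambda>y. D js (proj2 m y)) x"
        by (rule ldiff_cong[OF W that]) (rule iter[OF js])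
      moreover have "proj2 m x \<in> V" using that by (simp add: prod_dom_def)
      then have "ldiff (m + k) (\<lambda>y. D js (proj2 m y)) x" by (intro ldiff_proj2 D(2))
      ultimately show ?thesis by (rule iffD2)
    qed
    then show "\<forall>x\<in>?W. \<forall>i<m + k. (\<lambda>t. iter_pdiff js h (x(i := t))) differentiable at (x i)"
      by (simp add: ldiff_def)
  qed
qed

lemma bcwp_simps [simp]:
  "mtop (bcwp B F \<mu> \<psi>) = prod_topology (mtop B) (mtop F)"
  "mdim (bcwp B F \<mu> \<psi>) = mdim B + mdim F"
  "chart_at (bcwp B F \<mu> \<psi>) (p, q) = prod_chart (mdim B) (chart_at B p) (chart_at F q)"
  by (simp_all add: bcwp_def)

lemma chart_dom_prod_chart [simp]: "chart_dom (prod_chart m c d) = chart_dom c \<times> chart_dom d"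
  by (simp add: prod_chart_def)

lemma atlas_bcwp: "e \<in> atlas (bcwp B F \<mu> \<psi>) \<longleftrightarrow> (\<exists>c\<in>atlas B. \<exists>d\<in>atlas F. e = prod_chart (mdim B) c d)"
  by (auto simp: bcwp_def)

locale product_chart = B: pr_chart B c + F: pr_chart F d
  for B :: "'a pr_manifold" and c and F :: "'b pr_manifold" and d
begin

abbreviation "m \<equiv> mdim B"
abbreviation "k \<equiv> mdim F"
abbreviation "cd \<equiv> prod_chart m c d"
abbreviation "W \<equiv> prod_dom m B.U F.U"

lemma proj_chart_map:
  assumes "p \<in> chart_dom c"
  shows "proj1 m (chart_map cd (p, q)) = chart_map c p" and "proj2 m (chart_map cd (p, q)) =
      chart_map d q"
  using chart_map_zero[OF B.M B.c assms] by (auto simp: prod_chart_def proj1_def proj2_def)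

text \<open>The projections together determine every coordinate, including the zeros from m + k on,
  because \<open>proj2\<close> does not truncate.\<close>

lemma chart_map_eqI:
  assumes "proj1 m x = chart_map c p" "proj2 m x = chart_map d q"
  shows "x = chart_map cd (p, q)"
proof
  fix i
  show "x i = chart_map cd (p, q) i"
    using fun_cong[OF assms(1), of i] fun_cong[OF assms(2), of "i - m"]
    by (auto simp: prod_chart_def proj1_def proj2_def)
qed

lemma image_chart_map:
  assumes "A \<subseteq> chart_dom c"
  shows "chart_map cd ` (A \<times> A') = prod_dom m (chart_map c ` A) (chart_map d ` A')"
proof (intro equalityI subsetI)
  fix x assume "x \<in> chart_map cd ` (A \<times> A')"
  then show "x \<in> prod_dom m (chart_map c ` A) (chart_map d ` A')"
    using assms by (auto simp: prod_dom_def proj_chart_map)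
next
  fix x assume "x \<in> prod_dom m (chart_map c ` A) (chart_map d ` A')"
  then obtain p q where pq: "p \<in> A" "q \<in> A'" "proj1 m x = chart_map c p" "proj2 m x = chart_map d q"
    by (auto simp: prod_dom_def)
  from chart_map_eqI[OF pq(3,4)] pq(1,2) show "x \<in> chart_map cd ` (A \<times> A')" by blast
qed

lemma chart_inv_prod:
  assumes "x \<in> W"
  shows "chart_inv cd x = (chart_inv c (proj1 m x), chart_inv d (proj2 m x))"
proof -
  obtain p q where pq: "p \<in> chart_dom c" "q \<in> chart_dom d" and proj: "proj1 m x = chart_map c p"
      "proj2 m x = chart_map d q"
    using assms by (auto simp: prod_dom_def)
  have x: "x = chart_map cd (p, q)" by (rule chart_map_eqI[OF proj])
  have "inj_on (chart_map cd) (chart_dom cd)"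
  proof (rule inj_onI)
    fix y z assume yz: "y \<in> chart_dom cd" "z \<in> chart_dom cd" "chart_map cd y = chart_map cd z"
    have "chart_map c (fst y) = chart_map c (fst z)" "chart_map d (snd y) = chart_map d (snd z)"
      using proj_chart_map[of "fst y" "snd y"] proj_chart_map[of "fst z" "snd z"] yz by auto
    then have "fst y = fst z" "snd y = snd z"
      using inj_onD[OF inj_on_chart_map[OF B.M B.c]] inj_onD[OF inj_on_chart_map[OF F.M F.c]] yz(1,2)
      by (metis chart_dom_prod_chart mem_Times_iff)+
    then show "y = z" by (rule prod_eqI)
  qed
  then have "chart_inv cd x = (p, q)" unfolding x using pq by (intro inv_into_f_f) auto
  then show ?thesis using pq by (simp add: proj chart_inv_chart_map[OF B.M B.c]
      chart_inv_chart_map[OF F.M F.c])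
qed

lemma smooth_on_fst:
  assumes V: "openin (mtop B) V" and f: "smooth_map_on B V f"
  shows "smooth_on (m + k) (chart_map cd ` ((V \<inter> chart_dom c) \<times> chart_dom d)) ((f \<circ> fst) \<circ> chart_inv
      cd)"
proof -
  have "smooth_on (m + k) (prod_dom m (chart_map c ` (V \<inter> chart_dom c)) F.U) ((f \<circ> fst) \<circ> chart_inv cd)"
  proof (rule smooth_on_proj1)
    show "lopen m (chart_map c ` (V \<inter> chart_dom c))"
      by (intro openin_Euclidean_space_imp_lopen openin_chart_image[OF B.M B.c V])
    show "lopen k F.U" by (rule lopen_chart_image[OF F.M F.c])
    show "smooth_on m (chart_map c ` (V \<inter> chart_dom c)) (f \<circ> chart_inv c)"
      using f B.c by (simp add: smooth_map_on_def)
    show "((f \<circ> fst) \<circ> chart_inv cd) x = (f \<circ> chart_inv c) (proj1 m x)"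
      if "x \<in> prod_dom m (chart_map c ` (V \<inter> chart_dom c)) F.U" for x
      using chart_inv_prod[of x] that by (auto simp: prod_dom_def)
  qed
  then show ?thesis by (simp add: image_chart_map)
qed

lemma smooth_on_snd:
  assumes V: "openin (mtop F) V" and f: "smooth_map_on F V f"
  shows "smooth_on (m + k) (chart_map cd ` (chart_dom c \<times> (V \<inter> chart_dom d))) ((f \<circ> snd) \<circ> chart_inv
      cd)"
proof -
  have "smooth_on (m + k) (prod_dom m B.U (chart_map d ` (V \<inter> chart_dom d))) ((f \<circ> snd) \<circ> chart_inv cd)"
  proof (rule smooth_on_proj2)
    show "lopen k (chart_map d ` (V \<inter> chart_dom d))"
      by (intro openin_Euclidean_space_imp_lopen openin_chart_image[OF F.M F.c V])
    show "lopen m B.U" by (rule lopen_chart_image[OF B.M B.c])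
    show "smooth_on k (chart_map d ` (V \<inter> chart_dom d)) (f \<circ> chart_inv d)"
      using f F.c by (simp add: smooth_map_on_def)
    show "((f \<circ> snd) \<circ> chart_inv cd) x = (f \<circ> chart_inv d) (proj2 m x)"
      if "x \<in> prod_dom m B.U (chart_map d ` (V \<inter> chart_dom d))" for x
      using chart_inv_prod[of x] that by (auto simp: prod_dom_def)
  qed
  then show ?thesis by (simp add: image_chart_map)
qed

end

text \<open>Guarantees that a coordinate vector of the product, applied to f composed with the
  projection, is a genuine derivative whenever \<open>pushforward\<close> evaluates it.\<close>

lemma smooth_near_fst:
  assumes B: "pseudo_riemannian B" and F: "pseudo_riemannian F"
    and f: "smooth_near B p f" and q: "q \<in> points F"
  shows "smooth_near (bcwp B F \<mu> \<psi>) (p, q) (f \<circ> fst)"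
proof -
  obtain V where V: "openin (mtop B) V" "p \<in> V" "smooth_map_on B V f"
    using f by (auto simp: smooth_near_def)
  have "smooth_map_on (bcwp B F \<mu> \<psi>) (V \<times> points F) (f \<circ> fst)"
    unfolding smooth_map_on_def
  proof
    fix e assume "e \<in> atlas (bcwp B F \<mu> \<psi>)"
    then obtain c d where cd: "c \<in> atlas B" "d \<in> atlas F" and e: "e = prod_chart (mdim B) c d"
      unfolding atlas_bcwp by blast
    interpret product_chart B c F d by unfold_locales (use B F cd in auto)
    have "(V \<times> points F) \<inter> chart_dom cd = (V \<inter> chart_dom c) \<times> chart_dom d"
      using F.dom_points by auto
    then show "smooth_on (mdim (bcwp B F \<mu> \<psi>)) (chart_map e ` ((V \<times> points F) \<inter> chart_dom e)) ((f \<circ>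
        fst) \<circ> chart_inv e)"
      using smooth_on_fst[OF V(1,3)] by (simp only: e bcwp_simps)
  qed
  moreover have "openin (mtop (bcwp B F \<mu> \<psi>)) (V \<times> points F)"
    using V(1) by (simp add: openin_prod_Times_iff)
  ultimately show ?thesis unfolding smooth_near_def using V(2) q by blast
qed

lemma smooth_near_snd:
  assumes B: "pseudo_riemannian B" and F: "pseudo_riemannian F"
    and f: "smooth_near F q f" and p: "p \<in> points B"
  shows "smooth_near (bcwp B F \<mu> \<psi>) (p, q) (f \<circ> snd)"
proof -
  obtain V where V: "openin (mtop F) V" "q \<in> V" "smooth_map_on F V f"
    using f by (auto simp: smooth_near_def)
  have "smooth_map_on (bcwp B F \<mu> \<psi>) (points B \<times> V) (f \<circ> snd)"
    unfolding smooth_map_on_def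
  proof
    fix e assume "e \<in> atlas (bcwp B F \<mu> \<psi>)"
    then obtain c d where cd: "c \<in> atlas B" "d \<in> atlas F" and e: "e = prod_chart (mdim B) c d"
      unfolding atlas_bcwp by blast
    interpret product_chart B c F d by unfold_locales (use B F cd in auto)
    have "(points B \<times> V) \<inter> chart_dom cd = chart_dom c \<times> (V \<inter> chart_dom d)"
      using B.dom_points by auto
    then show "smooth_on (mdim (bcwp B F \<mu> \<psi>)) (chart_map e ` ((points B \<times> V) \<inter> chart_dom e)) ((f \<circ>
        snd) \<circ> chart_inv e)"
      using smooth_on_snd[OF V(1,3)] by (simp only: e bcwp_simps)
  qed
  moreover have "openin (mtop (bcwp B F \<mu> \<psi>)) (points B \<times> V)"
    using V(1) by (simp add: openin_prod_Times_iff)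
  ultimately show ?thesis unfolding smooth_near_def using V(2) p by blast
qed

section \<open>Components of the warped metric in a product chart\<close>

context product_chart
begin

lemma lopen_W: "lopen (m + k) W"
  by (rule lopen_prod_dom[OF lopen_chart_image[OF B.M B.c] lopen_chart_image[OF F.M F.c]])

context
  fixes p :: 'a and q :: 'b and \<mu> :: real and \<psi> :: "'a \<Rightarrow> real"
  assumes p: "p \<in> chart_dom c" and q: "q \<in> chart_dom d"
begin

lemma chart_map_in_W: "chart_map cd (p, q) \<in> W"
  using p q by (simp add: prod_dom_def proj_chart_map[OF p])

lemma pushforward_fst:
  assumes i: "i < m + k"
  shows "pushforward B fst p (coord_vec (bcwp B F \<mu> \<psi>) cd (p, q) i) =
    (if i < m then coord_vec B c p i else (\<lambda>f. 0))"
proof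
  fix f
  have "pdiff i ((f \<circ> fst) \<circ> chart_inv cd) (chart_map cd (p, q)) =
      pdiff i (\<lambda>x. (f \<circ> chart_inv c) (proj1 m x)) (chart_map cd (p, q))"
    by (rule pdiff_cong[OF lopen_W chart_map_in_W i]) (simp add: chart_inv_prod del:
        chart_dom_prod_chart)
  also have "\<dots> = (if i < m then pdiff i (f \<circ> chart_inv c) (chart_map c p) else 0)"
    using i by (cases rule: add_less_cases)
      (simp_all add: pdiff_proj1(1)[of _ _ "f \<circ> chart_inv c"] pdiff_proj1(2)[of _ _ "f \<circ> chart_inv c"]
        proj_chart_map[OF p] del: o_apply)
  finally show "pushforward B fst p (coord_vec (bcwp B F \<mu> \<psi>) cd (p, q) i) f =
      (if i < m then coord_vec B c p i else (\<lambda>f. 0)) f"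
    using smooth_near_fst[OF B.pr F.pr _ F.dom_points[OF q], of p f \<mu> \<psi>]
    by (simp add: pushforward_def coord_vec_def)
qed

lemma pushforward_snd:
  assumes i: "i < m + k"
  shows "pushforward F snd q (coord_vec (bcwp B F \<mu> \<psi>) cd (p, q) i) =
    (if i < m then (\<lambda>f. 0) else coord_vec F d q (i - m))"
proof
  fix f
  have "pdiff i ((f \<circ> snd) \<circ> chart_inv cd) (chart_map cd (p, q)) =
      pdiff i (\<lambda>x. (f \<circ> chart_inv d) (proj2 m x)) (chart_map cd (p, q))"
    by (rule pdiff_cong[OF lopen_W chart_map_in_W i]) (simp add: chart_inv_prod del:
        chart_dom_prod_chart)
  also have "\<dots> = (if i < m then 0 else pdiff (i - m) (f \<circ> chart_inv d) (chart_map d q))"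
    using i by (cases rule: add_less_cases)
      (simp_all add: pdiff_proj2(1)[of _ _ "f \<circ> chart_inv d"] pdiff_proj2(2)[of _ _ "f \<circ> chart_inv d"]
        proj_chart_map[OF p] del: o_apply)
  finally show "pushforward F snd q (coord_vec (bcwp B F \<mu> \<psi>) cd (p, q) i) f =
      (if i < m then (\<lambda>f. 0) else coord_vec F d q (i - m)) f"
    using smooth_near_snd[OF B.pr F.pr _ B.dom_points[OF p], of q f \<mu> \<psi>]
    by (simp add: pushforward_def coord_vec_def)
qed

text \<open>Mixed components vanish because every coordinate vector is pushed forward to 0 in one of
  the two factors.\<close>

lemma metric_comp_bcwp_at:
  assumes i: "i < m + k" and j: "j < m + k"
  shows "metric_comp (bcwp B F \<mu> \<psi>) cd (chart_map cd (p, q)) i j =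
    (if i < m then if j < m then \<psi> p powr (2 * \<mu>) * B.G (chart_map c p) i j else 0
     else if j < m then 0 else (\<psi> p)\<^sup>2 * F.G (chart_map d q) (i - m) (j - m))"
proof -
  have inv: "chart_inv cd (chart_map cd (p, q)) = (p, q)"
    unfolding chart_inv_prod[OF chart_map_in_W] proj_chart_map[OF p]
    by (simp add: chart_inv_chart_map[OF B.M B.c p] chart_inv_chart_map[OF F.M F.c q])
  have "metric_comp (bcwp B F \<mu> \<psi>) cd (chart_map cd (p, q)) i j =
     \<psi> p powr (2 * \<mu>) * metric B p (if i < m then coord_vec B c p i else (\<lambda>f. 0)) (if j < m then
         coord_vec B c p j else (\<lambda>f. 0))
     + (\<psi> p)\<^sup>2 * metric F q (if i < m then (\<lambda>f. 0) else coord_vec F d q (i - m)) (if j < m then (\<lambda>f.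
         0) else coord_vec F d q (j - m))"
    unfolding metric_comp_def Let_def inv pushforward_fst[OF i, symmetric] pushforward_fst[OF j,
        symmetric]
      pushforward_snd[OF i, symmetric] pushforward_snd[OF j, symmetric]
    by (simp add: bcwp_def)
  moreover have "metric B p (\<lambda>f. 0) (\<lambda>f. 0) = 0" "metric F q (\<lambda>f. 0) (\<lambda>f. 0) = 0"
    using B.metric_zero[OF p, of "\<lambda>f. 0"] F.metric_zero[OF q, of "\<lambda>f. 0"]
      B.comb_tangent[OF p, of "\<lambda>_. 0"] F.comb_tangent[OF q, of "\<lambda>_. 0"] by (simp_all add: B.comb_def
          F.comb_def)
  ultimately show ?thesis
    using i j B.metric_zero[OF p B.coord_vec_tangent[OF p]] F.metric_zero[OF q
        F.coord_vec_tangent[OF q]]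
    by (auto simp: B.metric_comp_chart_map[OF p] F.metric_comp_chart_map[OF q])
qed

end

lemma metric_comp_bcwp:
  assumes "x \<in> W" "i < m + k" "j < m + k"
  shows "metric_comp (bcwp B F \<mu> \<psi>) cd x i j =
    (if i < m then if j < m then \<psi> (chart_inv c (proj1 m x)) powr (2 * \<mu>) * B.G (proj1 m x) i j else 0
     else if j < m then 0 else (\<psi> (chart_inv c (proj1 m x)))\<^sup>2 * F.G (proj2 m x) (i - m) (j - m))"
proof -
  obtain p q where pq: "p \<in> chart_dom c" "q \<in> chart_dom d" and proj: "proj1 m x = chart_map c p"
      "proj2 m x = chart_map d q"
    using assms(1) by (auto simp: prod_dom_def)
  have x: "x = chart_map cd (p, q)" by (rule chart_map_eqI[OF proj])
  show ?thesis
    unfolding proj using metric_comp_bcwp_at[OF pq assms(2,3)]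
    by (simp add: x chart_inv_chart_map[OF B.M B.c pq(1)])
qed

end

section \<open>Scalar curvature of the base conformal warped product\<close>


lemma lap_cong:
  assumes U: "lopen n U" and x: "x \<in> U" and eq: "\<And>y. y \<in> U \<Longrightarrow> f y = h y"
  shows "lap n G f x = lap n G h x"
  unfolding lap_def
proof (intro sum.cong refl)
  fix i j assume ij: "i \<in> {..<n}" "j \<in> {..<n}"
  have "pdiff i (pdiff j f) x = pdiff i (pdiff j h) x"
    by (rule pdiff_cong[OF U x], use ij in simp) (rule pdiff_cong[OF U _ _ eq], use ij in auto)
  moreover have "(\<Sum>l<n. christoffel n G l i j x * pdiff l f x) = (\<Sum>l<n. christoffel n G l i j x *
      pdiff l h x)"
    by (intro sum.cong refl) (use pdiff_cong[OF U x _ eq] in auto)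
  ultimately show "inverse_matrix n (G x) i j * (pdiff i (pdiff j f) x - (\<Sum>l<n. christoffel n G l i
      j x * pdiff l f x))
      = inverse_matrix n (G x) i j * (pdiff i (pdiff j h) x - (\<Sum>l<n. christoffel n G l i j x * pdiff
          l h x))"
    by simp
qed

lemma grad_prod_cong:
  assumes U: "lopen n U" and x: "x \<in> U" and "\<And>y. y \<in> U \<Longrightarrow> f y = f' y" "\<And>y. y \<in> U \<Longrightarrow> h y = h' y"
  shows "grad_prod n G f h x = grad_prod n G f' h' x"
  unfolding grad_prod_def
  by (intro sum.cong refl) (use pdiff_cong[OF U x _ assms(3)] pdiff_cong[OF U x _ assms(4)] in auto)

lemma
  assumes U: "lopen n U" and x: "x \<in> U" and f: "C2_lines n U f"
    and h: "\<And>x. x \<in> U \<Longrightarrow> (h has_field_derivative h' (f x)) (at (f x))"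
  shows grad_prod_compose: "grad_prod n G (\<lambda>y. h (f y)) (\<lambda>y. h (f y)) x = (h' (f x))\<^sup>2 * grad_prod n
      G f f x"
    and grad_prod_compose_left: "grad_prod n G (\<lambda>y. h (f y)) f x = h' (f x) * grad_prod n G f f x"
    and lap_compose: "(\<And>x. x \<in> U \<Longrightarrow> (h' has_field_derivative h'' (f x)) (at (f x))) \<Longrightarrow>
      lap n G (\<lambda>y. h (f y)) x = h' (f x) * lap n G f x + h'' (f x) * grad_prod n G f f x"
proof -
  have d: "pdiff i (\<lambda>y. h (f y)) y = h' (f y) * pdiff i f y" if "y \<in> U" "i < n" for y i
    by (rule has_pdiff_imp_pdiff, rule has_pdiff_compose[of h "h' (f y)" f, OF h])
      (use f that in \<open>auto simp: C2_lines_def intro: ldiffD\<close>)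
  show "grad_prod n G (\<lambda>y. h (f y)) (\<lambda>y. h (f y)) x = (h' (f x))\<^sup>2 * grad_prod n G f f x"
    "grad_prod n G (\<lambda>y. h (f y)) f x = h' (f x) * grad_prod n G f f x"
    by (simp_all add: grad_prod_def d[OF x] sum_distrib_left power2_eq_square mult_ac)
  assume h': "\<And>x. x \<in> U \<Longrightarrow> (h' has_field_derivative h'' (f x)) (at (f x))"
  have dd: "pdiff i (pdiff j (\<lambda>y. h (f y))) x = h'' (f x) * (pdiff i f x * pdiff j f x) + h' (f x) *
      pdiff i (pdiff j f) x"
    if "i < n" "j < n" for i j
  proof -
    have "pdiff i (pdiff j (\<lambda>y. h (f y))) x = pdiff i (\<lambda>y. h' (f y) * pdiff j f y) x"
      by (rule pdiff_cong[OF U x that(1)]) (rule d[OF _ that(2)])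
    also have "\<dots> = (h'' (f x) * pdiff i f x) * pdiff j f x + h' (f x) * pdiff i (pdiff j f) x"
      by (rule has_pdiff_imp_pdiff, rule has_pdiff_mult, rule has_pdiff_compose[of h' "h'' (f x)" f,
          OF h'[OF x]])
        (use f x that in \<open>auto simp: C2_lines_def intro: ldiffD\<close>)
    finally show ?thesis by simp
  qed
  have "lap n G (\<lambda>y. h (f y)) x = (\<Sum>i<n. \<Sum>j<n. h' (f x) * (inverse_matrix n (G x) i j *
      (pdiff i (pdiff j f) x - (\<Sum>l<n. christoffel n G l i j x * pdiff l f x)))
      + h'' (f x) * (inverse_matrix n (G x) i j * (pdiff i f x * pdiff j f x)))"
    unfolding lap_def
  proof (intro sum.cong refl)
    fix i j assume ij: "i \<in> {..<n}" "j \<in> {..<n}"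
    have "(\<Sum>l<n. christoffel n G l i j x * pdiff l (\<lambda>y. h (f y)) x) = h' (f x) * (\<Sum>l<n. christoffel
        n G l i j x * pdiff l f x)"
      by (simp add: d[OF x] sum_distrib_left mult_ac)
    then show "inverse_matrix n (G x) i j * (pdiff i (pdiff j (\<lambda>y. h (f y))) x
        - (\<Sum>l<n. christoffel n G l i j x * pdiff l (\<lambda>y. h (f y)) x)) =
      h' (f x) * (inverse_matrix n (G x) i j * (pdiff i (pdiff j f) x - (\<Sum>l<n. christoffel n G l i j
          x * pdiff l f x)))
      + h'' (f x) * (inverse_matrix n (G x) i j * (pdiff i f x * pdiff j f x))"
      using dd ij by (simp add: algebra_simps)
  qed
  then show "lap n G (\<lambda>y. h (f y)) x = h' (f x) * lap n G f x + h'' (f x) * grad_prod n G f f x"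
    by (simp add: lap_def grad_prod_def sum.distrib sum_distrib_left)
qed

context pr_chart
begin

lemma
  assumes \<psi>: "smooth_map_on M (points M) \<psi>" "\<forall>p \<in> points M. \<psi> p > 0"
  defines "\<phi> \<equiv> \<lambda>x. ln (\<psi> (chart_inv c x))"
  shows C2_lines_ln: "C2_lines n U \<phi>"
    and grad_norm_sq_ln: "p \<in> chart_dom c \<Longrightarrow>
      grad_norm_sq M \<psi> p = (\<psi> p)\<^sup>2 * grad_prod n G \<phi> \<phi> (chart_map c p)"
proof -
  have pos: "\<psi> (chart_inv c x) > 0" if "x \<in> U" for x
    using that \<psi>(2) dom_points chart_inv_chart_map[OF M c] by auto
  show \<phi>: "C2_lines n U \<phi>"
    unfolding \<phi>_def
  proof (rule C2_lines_compose[where h = ln and h' = "\<lambda>s. inverse s" and h'' = "\<lambda>s. - inverse (s\<^sup>2)"])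
    show "lopen n U" by (rule lopen_chart_image[OF M c])
    show "C2_lines n U (\<lambda>x. \<psi> (chart_inv c x))"
      using C2_lines_chart[OF \<psi>(1)] by (simp add: o_def)
    show "(ln has_field_derivative inverse (\<psi> (chart_inv c x))) (at (\<psi> (chart_inv c x)))" if "x \<in> U"
        for x
      using pos[OF that] by (rule DERIV_ln)
    show "(inverse has_field_derivative - inverse ((\<psi> (chart_inv c x))\<^sup>2)) (at (\<psi> (chart_inv c x)))"
      if "x \<in> U" for x
      using DERIV_inverse[of "\<psi> (chart_inv c x)" UNIV] pos[OF that] by (simp add: power2_eq_square)
  qed
  assume p: "p \<in> chart_dom c"
  then have x: "chart_map c p \<in> U" by simp
  have "grad_norm_sq M \<psi> p = grad_prod n G (\<lambda>x. exp (\<phi> x)) (\<lambda>x. exp (\<phi> x)) (chart_map c p)"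
    unfolding grad_norm_sq_eq[OF p \<psi>(1)]
    by (rule grad_prod_cong[OF lopen_chart_image[OF M c] x]) (simp_all add: pos \<phi>_def)
  also have "\<dots> = (exp (\<phi> (chart_map c p)))\<^sup>2 * grad_prod n G \<phi> \<phi> (chart_map c p)"
    by (rule grad_prod_compose[OF lopen_chart_image[OF M c] x \<phi>]) (rule DERIV_exp)
  also have "exp (\<phi> (chart_map c p)) = \<psi> p"
    using pos[OF x] chart_inv_chart_map[OF M c p] by (simp add: \<phi>_def)
  finally show "grad_norm_sq M \<psi> p = (\<psi> p)\<^sup>2 * grad_prod n G \<phi> \<phi> (chart_map c p)" .
qed

end

context product_chart
begin

lemma scal_bcwp:
  fixes \<mu> :: real and \<psi> :: "'a \<Rightarrow> real"
  assumes \<psi>: "smooth_map_on B (points B) \<psi>" "\<forall>p \<in> points B. \<psi> p > 0"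
    and p: "p \<in> chart_dom c" and q: "q \<in> chart_dom d"
  defines "\<phi> \<equiv> \<lambda>x. ln (\<psi> (chart_inv c x))"
    and "A \<equiv> real k + (real m - 1) * \<mu>"
  shows "\<psi> p powr (2 * \<mu>) * scal (m + k) (metric_comp (bcwp B F \<mu> \<psi>) cd) (chart_map cd (p, q)) =
    scal m B.G (chart_map c p) + \<psi> p powr (2 * (\<mu> - 1)) * scal k F.G (chart_map d q)
    - 2 * A * lap m B.G \<phi> (chart_map c p)
    - ((A + (1 - \<mu>)) * real k + (real m - 2) * \<mu> * A) * grad_prod m B.G \<phi> \<phi> (chart_map c p)"
    and "local_metric (m + k) W (metric_comp (bcwp B F \<mu> \<psi>) cd)"
proof -
  define x where "x = chart_map c p"
  define y where "y = chart_map d q"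
  define z where "z = chart_map cd (p, q)"
  have xU: "x \<in> B.U" and zW: "z \<in> W" and proj: "proj1 m z = x" "proj2 m z = y"
    using p chart_map_in_W[OF p q] proj_chart_map[OF p] by (auto simp: x_def y_def z_def)
  have pos: "\<psi> (chart_inv c x) > 0" if "x \<in> B.U" for x
    using that \<psi>(2) B.dom_points chart_inv_chart_map[OF B.M B.c] by auto
  have \<phi>: "C2_lines m B.U \<phi>" unfolding \<phi>_def by (rule B.C2_lines_ln[OF \<psi>])
  interpret LB: local_metric m B.U B.G by (rule B.local_metric_chart)
  interpret LF: local_metric k F.U F.G by (rule F.local_metric_chart)
  \<comment> \<open>The base metric divided by the factor \<psi>^2 that base and fibre share; the
    second conformal change, by exp (2 \<phi>), restores it on both blocks.\<close>
  define G1 where "G1 x i j = exp (2 * ((\<mu> - 1) * \<phi> x)) * B.G x i j" for x i j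
  have C2: "C2_lines m B.U (\<lambda>x. (\<mu> - 1) * \<phi> x)"
    by (rule C2_lines_mult[OF LB.U _ \<phi>]) (simp add: C2_lines_def ldiff_const)
  interpret conf1: conformal_change m B.U B.G "\<lambda>x. (\<mu> - 1) * \<phi> x" G1
    by unfold_locales (use C2 in \<open>auto simp: G1_def\<close>)
  interpret L1: local_metric m B.U G1 by (rule conf1.local_metric_G')
  interpret prod: product_metric m B.U G1 k F.U F.G ..
  interpret LP: local_metric "m + k" W "prod_metric m G1 F.G" by (rule prod.local_metric_prod)
  interpret conf2: conformal_change "m + k" W "prod_metric m G1 F.G" "\<lambda>x. \<phi> (proj1 m x)"
    "metric_comp (bcwp B F \<mu> \<psi>) cd"
  proof unfold_locales
    show "C2_lines (m + k) W (\<lambda>x. \<phi> (proj1 m x))" by (rule C2_lines_proj1[OF \<phi>])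
    fix x i j assume x: "x \<in> W" and ij: "i < m + k" "j < m + k"
    have "\<psi> (chart_inv c (proj1 m x)) > 0" using x pos by (simp add: prod_dom_def)
    then have "\<psi> (chart_inv c (proj1 m x)) powr (2 * \<mu>) =
        exp (2 * \<phi> (proj1 m x)) * exp (2 * ((\<mu> - 1) * \<phi> (proj1 m x)))"
      and "(\<psi> (chart_inv c (proj1 m x)))\<^sup>2 = exp (2 * \<phi> (proj1 m x))"
      by (simp add: \<phi>_def powr_def algebra_simps flip: exp_add) (simp add: \<phi>_def exp_double \<open>0 < _\<close>)
    then show "metric_comp (bcwp B F \<mu> \<psi>) cd x i j = exp (2 * \<phi> (proj1 m x)) * prod_metric m G1 F.G
        x i j"
      unfolding metric_comp_bcwp[OF x ij] by (simp add: prod_metric_def G1_def)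
  qed
  define N where "N = grad_prod m B.G \<phi> \<phi> x"
  define L where "L = lap m B.G \<phi> x"
  \<comment> \<open>The factor that the first conformal change puts on every base quantity.\<close>
  define E where "E = exp (- 2 * ((\<mu> - 1) * \<phi> x))"
  have d: "((\<lambda>s. (\<mu> - 1) * s) has_field_derivative (\<mu> - 1)) (at t)" for t :: real
    by (auto intro!: derivative_eq_intros)
  have lin: "lap m B.G (\<lambda>y. (\<mu> - 1) * \<phi> y) x = (\<mu> - 1) * L"
    "grad_prod m B.G (\<lambda>y. (\<mu> - 1) * \<phi> y) (\<lambda>y. (\<mu> - 1) * \<phi> y) x = (\<mu> - 1)\<^sup>2 * N"
    "grad_prod m B.G (\<lambda>y. (\<mu> - 1) * \<phi> y) \<phi> x = (\<mu> - 1) * N"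
    unfolding L_def N_def
    using lap_compose[where h' = "\<lambda>_. \<mu> - 1" and h'' = "\<lambda>_. 0", OF LB.U xU \<phi> d DERIV_const]
      grad_prod_compose[where h' = "\<lambda>_. \<mu> - 1", OF LB.U xU \<phi> d]
      grad_prod_compose_left[where h' = "\<lambda>_. \<mu> - 1", OF LB.U xU \<phi> d]
    by simp_all
  have "scal m G1 x = E * (scal m B.G x - 2 * (real m - 1) * (\<mu> - 1) * L
      - (real m - 2) * (real m - 1) * (\<mu> - 1)\<^sup>2 * N)"
    using conf1.scal_conformal[OF xU] unfolding lin E_def by (simp add: mult.assoc)
  moreover have "lap m G1 \<phi> x = E * (L + (real m - 2) * (\<mu> - 1) * N)"
    using conf1.lap_conformal[OF xU, of \<phi>] unfolding lin E_def L_def[symmetric] by (simp add: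
        mult.assoc)
  moreover have "grad_prod m G1 \<phi> \<phi> x = E * N"
    using conf1.grad_prod_conformal[OF xU, of \<phi> \<phi>] by (simp add: E_def N_def)
  ultimately have S: "scal (m + k) (metric_comp (bcwp B F \<mu> \<psi>) cd) z = exp (- 2 * \<phi> x) *
     (E * (scal m B.G x - 2 * (real m - 1) * (\<mu> - 1) * L
      - (real m - 2) * (real m - 1) * (\<mu> - 1)\<^sup>2 * N) + scal k F.G y
      - 2 * (real m + real k - 1) * (E * (L + (real m - 2) * (\<mu> - 1) * N))
      - (real m + real k - 2) * (real m + real k - 1) * (E * N))"
    using conf2.scal_conformal[OF zW]
    unfolding prod.scal_prod[OF zW] prod.lap_prod[OF zW] prod.grad_prod_prod[OF zW] proj by simp
  have "\<psi> p > 0" using \<psi>(2) B.dom_points[OF p] by blast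
  then have \<psi>p: "\<psi> p powr a = exp (a * \<phi> x)" for a
    by (simp add: powr_def \<phi>_def x_def chart_inv_chart_map[OF B.M B.c p])
  \<comment> \<open>Multiplication by \<psi>^(2 \<mu>) frees all base terms from powers of \<psi>;
    by the next fact the fibre curvature keeps \<psi>^(2 (\<mu> - 1)), as it did not pass through
    the first change.\<close>
  have 1: "\<psi> p powr (2 * \<mu>) * exp (- 2 * \<phi> x) * E = 1"
    unfolding \<psi>p E_def by (simp add: algebra_simps flip: exp_add)
  have 2: "\<psi> p powr (2 * \<mu>) * exp (- 2 * \<phi> x) = \<psi> p powr (2 * (\<mu> - 1))"
    unfolding \<psi>p by (simp add: algebra_simps flip: exp_add)
  have rearrange: "P * (e * (E * (s - a - b) + t - c1 * (E * l) - c2 * (E * n))) =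
      (P * e * E) * (s - a - b - c1 * l - c2 * n) + (P * e) * t" for P e s a b t c1 c2 l n :: real
    by (simp only: algebra_simps)
  have "\<psi> p powr (2 * \<mu>) * scal (m + k) (metric_comp (bcwp B F \<mu> \<psi>) cd) z =
     (scal m B.G x - 2 * (real m - 1) * (\<mu> - 1) * L - (real m - 2) * (real m - 1) * (\<mu> - 1)\<^sup>2 * N
      - 2 * (real m + real k - 1) * (L + (real m - 2) * (\<mu> - 1) * N)
      - (real m + real k - 2) * (real m + real k - 1) * N) + \<psi> p powr (2 * (\<mu> - 1)) * scal k F.G y"
    unfolding S rearrange unfolding 1 unfolding 2 by simp
  \<comment> \<open>In the coefficient of L, (m - 1) (\<mu> - 1) and m + k - 1 add up to A. The
    coefficient of N collects the gradient terms of both changes and the one from the Laplacian of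
    \<phi> in the rescaled base metric.\<close>
  also have "\<dots> = scal m B.G x + \<psi> p powr (2 * (\<mu> - 1)) * scal k F.G y - 2 * A * L
      - ((A + (1 - \<mu>)) * real k + (real m - 2) * \<mu> * A) * N"
    by (simp add: A_def power2_eq_square algebra_simps)
  finally show "\<psi> p powr (2 * \<mu>) * scal (m + k) (metric_comp (bcwp B F \<mu> \<psi>) cd) (chart_map cd (p, q)) =
    scal m B.G (chart_map c p) + \<psi> p powr (2 * (\<mu> - 1)) * scal k F.G (chart_map d q)
    - 2 * A * lap m B.G \<phi> (chart_map c p)
    - ((A + (1 - \<mu>)) * real k + (real m - 2) * \<mu> * A) * grad_prod m B.G \<phi> \<phi> (chart_map c p)"
    by (simp add: x_def y_def z_def L_def N_def)
  show "local_metric (m + k) W (metric_comp (bcwp B F \<mu> \<psi>) cd)" by (rule conf2.local_metric_G')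
qed

end

text \<open>The chart chosen at (p, q) is by definition the product of the charts chosen at p and q,
  so the formula in product charts applies directly; the gradient of ln \<psi> is that of \<psi>
  divided by \<psi>.\<close>

lemma scalar_curvature_bcwp:
  fixes B :: "'a pr_manifold" and F :: "'b pr_manifold" and \<mu> :: real
  assumes B: "pseudo_riemannian B" and F: "pseudo_riemannian F"
    and \<psi>: "smooth_map_on B (points B) \<psi>" "\<forall>p \<in> points B. \<psi> p > 0"
    and p: "p \<in> points B" and q: "q \<in> points F"
  defines "A \<equiv> real (mdim F) + (real (mdim B) - 1) * \<mu>"
  shows "\<psi> p powr (2 * \<mu>) * scalar_curvature (bcwp B F \<mu> \<psi>) (p, q) =
    scalar_curvature B p + \<psi> p powr (2 * (\<mu> - 1)) * scalar_curvature F q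
    - 2 * A * laplacian B (\<lambda>p. ln (\<psi> p)) p
    - ((A + (1 - \<mu>)) * real (mdim F) + (real (mdim B) - 2) * \<mu> * A) * (grad_norm_sq B \<psi> p / (\<psi> p)\<^sup>2)"
proof -
  interpret product_chart B "chart_at B p" F "chart_at F q"
    by unfold_locales (use B F pseudo_riemannian_chart_at p q in auto)
  have pq: "p \<in> chart_dom (chart_at B p)" "q \<in> chart_dom (chart_at F q)"
    by (rule pseudo_riemannian_chart_at[OF B p], rule pseudo_riemannian_chart_at[OF F q])
  interpret LP: local_metric "m + k" W "metric_comp (bcwp B F \<mu> \<psi>) cd"
    by (rule scal_bcwp(2)[OF \<psi> pq])
  have "scalar_curvature (bcwp B F \<mu> \<psi>) (p, q) = scal (m + k) (metric_comp (bcwp B F \<mu> \<psi>) cd)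
      (chart_map cd (p, q))"
    unfolding scalar_curvature_def Let_def bcwp_simps
    by (rule LP.metric_trace_ricci) (rule chart_map_in_W[OF pq])
  moreover have "\<psi> p \<noteq> 0" using \<psi>(2) p by force
  ultimately show ?thesis
    using scal_bcwp(1)[OF \<psi> pq, of \<mu>] B.grad_norm_sq_ln[OF \<psi> pq(1)]
    by (simp add: scalar_curvature_eq[OF B p] scalar_curvature_eq[OF F q] A_def o_def)
qed

text \<open>Since u = exp (ln \<psi> / \<alpha>) on the manifold, u takes its derivatives from
  \<psi>, and the chain rule is applied to s |-> exp (s / \<alpha>).\<close>

lemma laplacian_powr:
  assumes pr: "pseudo_riemannian M"
    and \<psi>: "smooth_map_on M (points M) \<psi>" "\<forall>p \<in> points M. \<psi> p > 0"
    and u: "\<forall>p \<in> points M. u p > 0 \<and> \<psi> p = u p powr \<alpha>" and \<alpha>: "\<alpha> \<noteq> 0"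
    and p: "p \<in> points M"
  shows "laplacian M u p =
    u p * (laplacian M (\<lambda>p. ln (\<psi> p)) p / \<alpha> + grad_norm_sq M \<psi> p / (\<psi> p)\<^sup>2 / \<alpha>\<^sup>2)"
proof -
  interpret pr_chart M "chart_at M p"
    by unfold_locales (use pr pseudo_riemannian_chart_at p in auto)
  have pd: "p \<in> chart_dom (chart_at M p)"
    by (rule pseudo_riemannian_chart_at[OF pr p])
  interpret local_metric n U G by (rule local_metric_chart)
  let ?\<phi> = "\<lambda>x. ln (\<psi> (chart_inv (chart_at M p) x))"
  let ?x = "chart_map (chart_at M p) p"
  have x: "?x \<in> U" using pd by simp
  have inv: "chart_inv (chart_at M p) ?x = p" by (rule chart_inv_chart_map[OF M c pd])
  have exp: "exp (ln (\<psi> r) / \<alpha>) = u r" if "r \<in> points M" for r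
    using u that \<alpha> by (simp add: ln_powr)
  have "laplacian M u p = lap n G (\<lambda>y. exp (?\<phi> y / \<alpha>)) ?x"
    unfolding scalar_curvature_eq(2)[OF pr p]
  proof (rule lap_cong[OF U x])
    fix y assume "y \<in> U"
    then have "chart_inv (chart_at M p) y \<in> points M" by (auto intro: dom_points inv_into_into)
    then show "(u \<circ> chart_inv (chart_at M p)) y = exp (?\<phi> y / \<alpha>)" by (simp add: exp)
  qed
  also have "\<dots> = (exp (?\<phi> ?x / \<alpha>) / \<alpha>) * lap n G ?\<phi> ?x + (exp (?\<phi> ?x / \<alpha>) / \<alpha>\<^sup>2) * grad_prod n G ?\<phi>
      ?\<phi> ?x"
    by (rule lap_compose[where h' = "\<lambda>s. exp (s / \<alpha>) / \<alpha>" and h'' = "\<lambda>s. exp (s / \<alpha>) / \<alpha>\<^sup>2",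
          OF U x C2_lines_ln[OF \<psi>]])
      (auto intro!: derivative_eq_intros simp: power2_eq_square \<alpha>)
  also have "exp (?\<phi> ?x / \<alpha>) = u p" unfolding inv by (rule exp[OF p])
  also have "grad_prod n G ?\<phi> ?\<phi> ?x = grad_norm_sq M \<psi> p / (\<psi> p)\<^sup>2"
    using grad_norm_sq_ln[OF \<psi> pd] \<psi>(2) p by force
  also have "lap n G ?\<phi> ?x = laplacian M (\<lambda>p. ln (\<psi> p)) p"
    unfolding scalar_curvature_eq(2)[OF pr p] by (simp add: o_def)
  finally show ?thesis by (simp add: distrib_left)
qed

text \<open>With \<open>A = k + (m - 1) \<mu>\<close> the terms linear in \<open>A\<close> cancel in the denominator of \<open>\<alpha>\<close>.\<close>

lemma denominator_eq:
  fixes m k :: nat and \<mu> :: real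
  assumes "m \<ge> 2"
  defines "A \<equiv> real k + (real m - 1) * \<mu>"
  shows "(A + (1 - \<mu>)) * real k + (real m - 2) * \<mu> * A =
    ((real m - 2) * A\<^sup>2 + real k * (real k + real m - 1)) / (real m - 1)"
proof -
  have m: "real m - 1 \<noteq> 0" using assms(1) by simp
  have "((A + (1 - \<mu>)) * real k + (real m - 2) * \<mu> * A) * (real m - 1) =
      (real m - 2) * A\<^sup>2 + real k * (real k + real m - 1)"
    by (simp add: A_def power2_eq_square algebra_simps)
  then show ?thesis using m by (simp add: field_simps)
qed

theorem theorem1p1:
  fixes B :: "'a pr_manifold" and F :: "'b pr_manifold"
    and m k :: nat and \<mu> :: real and \<psi> :: "'a \<Rightarrow> real"
    and S_B :: "'a \<Rightarrow> real" and S_F :: "'b \<Rightarrow> real" and S :: "'a \<times> 'b \<Rightarrow> real"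
  assumes "pseudo_riemannian B" and "pseudo_riemannian F"
    and "mdim B = m" and "m \<ge> 2" and "mdim F = k"
    and "smooth_map_on B (points B) \<psi>" and "\<forall>p \<in> points B. \<psi> p > 0"
    and "S_B = scalar_curvature B" and "S_F = scalar_curvature F"
    and "S = scalar_curvature (bcwp B F \<mu> \<psi>)"
  shows
    "(\<mu> \<noteq> - real k / (real m - 1) \<and> \<not> (m = 2 \<and> k = 0) \<longrightarrow>
       (let \<alpha> = 2 * (real k + (real m - 1) * \<mu>) /
                 (((real k + (real m - 1) * \<mu>) + (1 - \<mu>)) * real k
                    + (real m - 2) * \<mu> * (real k + (real m - 1) * \<mu>));
            \<beta> = 2 * \<alpha> * (real k + (real m - 1) * \<mu>)
        in \<beta> > 0 \<and>
           (\<forall>u :: 'a \<Rightarrow> real.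
              (\<forall>p \<in> points B. u p > 0 \<and> \<psi> p = u p powr \<alpha>) \<longrightarrow>
              (\<forall>p \<in> points B. \<forall>q \<in> points F.
                 - \<beta> * laplacian B u p + S_B p * u p =
                   S (p, q) * u p powr (2 * \<mu> * \<alpha> + 1)
                   - S_F q * u p powr (2 * (\<mu> - 1) * \<alpha> + 1)))))
     \<and>
     (\<mu> = - real k / (real m - 1) \<longrightarrow>
       (\<forall>p \<in> points B. \<forall>q \<in> points F.
          - (- (real k)\<^sup>2 * ((real m - 2) / (real m - 1)) + real k * (real k + 1))
              * (grad_norm_sq B \<psi> p / (\<psi> p)\<^sup>2) =
            \<psi> p powr (- 2 * (real k / (real m - 1))) * S (p, q) - S_B p
            - S_F q * \<psi> p powr (- 2 * (real k / (real m - 1) + 1))))"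
proof -
  define A where "A = real k + (real m - 1) * \<mu>"
  define D where "D = (A + (1 - \<mu>)) * real k + (real m - 2) * \<mu> * A"
  have m: "real m - 1 > 0" "real m - 2 \<ge> 0" using \<open>m \<ge> 2\<close> by auto
  \<comment> \<open>In this form D is visibly a sum of nonnegative terms over a positive
    denominator.\<close>
  have D: "D = ((real m - 2) * A\<^sup>2 + real k * (real k + real m - 1)) / (real m - 1)"
    unfolding D_def A_def by (rule denominator_eq[OF \<open>m \<ge> 2\<close>])
  have A_zero: "A = 0 \<longleftrightarrow> \<mu> = - real k / (real m - 1)"
    using m by (auto simp: A_def field_simps)
  have S: "\<psi> p powr (2 * \<mu>) * S (p, q) = S_B p + \<psi> p powr (2 * (\<mu> - 1)) * S_F q
      - 2 * A * laplacian B (\<lambda>p. ln (\<psi> p)) p - D * (grad_norm_sq B \<psi> p / (\<psi> p)\<^sup>2)"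
    if "p \<in> points B" "q \<in> points F" for p q
    using scalar_curvature_bcwp[OF assms(1,2,6,7) that, of \<mu>] assms by (simp add: A_def D_def)
  show ?thesis
    unfolding A_def[symmetric] D_def[symmetric] Let_def
  proof (intro conjI impI allI ballI)
    assume gen: "\<mu> \<noteq> - real k / (real m - 1) \<and> \<not> (m = 2 \<and> k = 0)"
    then have A: "A \<noteq> 0" by (simp add: A_zero)
    \<comment> \<open>For m = 2 positivity comes from k > 0, otherwise from A \<noteq> 0. For m = 2
      and k = 0 one has D = 0, so the quotient defining \<alpha> breaks down; this is the pair set
      apart in the statement.\<close>
    have D_pos: "D > 0"
    proof (cases "m = 2")
      case True
      then show ?thesis using gen by (simp add: D)
    next
      case False
      then have "(real m - 2) * A\<^sup>2 > 0" using A \<open>m \<ge> 2\<close> by simp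
      moreover have "real k * (real k + real m - 1) \<ge> 0" using m by simp
      ultimately show ?thesis unfolding D using m(1) by (intro divide_pos_pos add_pos_nonneg)
    qed
    have "2 * (2 * A / D) * A = 4 * A\<^sup>2 / D" by (simp add: power2_eq_square)
    also have "\<dots> > 0" using A D_pos by simp
    finally show "2 * (2 * A / D) * A > 0" .
    fix u p q
    assume u: "\<forall>p\<in>points B. u p > 0 \<and> \<psi> p = u p powr (2 * A / D)"
      and p: "p \<in> points B" and q: "q \<in> points F"
    define \<alpha> where "\<alpha> = 2 * A / D"
    define L where "L = laplacian B (\<lambda>p. ln (\<psi> p)) p"
    define N where "N = grad_norm_sq B \<psi> p / (\<psi> p)\<^sup>2"
    have \<alpha>: "\<alpha> \<noteq> 0" using A D_pos by (simp add: \<alpha>_def)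
    have u_pos: "u p > 0" and \<psi>: "\<psi> p = u p powr \<alpha>" using u p by (auto simp: \<alpha>_def)
    have lap: "laplacian B u p = u p * (L / \<alpha> + N / \<alpha>\<^sup>2)"
      unfolding L_def N_def by (rule laplacian_powr[OF assms(1,6,7) u[folded \<alpha>_def] \<alpha> p])
    have "2 * \<alpha> * A * (L / \<alpha> + N / \<alpha>\<^sup>2) = 2 * A * L + 2 * A / \<alpha> * N"
      using \<alpha> by (simp add: field_simps power2_eq_square)
    \<comment> \<open>The equation that determines \<alpha>: the gradient term in \<beta> \<Delta>u
      / u gets the same coefficient D as in the curvature formula.\<close>
    also have "2 * A / \<alpha> = D" using A by (simp add: \<alpha>_def)
    finally have \<beta>: "2 * \<alpha> * A * (L / \<alpha> + N / \<alpha>\<^sup>2) = 2 * A * L + D * N" .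
    \<comment> \<open>The summand 1 in the exponents of u is the common factor u of the
      equation.\<close>
    have powr: "u p powr (a * \<alpha> + 1) = u p * \<psi> p powr a" for a
      using u_pos by (simp add: \<psi> powr_powr powr_add mult.commute)
    have "- (2 * \<alpha> * A) * laplacian B u p + S_B p * u p = u p * (S_B p - 2 * \<alpha> * A * (L / \<alpha> + N / \<alpha>\<^sup>2))"
      unfolding lap by (simp add: algebra_simps)
    also have "\<dots> = u p * (\<psi> p powr (2 * \<mu>) * S (p, q) - \<psi> p powr (2 * (\<mu> - 1)) * S_F q)"
      unfolding \<beta> unfolding S[OF p q] L_def N_def by simp
    also have "\<dots> = S (p, q) * u p powr (2 * \<mu> * \<alpha> + 1) - S_F q * u p powr (2 * (\<mu> - 1) * \<alpha> + 1)"
      unfolding powr by (simp add: algebra_simps)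
    finally show "- (2 * (2 * A / D) * A) * laplacian B u p + S_B p * u p =
        S (p, q) * u p powr (2 * \<mu> * (2 * A / D) + 1) - S_F q * u p powr (2 * (\<mu> - 1) * (2 * A / D)
            + 1)"
      unfolding \<alpha>_def .
  next
    fix p q assume \<mu>: "\<mu> = - real k / (real m - 1)" and p: "p \<in> points B" and q: "q \<in> points F"
    have A: "A = 0" using \<mu> by (simp add: A_zero)
    \<comment> \<open>At A = 0 only k (k + m - 1) / (m - 1) remains of D, which is the stated
      constant written differently.\<close>
    have D_eq: "D = - (real k)\<^sup>2 * ((real m - 2) / (real m - 1)) + real k * (real k + 1)"
      unfolding D A using m(1) by (simp add: field_simps power2_eq_square)
    have exponents: "2 * \<mu> = - 2 * (real k / (real m - 1))" "2 * (\<mu> - 1) = - 2 * (real k / (real m -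
        1) + 1)"
      by (simp_all add: \<mu>)
    \<comment> \<open>The product with 0 is the Laplacian term, whose coefficient A
      vanishes.\<close>
    have rearrange: "a = b + c * d - 2 * 0 * l - e * n \<Longrightarrow> - e * n = a - b - d * c" for a b c d e l n
        :: real
      by simp
    show "- (- (real k)\<^sup>2 * ((real m - 2) / (real m - 1)) + real k * (real k + 1))
        * (grad_norm_sq B \<psi> p / (\<psi> p)\<^sup>2) =
      \<psi> p powr (- 2 * (real k / (real m - 1))) * S (p, q) - S_B p
      - S_F q * \<psi> p powr (- 2 * (real k / (real m - 1) + 1))"
      by (rule rearrange[OF S[OF p q, unfolded D_eq exponents A]])
  qed
qed

end
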